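(* For any $p<2$ and any $j\in\mathbb{N}\smallsetminus\{0\}$ there exists a map $$g\in W^{1,p}\cap W^{1,(2,\infty)}_{\mathrm{loc}}(D^2,\mathbb{S}^1)\cap C^0(\overline{D^2})$$ satisfying $$\operatorname{div}(i\overline g\nabla g)=0\quad\text{and}\quad \operatorname{div}(i\overline g\nabla^\perp g)=2\pi\sum_{k=1}^\infty\delta_{p_k}\quad\text{in }D^2$$ for isolated points $p_k\in D^2$, and a map $u\in C^{\sqrt{j^2+j}}(D^2,\mathbb{C})$ satisfying $$\operatorname{div}(g\nabla u)=0\quad\text{in }D^2 .$$ Moreover, $u$ is smooth away from the points $p_k$, $\nabla u$ vanishes at isolated points, and the trace of $u$ on $\partial D^2$ is smooth.
   Context: $D^2\subset\mathbb{R}^2\cong\mathbb{C}$ is the open unit disc centered at the origin, with coordinates $(x_1,x_2)$; $\mathbb{S}^1\subset\mathbb{C}$ is the unit circle; $\overline g$ is the complex conjugate of $g$; $\nabla^\perp:=(-\partial_{x_2},\partial_{x_1})^T$; $\delta_q$ is the Dirac mass at $q$. All equations are in the sense of distributions on $D^2$. The points $p_k$, $k=1,2,3,\dots$, form an infinite sequence; isolated means without accumulation points in the open disc $D^2$ (accumulation at $\partial D^2$ is allowed). For non-integer $a>0$, $C^a(D^2)$ denotes the Hölder space $C^{\lfloor a\rfloor,\,a-\lfloor a\rfloor}(D^2)$. $g\in W^{1,(2,\infty)}_{\mathrm{loc}}(D^2)$ means that $\nabla g\in L^{2,\infty}_{\mathrm{loc}}(D^2)$ (weak $L^2$). The trace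 of $u$ is its boundary value on $\partial D^2$.
   Formalization: Continuity of g on the closed disc is impossible (a continuous g would lift, making div(i ḡ∇^⊥g)=0), so it is required only on the closed disc minus the closure of {p_k}; p is taken with 1 ≤ p < 2. *)

theory Defs
  imports "HOL-Analysis.Analysis"
begin

text \<open>
  The plane is identified with the type of complex numbers, \<open>x\<^sub>1 = Re z\<close> and \<open>x\<^sub>2 = Im z\<close>, so the
  coordinate directions are \<open>1\<close> and \<open>\<i>\<close> (which together form \<open>Basis\<close>).
\<close>

abbreviation D2 :: "complex set" where
  "D2 \<equiv> ball 0 1"

definition partial :: "'a::euclidean_space \<Rightarrow> ('a \<Rightarrow> 'b::real_normed_vector) \<Rightarrow> 'a \<Rightarrow> 'b" where
  "partial b f x = frechet_derivative f (at x) b"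

abbreviation partials :: "'a::euclidean_space list \<Rightarrow> ('a \<Rightarrow> 'b::real_normed_vector) \<Rightarrow> 'a \<Rightarrow> 'b" where
  "partials bs f \<equiv> foldr partial bs f"

text \<open>The next two notions are meant for open sets \<open>S\<close> only.\<close>

primrec Ck_on :: "nat \<Rightarrow> 'a::euclidean_space set \<Rightarrow> ('a \<Rightarrow> 'b::real_normed_vector) \<Rightarrow> bool" where
  "Ck_on 0 S f \<longleftrightarrow> continuous_on S f"
| "Ck_on (Suc k) S f \<longleftrightarrow>
     (\<forall>x\<in>S. f differentiable at x) \<and> (\<forall>b\<in>Basis. Ck_on k S (partial b f))"

definition smooth_on :: "'a::euclidean_space set \<Rightarrow> ('a \<Rightarrow> 'b::real_normed_vector) \<Rightarrow> bool" where
  "smooth_on S f \<longleftrightarrow> (\<forall>k. Ck_on k S f)"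

text \<open>
  For non-integer \<open>a > 0\<close>, the space \<open>C\<^sup>a(S)\<close> of functions with finite Hoelder norm, where the norm
  is the global one on \<open>S\<close> (not a family of seminorms on compact subsets).
\<close>

definition holder_space ::
    "real \<Rightarrow> 'a::euclidean_space set \<Rightarrow> ('a \<Rightarrow> 'b::real_normed_vector) set" where
  "holder_space a S = {f.
     Ck_on (nat \<lfloor>a\<rfloor>) S f \<and>
     (\<forall>bs. set bs \<subseteq> Basis \<and> length bs \<le> nat \<lfloor>a\<rfloor> \<longrightarrow> bounded (partials bs f ` S)) \<and>
     (\<forall>bs. set bs \<subseteq> Basis \<and> length bs = nat \<lfloor>a\<rfloor> \<longrightarrow>
        (\<exists>C. \<forall>x\<in>S. \<forall>y\<in>S.
           norm (partials bs f x - partials bs f y) \<le> C * dist x y powr (a - \<lfloor>a\<rfloor>)))}"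

text \<open>
  Test functions are real-valued; a complex-valued distribution is determined by its values on them.
\<close>

definition test_functions :: "complex set \<Rightarrow> (complex \<Rightarrow> real) set" where
  "test_functions \<Omega> =
     {\<phi>. smooth_on UNIV \<phi> \<and> (\<exists>K. compact K \<and> K \<subseteq> \<Omega> \<and> (\<forall>z. z \<notin> K \<longrightarrow> \<phi> z = 0))}"

definition locally_integrable_on ::
    "complex set \<Rightarrow> (complex \<Rightarrow> 'b::{banach, second_countable_topology}) \<Rightarrow> bool" where
  "locally_integrable_on \<Omega> f \<longleftrightarrow> (\<forall>K. compact K \<and> K \<subseteq> \<Omega> \<longrightarrow> set_integrable lborel K f)"

text \<open>Vector fields, and gradients of complex-valued functions, take values in pairs.\<close>

definition has_weak_gradient ::
    "complex set \<Rightarrow> (complex \<Rightarrow> complex) \<Rightarrow> (complex \<Rightarrow> complex \<times> complex) \<Rightarrow> bool" where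
  "has_weak_gradient \<Omega> f F \<longleftrightarrow>
     locally_integrable_on \<Omega> f \<and> locally_integrable_on \<Omega> F \<and>
     (\<forall>\<phi>\<in>test_functions \<Omega>.
        (LINT z:\<Omega>|lborel. \<phi> z *\<^sub>R fst (F z)) = - (LINT z:\<Omega>|lborel. partial 1 \<phi> z *\<^sub>R f z) \<and>
        (LINT z:\<Omega>|lborel. \<phi> z *\<^sub>R snd (F z)) = - (LINT z:\<Omega>|lborel. partial \<i> \<phi> z *\<^sub>R f z))"

definition grad :: "(complex \<Rightarrow> complex) \<Rightarrow> complex \<Rightarrow> complex \<times> complex" where
  "grad f z = (partial 1 f z, partial \<i> f z)"

text \<open>If \<open>F = \<nabla>f\<close> then \<open>perp F = \<nabla>\<^sup>\<bottom>f = (- \<partial>\<^sub>2 f, \<partial>\<^sub>1 f)\<close>.\<close>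

definition perp :: "(complex \<Rightarrow> complex \<times> complex) \<Rightarrow> complex \<Rightarrow> complex \<times> complex" where
  "perp F z = (- snd (F z), fst (F z))"

definition field_mult ::
    "(complex \<Rightarrow> complex) \<Rightarrow> (complex \<Rightarrow> complex \<times> complex) \<Rightarrow> complex \<Rightarrow> complex \<times> complex" where
  "field_mult h F z = (h z * fst (F z), h z * snd (F z))"

text \<open>The distribution \<open>div X\<close> of a locally integrable field \<open>X\<close>, acting on test functions.\<close>

definition distr_div ::
    "complex set \<Rightarrow> (complex \<Rightarrow> complex \<times> complex) \<Rightarrow> (complex \<Rightarrow> real) \<Rightarrow> complex" where
  "distr_div \<Omega> X \<phi> =
     - (LINT z:\<Omega>|lborel. partial 1 \<phi> z *\<^sub>R fst (X z) + partial \<i> \<phi> z *\<^sub>R snd (X z))"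

definition dirac :: "complex \<Rightarrow> (complex \<Rightarrow> real) \<Rightarrow> complex" where
  "dirac q \<phi> = complex_of_real (\<phi> q)"

definition Lp_on ::
    "real \<Rightarrow> complex set \<Rightarrow> (complex \<Rightarrow> 'b::{banach, second_countable_topology}) \<Rightarrow> bool" where
  "Lp_on p A f \<longleftrightarrow>
     set_borel_measurable lborel A f \<and> set_integrable lborel A (\<lambda>z. norm (f z) powr p)"

text \<open>Weak \<open>L\<^sup>2\<close>: the quasi-norm \<open>sup {t * |{|f| > t}|\<^bsup>1/2\<^esup> | t > 0}\<close> is finite.\<close>

definition weak_L2_on ::
    "complex set \<Rightarrow> (complex \<Rightarrow> 'b::{banach, second_countable_topology}) \<Rightarrow> bool" where
  "weak_L2_on A f \<longleftrightarrow>
     set_borel_measurable lborel A f \<and>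
     (\<exists>C. \<forall>t>0. emeasure lborel {z\<in>A. t < norm (f z)} \<le> ennreal (C / t\<^sup>2))"

definition weak_L2_loc ::
    "complex set \<Rightarrow> (complex \<Rightarrow> 'b::{banach, second_countable_topology}) \<Rightarrow> bool" where
  "weak_L2_loc \<Omega> f \<longleftrightarrow> (\<forall>K. compact K \<and> K \<subseteq> \<Omega> \<longrightarrow> weak_L2_on K f)"

definition isolated_points_in :: "complex set \<Rightarrow> complex set \<Rightarrow> bool" where
  "isolated_points_in \<Omega> Z \<longleftrightarrow> Z \<subseteq> \<Omega> \<and> (\<forall>z\<in>\<Omega>. \<not> (z islimpt Z))"

definition has_boundary_trace :: "(complex \<Rightarrow> complex) \<Rightarrow> (complex \<Rightarrow> complex) \<Rightarrow> bool" where
  "has_boundary_trace u \<tau> \<longleftrightarrow> (\<forall>\<zeta>\<in>sphere 0 1. (u \<longlongrightarrow> \<tau> \<zeta>) (at \<zeta> within D2))"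

text \<open>Smoothness on the unit circle is smoothness in the angle.\<close>

definition smooth_on_circle :: "(complex \<Rightarrow> complex) \<Rightarrow> bool" where
  "smooth_on_circle \<tau> \<longleftrightarrow> smooth_on UNIV (\<lambda>\<theta>::real. \<tau> (cis \<theta>))"

text \<open>
  Continuity up to the boundary of a unit-modulus map \<open>g\<close> with vortices at the points of \<open>Q\<close>.
  Around each vortex \<open>g\<close> has winding number 1, so on every neighbourhood of a point of \<open>closure Q\<close>
  it takes every value of the unit circle and has no continuous representative there.
  Hence \<open>C\<^sup>0\<close> on the closed disc can only refer to the complement of \<open>closure Q\<close>, which contains
  the boundary points at which the vortices do not accumulate.
\<close>

definition continuous_up_to_boundary_off :: "complex set \<Rightarrow> (complex \<Rightarrow> complex) \<Rightarrow> bool" where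
  "continuous_up_to_boundary_off Q g \<longleftrightarrow> continuous_on (closure D2 - closure Q) g"

end

theory Submission
  imports Defs "HOL-Complex_Analysis.Complex_Analysis"
begin

text \<open>
  Around one vortex, \<open>g = z / |z|\<close> and \<open>u = |z| powr a * (z / |z|) ^ j\<close> with \<open>a\<^sup>2 = j\<^sup>2 + j\<close> solve
  \<open>div (g \<nabla>u) = 0\<close>. All equations are conformally invariant, so both maps may be composed with a
  holomorphic function \<open>h\<close> on the disc that has infinitely many zeros, all of them simple: every zero
  becomes a vortex of \<open>g = h / |h|\<close>, and \<open>|\<nabla>g| = |h' / h|\<close>. We take
  \<open>h z = exp (- L\<^sup>2) * sin (\<pi> L)\<close> with \<open>L = ln (1 - z)\<close>, whose zeros are \<open>1 - exp (- k)\<close>. The first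
  factor makes \<open>h\<close> flat at the accumulation point \<open>1\<close>, which yields the global regularity of \<open>u\<close> and of
  its trace, but it contributes only \<open>2 L / (1 - z)\<close> to \<open>h' / h\<close>, which lies in every \<open>L\<^sup>p\<close> with \<open>p < 2\<close>.
\<close>

section \<open>Partial derivatives and test functions\<close>

text \<open>For \<open>u = r^a exp (i j \<theta>)\<close> and \<open>g = exp (i \<theta>)\<close>
  one finds \<open>div (g \<nabla>u) = (a^2 - j^2 - j) r^(-2) g u\<close>: the Laplacian contributes
  \<open>a^2 - j^2\<close>, and \<open>\<nabla>g / g\<close> paired with the angular derivative
  contributes \<open>- j\<close>. This fixes \<open>a\<close>. Two obstacles shape the proof. The
  vortices accumulate at a boundary point, and flatness of \<open>h\<close> there competes with
  integrability of \<open>h' / h\<close>: a factor \<open>exp (- (1 - z) powr (- s))\<close> would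
  add a multiple of \<open>(1 - z) powr (- 1 - s)\<close>, which is p-integrable only for
  \<open>p * (1 + s) < 2\<close>. The Gaussian in \<open>L\<close> serves all \<open>p < 2\<close>
  at once; it decays because \<open>Im L\<close> stays bounded by \<open>pi / 2\<close>, and it
  beats every power of \<open>|1 - z|\<close>. Moreover, all fields are singular at the vortices,
  where the pointwise identities say nothing: the weak formulation has to show that
  \<open>div (g \<nabla>u)\<close> carries no mass there, while the divergence of the rotated field
  carries exactly \<open>2 * pi\<close>.\<close>

lemma partial_eq: "(f has_derivative f') (at x) \<Longrightarrow> partial b f x = f' b"
  unfolding partial_def by (metis frechet_derivative_at)

lemma partial_cong_open:
  assumes "open S" "x \<in> S" "\<And>y. y \<in> S \<Longrightarrow> f y = g y"
  shows "partial b f x = partial b g x"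
proof -
  have "(f has_derivative f') (at x) = (g has_derivative f') (at x)" for f'
    using has_derivative_transform_within_open[OF _ assms(1,2), of f f' UNIV g]
      has_derivative_transform_within_open[OF _ assms(1,2), of g f' UNIV f] assms(3) by auto
  then show ?thesis unfolding partial_def frechet_derivative_def by simp
qed

lemma differentiable_cong_open:
  assumes "open S" "x \<in> S" "\<And>y. y \<in> S \<Longrightarrow> f y = g y" "f differentiable at x"
  shows "g differentiable at x"
  using assms has_derivative_transform_within_open[OF _ assms(1,2), of f _ UNIV g]
  unfolding differentiable_def by blast

lemma Ck_on_cong:
  assumes "open S" "\<And>y. y \<in> S \<Longrightarrow> f y = g y" "Ck_on k S f"
  shows "Ck_on k S g"
  using assms(2,3)
proof (induction k arbitrary: f g)
  case 0
  then show ?case using continuous_on_cong[of S S f g] by auto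
next
  case (Suc k)
  have "Ck_on k S (partial b g)" if "b \<in> Basis" for b
    using Suc.IH[of "partial b f" "partial b g"] Suc.prems that
      partial_cong_open[OF assms(1) _ Suc.prems(1)] by auto
  then show ?case using Suc.prems differentiable_cong_open[OF assms(1) _ Suc.prems(1)] by auto
qed

lemma test_function_differentiable:
  assumes "\<phi> \<in> test_functions \<Omega>"
  shows "\<phi> differentiable at x"
proof -
  have "Ck_on (Suc 0) UNIV \<phi>" using assms unfolding test_functions_def smooth_on_def by blast
  then show ?thesis by simp
qed

lemma test_function_continuous:
  assumes "\<phi> \<in> test_functions \<Omega>"
  shows "continuous_on A \<phi>"
  using test_function_differentiable[OF assms]
  by (simp add: continuous_at_imp_continuous_on differentiable_imp_continuous_within)

lemma test_function_partial_continuous: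
  assumes "\<phi> \<in> test_functions \<Omega>" "b \<in> Basis"
  shows "continuous_on A (partial b \<phi>)"
proof -
  have "Ck_on (Suc 0) UNIV \<phi>" using assms unfolding test_functions_def smooth_on_def by blast
  then show ?thesis using assms(2) continuous_on_subset by fastforce
qed

text \<open>Off the closed set \<open>K\<close> the function vanishes on a neighbourhood, so its
  partial derivatives vanish there as well and one \<open>K\<close> serves for all of them.\<close>

lemma test_functionE:
  assumes "\<phi> \<in> test_functions \<Omega>"
  obtains K where "compact K" "K \<subseteq> \<Omega>" "\<And>z. z \<notin> K \<Longrightarrow> \<phi> z = 0"
    "\<And>b z. z \<notin> K \<Longrightarrow> partial b \<phi> z = 0"
proof -
  obtain K where K: "compact K" "K \<subseteq> \<Omega>" "\<And>z. z \<notin> K \<Longrightarrow> \<phi> z = 0"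
    using assms unfolding test_functions_def by blast
  have "partial b \<phi> z = 0" if "z \<notin> K" for b z
  proof -
    have "open (-K)" using K(1) by (simp add: compact_imp_closed open_Compl)
    then have "partial b \<phi> z = partial b (\<lambda>_. 0) z"
      using partial_cong_open[of "-K" z \<phi> "\<lambda>_. 0" b] K(3) that by auto
    also have "\<dots> = 0" by (rule partial_eq) (rule has_derivative_const)
    finally show ?thesis .
  qed
  with K that show ?thesis by blast
qed

section \<open>Homogeneous functions on the plane\<close>

text \<open>Since \<open>0 powr c = 0\<close> for every \<open>c\<close>, all these functions vanish at \<open>0\<close>, even \<open>homog 0 m\<close>.\<close>

definition homog :: "real \<Rightarrow> int \<Rightarrow> complex \<Rightarrow> complex" where
  "homog c m \<zeta> = of_real (norm \<zeta> powr c) * sgn \<zeta> powi m"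

lemma homog_0 [simp]: "homog c m 0 = 0"
  by (simp add: homog_def)

lemma norm_homog: "\<zeta> \<noteq> 0 \<Longrightarrow> norm (homog c m \<zeta>) = norm \<zeta> powr c"
  by (simp add: homog_def norm_mult norm_power_int norm_sgn)

lemma norm_homog_le: "norm (homog c m \<zeta>) \<le> norm \<zeta> powr c"
  by (cases "\<zeta> = 0") (auto simp: norm_homog)

lemma homog_mult: "homog c m \<zeta> * homog d n \<zeta> = homog (c + d) (m + n) \<zeta>"
  by (cases "\<zeta> = 0") (auto simp: homog_def powr_add power_int_add sgn_zero_iff)

lemma cnj_homog: "cnj (homog c m \<zeta>) = homog c (-m) \<zeta>"
proof (cases "\<zeta> = 0")
  case False
  have "cnj (sgn \<zeta>) = inverse (sgn \<zeta>)"
    using False complex_norm_square[of "sgn \<zeta>"] by (intro inverse_unique[symmetric]) (simp add: norm_sgn)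
  moreover have "cnj (w powi m) = cnj w powi m" for w
    by (simp add: power_int_def)
  ultimately show ?thesis by (simp add: homog_def power_int_minus power_int_inverse)
qed auto

lemma homog_1_1: "\<zeta> \<noteq> 0 \<Longrightarrow> homog 1 1 \<zeta> = \<zeta>"
  by (simp add: homog_def sgn_div_norm scaleR_conv_of_real)

lemma homog_m1_m1: "homog (-1) (-1) \<zeta> = inverse \<zeta>"
  by (cases "\<zeta> = 0") (auto simp: homog_def power_int_minus sgn_div_norm scaleR_conv_of_real powr_minus)

text \<open>Formally \<open>homog c m \<zeta>\<close> is \<open>\<zeta>\<close> to the power
  \<open>(c + m) / 2\<close> times \<open>cnj \<zeta>\<close> to the power
  \<open>(c - m) / 2\<close>; the two coefficients are these exponents. Each Wirtinger derivative
  lowers the degree \<open>c\<close> by one and shifts the frequency \<open>m\<close> by one, so up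
  to constants the family is closed under differentiation.\<close>

lemma homog_has_derivative_nz:
  assumes "\<zeta> \<noteq> 0"
  shows "(homog c m has_derivative (\<lambda>v. of_real ((c + m) / 2) * homog (c-1) (m-1) \<zeta> * v
           + of_real ((c - m) / 2) * homog (c-1) (m+1) \<zeta> * cnj v)) (at \<zeta>)"
proof -
  \<comment> \<open>Trading the phase for an integer power of \<open>x\<close> leaves a real power
    of the norm, so two standard derivatives suffice.\<close>
  have eq: "homog c m x = of_real (norm x powr (c - m)) * x powi m" if "x \<noteq> 0" for x
  proof -
    have "sgn x powi m = x powi m * of_real (norm x powi (-m))"
      using that by (simp add: sgn_div_norm scaleR_conv_of_real power_int_mult_distrib power_int_inverse power_int_minus
        field_simps power_int_divide_distrib)
    moreover have "norm x powr (c - m) = norm x powr c * norm x powi (-m)"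
      using that by (simp add: powr_diff power_int_minus powr_real_of_int' field_simps)
    ultimately show ?thesis by (simp add: homog_def)
  qed
  \<comment> \<open>The radial derivative is rewritten through \<open>v\<close> and
    \<open>cnj v\<close>, which brings the derivative of the norm into Wirtinger form.\<close>
  have i: "of_real (inner (sgn \<zeta>) v) = (cnj (sgn \<zeta>) * v + sgn \<zeta> * cnj v) / 2" for v
    by (simp add: complex_eq_iff inner_complex_def add_divide_distrib diff_divide_distrib)
  have "((\<lambda>x. of_real (norm x powr (c - m)) * x powi m) has_derivative
     (\<lambda>v. of_real (norm \<zeta> powr (c - m)) * (of_int m * \<zeta> powi (m - 1) * v)
        + of_real ((c - m) * norm \<zeta> powr (c - m - 1)) * of_real (inner (sgn \<zeta>) v) * \<zeta> powi m)) (at \<zeta>)"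
  proof -
    have "((\<lambda>t. t powr (c - m)) has_derivative (*) ((c - m) * norm \<zeta> powr (c - m - 1))) (at (norm \<zeta>))"
      using has_real_derivative_powr[of "norm \<zeta>" "c - m"] assms
      by (simp add: has_field_derivative_def)
    from has_derivative_compose[OF has_derivative_norm[OF assms] this]
    have "((\<lambda>x. norm x powr (c - m)) has_derivative (\<lambda>v. ((c - m) * norm \<zeta> powr (c - m - 1)) * inner v (sgn \<zeta>))) (at \<zeta>)"
      by simp
    moreover have "((\<lambda>x. x powi m) has_derivative (*) (of_int m * \<zeta> powi (m - 1))) (at \<zeta>)"
      using DERIV_power_int[OF DERIV_ident disjI2[OF assms], of m] by (simp add: has_field_derivative_def)
    ultimately show ?thesis
      by (rule has_derivative_eq_rhs[OF has_derivative_mult[OF has_derivative_of_real]]) (simp add: fun_eq_iff inner_commute algebra_simps)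
  qed
  moreover have "(\<lambda>v. of_real (norm \<zeta> powr (c - m)) * (of_int m * \<zeta> powi (m - 1) * v)
        + of_real ((c - m) * norm \<zeta> powr (c - m - 1)) * of_real (inner (sgn \<zeta>) v) * \<zeta> powi m) =
     (\<lambda>v. of_real ((c + m) / 2) * homog (c-1) (m-1) \<zeta> * v
           + of_real ((c - m) / 2) * homog (c-1) (m+1) \<zeta> * cnj v)"
  proof
    fix v
    define r where "r = norm \<zeta>"
    define \<sigma> where "\<sigma> = sgn \<zeta>"
    have r: "r > 0" and s0: "\<sigma> \<noteq> 0" using assms by (auto simp: r_def \<sigma>_def sgn_zero_iff)
    have z: "\<zeta> = of_real r * \<sigma>" using assms by (simp add: r_def \<sigma>_def sgn_div_norm scaleR_conv_of_real)
    have cs: "cnj \<sigma> = inverse \<sigma>"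
      using assms complex_norm_square[of "sgn \<zeta>"] unfolding \<sigma>_def
      by (intro inverse_unique[symmetric]) (simp add: norm_sgn)
    have pr: "r powi k * r powr d = r powr (d + k)" for k d
      using r by (simp add: powr_add powr_real_of_int')
    have e1: "\<zeta> powi k = of_real (r powi k) * \<sigma> powi k" for k
      by (simp add: z power_int_mult_distrib)
    have AB: "of_real (r powr d) * \<zeta> powi k = of_real (r powr (d + k)) * \<sigma> powi k" for d k
      unfolding pr[symmetric] e1 by (simp only: of_real_mult ac_simps)
    have A: "of_real (r powr (c - m)) * \<zeta> powi (m - 1) = of_real (r powr (c - 1)) * \<sigma> powi (m-1)"
      using AB[of "c - m" "m - 1"] by simp
    have B: "of_real (r powr (c - m - 1)) * \<zeta> powi m = of_real (r powr (c - 1)) * \<sigma> powi m"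
      using AB[of "c - m - 1" m] by simp
    have C: "\<sigma> powi (m - 1) = \<sigma> powi m * inverse \<sigma>" "\<sigma> powi (m + 1) = \<sigma> powi m * \<sigma>"
      using s0 by (simp_all add: power_int_diff power_int_add divide_inverse)
    have "of_real (r powr (c - m)) * (of_int m * \<zeta> powi (m - 1) * v)
        + of_real ((c - m) * r powr (c - m - 1)) * of_real (inner \<sigma> v) * \<zeta> powi m
       = of_int m * v * (of_real (r powr (c - m)) * \<zeta> powi (m - 1)) +
         of_real (c - m) * of_real (inner \<sigma> v) * (of_real (r powr (c - m - 1)) * \<zeta> powi m)"
      by (simp only: of_real_mult ac_simps)
    also have "\<dots> = of_int m * v * (of_real (r powr (c - 1)) * (\<sigma> powi m * inverse \<sigma>)) +
         of_real (c - m) * ((inverse \<sigma> * v + \<sigma> * cnj v) / 2) * (of_real (r powr (c - 1)) * \<sigma> powi m)"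
      by (simp only: A B C i[folded \<sigma>_def] cs)
    also have "\<dots> = of_real ((c + m) / 2) * (of_real (r powr (c - 1)) * (\<sigma> powi m * inverse \<sigma>)) * v
           + of_real ((c - m) / 2) * (of_real (r powr (c - 1)) * (\<sigma> powi m * \<sigma>)) * cnj v"
    proof -
      have k: "of_real ((c + m) / 2) = of_int m + (of_real (c - m) / 2 :: complex)"
        by (simp add: add_divide_distrib diff_divide_distrib)
      have d: "of_real ((c - m) / 2) = (of_real (c - m) / 2 :: complex)"
        by simp
      show ?thesis unfolding k d
        by (simp only: distrib_left distrib_right times_divide_eq_left times_divide_eq_right add_divide_distrib ac_simps)
    qed
    finally show "of_real (norm \<zeta> powr (c - m)) * (of_int m * \<zeta> powi (m - 1) * v)
        + of_real ((c - m) * norm \<zeta> powr (c - m - 1)) * of_real (inner (sgn \<zeta>) v) * \<zeta> powi m =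
       of_real ((c + m) / 2) * homog (c-1) (m-1) \<zeta> * v
           + of_real ((c - m) / 2) * homog (c-1) (m+1) \<zeta> * cnj v"
      unfolding homog_def r_def[symmetric] \<sigma>_def[symmetric] C .
  qed
  ultimately have "((\<lambda>x. of_real (norm x powr (c - m)) * x powi m) has_derivative
     (\<lambda>v. of_real ((c + m) / 2) * homog (c-1) (m-1) \<zeta> * v
           + of_real ((c - m) / 2) * homog (c-1) (m+1) \<zeta> * cnj v)) (at \<zeta>)" by simp
  then show ?thesis
    by (rule has_derivative_transform_within_open[of _ _ _ _ "-{0}"]) (use assms eq in auto)
qed

lemma homog_has_derivative_0:
  assumes "c > 1"
  shows "(homog c m has_derivative (\<lambda>v. 0)) (at 0)"
proof -
  have "((\<lambda>v. norm v powr (c - 1)) \<longlongrightarrow> 0) (at (0::complex))"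
    using assms by (intro tendsto_zero_powrI[OF _ tendsto_const] tendsto_norm_zero tendsto_ident_at) auto
  moreover have "norm (norm (homog c m v) / norm v) \<le> norm v powr (c - 1)" for v
  proof (cases "v = 0")
    case False
    then have "norm v powr (c - 1) = norm v powr c / norm v" by (simp add: powr_diff)
    then show ?thesis using norm_homog_le[of c m v] by (simp add: divide_right_mono)
  qed auto
  ultimately have "((\<lambda>v. norm (homog c m v) / norm v) \<longlongrightarrow> 0) (at 0)"
    by (metis (no_types, lifting) Lim_null_comparison always_eventually)
  then show ?thesis by (simp add: has_derivative_at)
qed

text \<open>The convention \<open>homog c m 0 = 0\<close> makes the formula vanish at
  \<open>0\<close>, which is the correct derivative there once \<open>c > 1\<close>.\<close>

lemma homog_has_derivative:
  assumes "\<zeta> \<noteq> 0 \<or> c > 1"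
  shows "(homog c m has_derivative (\<lambda>v. of_real ((c + m) / 2) * homog (c-1) (m-1) \<zeta> * v
           + of_real ((c - m) / 2) * homog (c-1) (m+1) \<zeta> * cnj v)) (at \<zeta>)"
  using homog_has_derivative_nz[of \<zeta> c m] homog_has_derivative_0[of c m] assms by (cases "\<zeta> = 0") auto

lemma continuous_on_homog:
  assumes "c > 0"
  shows "continuous_on A (homog c m)"
proof (rule continuous_at_imp_continuous_on, rule ballI)
  fix \<zeta>
  show "isCont (homog c m) \<zeta>"
  proof (cases "\<zeta> = 0")
    case True
    have "((\<lambda>v. norm v powr c) \<longlongrightarrow> 0) (at (0::complex))"
      using assms by (intro tendsto_zero_powrI[OF _ tendsto_const] tendsto_norm_zero tendsto_ident_at) auto
    then have "((\<lambda>v. homog c m v) \<longlongrightarrow> 0) (at (0::complex))"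
      by (rule Lim_null_comparison[OF always_eventually, OF allI, OF norm_homog_le])
    then show ?thesis using True by (simp add: isCont_def)
  qed (use homog_has_derivative_nz has_derivative_continuous in blast)
qed

text \<open>If \<open>x\<close> and \<open>y\<close> are close compared with \<open>norm x\<close>,
  a ball around \<open>x\<close> that contains \<open>y\<close> avoids the singularity and the mean
  value inequality applies; otherwise both norms are at most a multiple of
  \<open>norm (x - y)\<close> and the size bound suffices. \<open>M\<close> enters since a power
  \<open>c > e\<close> is dominated by the power \<open>e\<close> only on bounded sets.\<close>

lemma homog_holder:
  assumes "0 < e" "e < 1" "e \<le> c"
  obtains C where "C \<ge> 0" "\<And>x y. norm x \<le> M \<Longrightarrow> norm y \<le> M \<Longrightarrow>
    norm (homog c m x - homog c m y) \<le> C * norm (x - y) powr e"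
proof -
  \<comment> \<open>The radius is doubled because the points used in the near case have norm at most
    \<open>2 * norm x\<close>.\<close>
  define B where "B = (2 * \<bar>M\<bar>) powr (c - e)"
  \<comment> \<open>The summands \<open>2\<close> and \<open>3\<close> come from
    \<open>norm x \<le> 2 * d\<close> and \<open>norm y \<le> 3 * d\<close> in the far case; the
    last term is the gradient bound of the near case.\<close>
  define C where "C = B * (2 + 3) + (\<bar>c\<bar> + \<bar>real_of_int m\<bar>) * B"
  have B0: "B \<ge> 0" by (simp add: B_def)
  have C0: "C \<ge> 0" using B0 unfolding C_def by (intro add_nonneg_nonneg mult_nonneg_nonneg) auto
  have pe: "t powr c \<le> B * t powr e" if "0 \<le> t" "t \<le> 2 * \<bar>M\<bar>" for t
  proof (cases "t = 0")
    case False
    have "t powr c = t powr (c - e) * t powr e" by (simp add: powr_add[symmetric])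
    also have "\<dots> \<le> B * t powr e" unfolding B_def
      using that assms by (intro mult_right_mono powr_mono2) auto
    finally show ?thesis .
  qed (use B0 in auto)
  have "norm (homog c m x - homog c m y) \<le> C * norm (x - y) powr e" if "norm x \<le> M" "norm y \<le> M" for x y
  proof (cases "norm (x - y) < norm x / 2")
    case True
    have x0: "x \<noteq> 0" using True by auto
    define K where "K = (\<bar>c\<bar> + \<bar>real_of_int m\<bar>) * (B * (norm x / 2) powr (e - 1))"
    have K: "norm (of_real ((c + m) / 2) * homog (c-1) (m-1) z * v
           + of_real ((c - m) / 2) * homog (c-1) (m+1) z * cnj v) \<le> K * norm v" if z: "z \<in> ball x (norm x / 2)" for z v
    proof -
      have zl: "norm x / 2 \<le> norm z" "norm z \<le> 2 * norm x"
        using z norm_triangle_ineq2[of x z] norm_triangle_ineq2[of z x] norm_ge_zero[of x]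
        unfolding mem_ball dist_norm norm_minus_commute[of z x] by linarith+
      then have z0: "z \<noteq> 0" using x0 by auto
      have "norm z powr (c - 1) = norm z powr c / norm z" using z0 by (simp add: powr_diff)
      also have "\<dots> \<le> B * norm z powr e / norm z"
        using zl \<open>norm x \<le> M\<close> by (intro divide_right_mono pe) auto
      also have "\<dots> = B * norm z powr (e - 1)" using z0 by (simp add: powr_diff)
      also have "\<dots> \<le> B * (norm x / 2) powr (e - 1)"
        using assms zl x0 B0 by (intro mult_left_mono powr_mono2') auto
      finally have *: "norm z powr (c - 1) \<le> B * (norm x / 2) powr (e - 1)" .
      have "norm (of_real ((c + m) / 2) * homog (c-1) (m-1) z * v
           + of_real ((c - m) / 2) * homog (c-1) (m+1) z * cnj v)
        \<le> \<bar>(c + m) / 2\<bar> * norm z powr (c-1) * norm v + \<bar>(c - m) / 2\<bar> * norm z powr (c-1) * norm v"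
        unfolding norm_mult norm_homog[OF z0] norm_of_real complex_mod_cnj
        by (intro order_trans[OF norm_triangle_ineq]) (simp only: norm_mult norm_homog[OF z0] norm_of_real complex_mod_cnj order.refl)
      also have "\<dots> = (\<bar>(c + m) / 2\<bar> + \<bar>(c - m) / 2\<bar>) * norm z powr (c-1) * norm v"
        by (simp add: algebra_simps)
      also have "\<dots> \<le> (\<bar>c\<bar> + \<bar>real_of_int m\<bar>) * (B * (norm x / 2) powr (e - 1)) * norm v"
      proof (intro mult_right_mono mult_mono *)
        show "\<bar>(c + m) / 2\<bar> + \<bar>(c - m) / 2\<bar> \<le> \<bar>c\<bar> + \<bar>real_of_int m\<bar>"
          using abs_triangle_ineq[of c m] abs_triangle_ineq4[of c m] by simp
      qed (use B0 in auto)
      finally show ?thesis by (simp add: K_def)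
    qed
    have K0: "K \<ge> 0" unfolding K_def using B0 by auto
    have "norm (homog c m x - homog c m y) \<le> K * norm (x - y)"
    proof (rule differentiable_bound[of "ball x (norm x / 2)" "homog c m"
          "\<lambda>z v. of_real ((c + m) / 2) * homog (c-1) (m-1) z * v
           + of_real ((c - m) / 2) * homog (c-1) (m+1) z * cnj v"])
      fix z assume z: "z \<in> ball x (norm x / 2)"
      have "z \<noteq> 0" using z x0 by (auto simp: dist_norm)
      then show "(homog c m has_derivative (\<lambda>v. of_real ((c + m) / 2) * homog (c-1) (m-1) z * v
           + of_real ((c - m) / 2) * homog (c-1) (m+1) z * cnj v)) (at z within ball x (norm x / 2))"
        using homog_has_derivative_nz has_derivative_at_withinI by blast
      show "onorm (\<lambda>v. of_real ((c + m) / 2) * homog (c-1) (m-1) z * v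
           + of_real ((c - m) / 2) * homog (c-1) (m+1) z * cnj v) \<le> K"
        by (rule onorm_bound[OF K0 K[OF z]])
    qed (use x0 True in \<open>auto simp: dist_norm\<close>)
    also have "\<dots> = (\<bar>c\<bar> + \<bar>real_of_int m\<bar>) * B * ((norm x / 2) powr (e - 1) * norm (x - y))"
      by (simp add: K_def)
    \<comment> \<open>As \<open>e - 1 < 0\<close>, the power at \<open>norm x / 2\<close> is at most
      the power at the smaller number \<open>norm (x - y)\<close>.\<close>
    also have "(norm x / 2) powr (e - 1) * norm (x - y) \<le> norm (x - y) powr e"
    proof (cases "x = y")
      case False
      have "(norm x / 2) powr (e - 1) \<le> norm (x - y) powr (e - 1)"
        using True False assms by (intro powr_mono2') auto
      then have "(norm x / 2) powr (e - 1) * norm (x - y) \<le> norm (x - y) powr (e - 1) * norm (x - y)"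
        by (rule mult_right_mono) auto
      also have "\<dots> = norm (x - y) powr e" using False by (simp add: powr_diff)
      finally show ?thesis .
    qed auto
    also have "(\<bar>c\<bar> + \<bar>real_of_int m\<bar>) * B * norm (x - y) powr e \<le> C * norm (x - y) powr e"
    proof (rule mult_right_mono)
      have "0 \<le> (\<bar>c\<bar> + \<bar>real_of_int m\<bar>) * B" using B0 by auto
      then show "(\<bar>c\<bar> + \<bar>real_of_int m\<bar>) * B \<le> C" using B0 unfolding C_def by simp
    qed auto
    finally show ?thesis using B0 by (simp add: mult_left_mono)
  next
    case False
    define d where "d = norm (x - y)"
    have nx: "norm x \<le> 2 * d" and ny: "norm y \<le> 3 * d"
      using False norm_triangle_ineq2[of y x] unfolding d_def by (auto simp: norm_minus_commute)
    have pw: "(k * d) powr e \<le> k * d powr e" if "k \<ge> 1" for k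
    proof -
      have "k powr e \<le> k powr 1" using that assms by (intro powr_mono) auto
      then show ?thesis using that by (simp add: powr_mult d_def mult_right_mono)
    qed
    have "norm (homog c m x - homog c m y) \<le> norm x powr c + norm y powr c"
      by (intro order_trans[OF norm_triangle_ineq4] add_mono norm_homog_le)
    also have "\<dots> \<le> B * norm x powr e + B * norm y powr e"
      using that by (intro add_mono pe) auto
    also have "\<dots> \<le> B * (2 * d) powr e + B * (3 * d) powr e"
      using nx ny assms B0 by (intro add_mono mult_left_mono powr_mono2) auto
    also have "\<dots> \<le> B * (2 * d powr e) + B * (3 * d powr e)"
      using B0 by (intro add_mono mult_left_mono pw) auto
    also have "\<dots> = B * (2 + 3) * d powr e" by (simp add: algebra_simps)
    also have "\<dots> \<le> C * d powr e"
      using B0 unfolding C_def by (intro mult_right_mono) auto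
    finally show ?thesis by (simp add: d_def)
  qed
  with C0 that show ?thesis by blast
qed

section \<open>Hoelder regularity of compositions with a holomorphic function\<close>

text \<open>The bounds hold on the whole disc because the target Hoelder norm is global, and for all
  orders because repeated differentiation also falls on the holomorphic factors.\<close>

definition bounded_derivs :: "(complex \<Rightarrow> complex) \<Rightarrow> bool" where
  "bounded_derivs A \<longleftrightarrow> A holomorphic_on D2 \<and> (\<forall>n. bounded ((deriv ^^ n) A ` D2))"

lemma bounded_derivs_const: "bounded_derivs (\<lambda>_. c)"
  unfolding bounded_derivs_def
  by (auto simp: bounded_iff intro!: exI[of _ "norm c"])

lemma bounded_derivs_deriv: "bounded_derivs A \<Longrightarrow> bounded_derivs (deriv A)"
  unfolding bounded_derivs_def
  by (metis funpow_Suc_right comp_apply holomorphic_deriv open_ball)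

lemma bounded_derivs_mult:
  assumes "bounded_derivs A" "bounded_derivs B"
  shows "bounded_derivs (\<lambda>z. A z * B z)"
proof -
  have "bounded ((deriv ^^ n) (\<lambda>w. A w * B w) ` D2)" for n
  proof -
    have "\<exists>C. \<forall>z\<in>D2. norm ((deriv ^^ i) A z) \<le> C" for i
      using assms(1) by (force simp: bounded_derivs_def bounded_iff)
    then obtain a where a: "\<And>i z. z \<in> D2 \<Longrightarrow> norm ((deriv ^^ i) A z) \<le> a i" by metis
    have "\<exists>C. \<forall>z\<in>D2. norm ((deriv ^^ i) B z) \<le> C" for i
      using assms(2) by (force simp: bounded_derivs_def bounded_iff)
    then obtain b where b: "\<And>i z. z \<in> D2 \<Longrightarrow> norm ((deriv ^^ i) B z) \<le> b i" by metis
    have "norm ((deriv ^^ n) (\<lambda>w. A w * B w) z) \<le> (\<Sum>i = 0..n. real (n choose i) * a i * b (n-i))"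
      if z: "z \<in> D2" for z
    proof -
      have "(deriv ^^ n) (\<lambda>w. A w * B w) z = (\<Sum>i = 0..n. of_nat (n choose i) * (deriv ^^ i) A z * (deriv ^^ (n-i)) B z)"
        using assms z by (intro higher_deriv_mult[of _ D2]) (auto simp: bounded_derivs_def)
      also have "norm \<dots> \<le> (\<Sum>i = 0..n. real (n choose i) * a i * b (n-i))"
      proof (rule sum_norm_le)
        fix i
        have "0 \<le> a i" using a[OF z, of i] norm_ge_zero order_trans by blast
        then show "norm (of_nat (n choose i) * (deriv ^^ i) A z * (deriv ^^ (n-i)) B z)
            \<le> real (n choose i) * a i * b (n-i)"
          unfolding norm_mult norm_of_nat using a[OF z] b[OF z]
          by (intro mult_mono mult_left_mono) auto
      qed
      finally show ?thesis .
    qed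
    then show ?thesis unfolding bounded_iff by blast
  qed
  then show ?thesis using assms unfolding bounded_derivs_def by (auto intro: holomorphic_on_mult)
qed

lemma bounded_derivs_holomorphic: "bounded_derivs A \<Longrightarrow> A holomorphic_on D2"
  by (simp add: bounded_derivs_def)

lemma bounded_derivs_bounded:
  assumes "bounded_derivs A"
  obtains C where "C \<ge> 0" "\<And>z. z \<in> D2 \<Longrightarrow> norm (A z) \<le> C"
proof -
  have "bounded ((deriv ^^ 0) A ` D2)" using assms unfolding bounded_derivs_def by blast
  then obtain C where C: "\<And>z. z \<in> D2 \<Longrightarrow> norm (A z) \<le> C" by (force simp: bounded_iff)
  have "0 \<le> norm (A 0)" by simp
  also have "\<dots> \<le> C" by (rule C) simp
  finally have "C \<ge> 0" .
  with C that show ?thesis by blast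
qed

lemma holomorphic_has_derivative:
  "A holomorphic_on S \<Longrightarrow> open S \<Longrightarrow> z \<in> S \<Longrightarrow> (A has_derivative (\<lambda>v. deriv A z * v)) (at z)"
  using holomorphic_derivI[of A S z UNIV] by (simp add: has_field_derivative_def)

lemma bounded_derivs_Lipschitz:
  assumes "bounded_derivs A"
  obtains C where "C \<ge> 0" "\<And>x y. x \<in> D2 \<Longrightarrow> y \<in> D2 \<Longrightarrow> norm (A x - A y) \<le> C * norm (x - y)"
proof -
  obtain C where C: "C \<ge> 0" "\<And>z. z \<in> D2 \<Longrightarrow> norm (deriv A z) \<le> C"
    using bounded_derivs_bounded[OF bounded_derivs_deriv[OF assms]] by blast
  have "norm (A x - A y) \<le> C * norm (x - y)" if "x \<in> D2" "y \<in> D2" for x y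
  proof (rule field_differentiable_bound[OF convex_ball _ C(2) that])
    fix z assume "z \<in> D2"
    then show "(A has_field_derivative deriv A z) (at z within D2)"
      using holomorphic_derivI[OF bounded_derivs_holomorphic[OF assms]] by auto
  qed
  with C(1) that show ?thesis by blast
qed

section \<open>Hoelder continuous functions on the disc\<close>

definition holder_cont :: "real \<Rightarrow> (complex \<Rightarrow> complex) \<Rightarrow> bool" where
  "holder_cont e f \<longleftrightarrow> bounded (f ` D2) \<and>
    (\<exists>C. \<forall>x\<in>D2. \<forall>y\<in>D2. norm (f x - f y) \<le> C * dist x y powr e)"

lemma holder_contI:
  assumes "\<And>x. x \<in> D2 \<Longrightarrow> norm (f x) \<le> M"
    "\<And>x y. x \<in> D2 \<Longrightarrow> y \<in> D2 \<Longrightarrow> norm (f x - f y) \<le> C * dist x y powr e"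
  shows "holder_cont e f"
  using assms unfolding holder_cont_def bounded_iff by blast

lemma holder_contE:
  assumes "holder_cont e f"
  obtains M C where "M \<ge> 0" "C \<ge> 0" "\<And>x. x \<in> D2 \<Longrightarrow> norm (f x) \<le> M"
    "\<And>x y. x \<in> D2 \<Longrightarrow> y \<in> D2 \<Longrightarrow> norm (f x - f y) \<le> C * dist x y powr e"
proof -
  obtain M where M: "\<And>x. x \<in> D2 \<Longrightarrow> norm (f x) \<le> M"
    using assms unfolding holder_cont_def bounded_iff by blast
  obtain C where C: "\<And>x y. x \<in> D2 \<Longrightarrow> y \<in> D2 \<Longrightarrow> norm (f x - f y) \<le> C * dist x y powr e"
    using assms unfolding holder_cont_def by blast
  have "norm (f x - f y) \<le> \<bar>C\<bar> * dist x y powr e" if "x \<in> D2" "y \<in> D2" for x y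
    by (rule order_trans[OF C[OF that]]) (intro mult_right_mono, auto)
  moreover have "norm (f x) \<le> \<bar>M\<bar>" if "x \<in> D2" for x using M[OF that] by linarith
  ultimately show ?thesis using that[of "\<bar>M\<bar>" "\<bar>C\<bar>"] by simp
qed

lemma holder_cont_add:
  assumes "holder_cont e f" "holder_cont e g"
  shows "holder_cont e (\<lambda>z. f z + g z)"
proof -
  obtain M C where f: "\<And>x. x \<in> D2 \<Longrightarrow> norm (f x) \<le> M"
    "\<And>x y. x \<in> D2 \<Longrightarrow> y \<in> D2 \<Longrightarrow> norm (f x - f y) \<le> C * dist x y powr e"
    using holder_contE[OF assms(1)] by metis
  obtain M' C' where g: "\<And>x. x \<in> D2 \<Longrightarrow> norm (g x) \<le> M'"
    "\<And>x y. x \<in> D2 \<Longrightarrow> y \<in> D2 \<Longrightarrow> norm (g x - g y) \<le> C' * dist x y powr e"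
    using holder_contE[OF assms(2)] by metis
  show ?thesis
  proof (rule holder_contI[of _ "M + M'" "C + C'"])
    fix x y assume xy: "x \<in> D2" "y \<in> D2"
    have eq: "f x + g x - (f y + g y) = (f x - f y) + (g x - g y)" by simp
    show "norm (f x + g x - (f y + g y)) \<le> (C + C') * dist x y powr e"
      unfolding eq distrib_right
      using norm_triangle_ineq[of "f x - f y" "g x - g y"] f(2)[OF xy] g(2)[OF xy] by linarith
  next
    fix x assume "x \<in> D2"
    then show "norm (f x + g x) \<le> M + M'"
      using norm_triangle_ineq[of "f x" "g x"] f(1)[of x] g(1)[of x] by linarith
  qed
qed

text \<open>The difference of the products is split by changing one factor at a time; the other
  factor is controlled by its sup bound, which is why \<open>holder_cont\<close> includes
  boundedness.\<close>

lemma holder_cont_mult: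
  assumes "holder_cont e f" "holder_cont e g"
  shows "holder_cont e (\<lambda>z. f z * g z)"
proof -
  obtain M C where f: "M \<ge> 0" "C \<ge> 0" "\<And>x. x \<in> D2 \<Longrightarrow> norm (f x) \<le> M"
    "\<And>x y. x \<in> D2 \<Longrightarrow> y \<in> D2 \<Longrightarrow> norm (f x - f y) \<le> C * dist x y powr e"
    using holder_contE[OF assms(1)] by metis
  obtain M' C' where g: "M' \<ge> 0" "C' \<ge> 0" "\<And>x. x \<in> D2 \<Longrightarrow> norm (g x) \<le> M'"
    "\<And>x y. x \<in> D2 \<Longrightarrow> y \<in> D2 \<Longrightarrow> norm (g x - g y) \<le> C' * dist x y powr e"
    using holder_contE[OF assms(2)] by metis
  show ?thesis
  proof (rule holder_contI[of _ "M * M'" "M * C' + C * M'"])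
    fix x y assume xy: "x \<in> D2" "y \<in> D2"
    have "norm (f x * g x - f y * g y) = norm (f x * (g x - g y) + (f x - f y) * g y)"
      by (simp add: algebra_simps)
    also have "\<dots> \<le> norm (f x) * norm (g x - g y) + norm (f x - f y) * norm (g y)"
      by (intro order_trans[OF norm_triangle_ineq]) (simp add: norm_mult)
    also have "\<dots> \<le> M * (C' * dist x y powr e) + (C * dist x y powr e) * M'"
      using f g xy by (intro add_mono mult_mono) auto
    finally show "norm (f x * g x - f y * g y) \<le> (M * C' + C * M') * dist x y powr e"
      by (simp add: algebra_simps)
  next
    fix x assume "x \<in> D2"
    then show "norm (f x * g x) \<le> M * M'"
      using f g by (auto simp: norm_mult intro!: mult_mono)
  qed
qed

lemma holder_cont_cnj: "holder_cont e f \<Longrightarrow> holder_cont e (\<lambda>z. cnj (f z))"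
  by (elim holder_contE, rule holder_contI) (auto simp flip: complex_cnj_diff)

text \<open>Distances in the disc are at most \<open>2\<close>, so the first power of a distance is
  at most \<open>2 powr (1 - e)\<close> times its power \<open>e\<close>; this turns the Lipschitz
  bound into a Hoelder bound.\<close>

lemma bounded_derivs_holder_cont:
  assumes "bounded_derivs A" "0 < e" "e < 1"
  shows "holder_cont e A"
proof -
  obtain M where M: "M \<ge> 0" "\<And>z. z \<in> D2 \<Longrightarrow> norm (A z) \<le> M"
    using bounded_derivs_bounded[OF assms(1)] by blast
  obtain C where C: "C \<ge> 0" "\<And>x y. x \<in> D2 \<Longrightarrow> y \<in> D2 \<Longrightarrow> norm (A x - A y) \<le> C * norm (x - y)"
    using bounded_derivs_Lipschitz[OF assms(1)] by blast
  show ?thesis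
  proof (rule holder_contI[OF M(2), of _ "C * 2 powr (1 - e)"])
    fix x y assume xy: "x \<in> D2" "y \<in> D2"
    have d: "dist x y \<le> 2" using xy norm_triangle_ineq4[of x y] by (simp add: dist_norm)
    have "dist x y = dist x y powr (1 - e) * dist x y powr e"
      by (cases "x = y") (auto simp flip: powr_add)
    also have "\<dots> \<le> 2 powr (1 - e) * dist x y powr e"
      using d assms by (intro mult_right_mono powr_mono2) auto
    finally show "norm (A x - A y) \<le> C * 2 powr (1 - e) * dist x y powr e"
      using C(2)[OF xy] C(1) by (simp add: dist_norm mult.assoc) (meson mult_left_mono order_trans)
  qed
qed

text \<open>Holomorphic and antiholomorphic amplitudes are kept apart, so that each Wirtinger
  derivative acts on only one of them; sums of such terms are stable under differentiation.\<close>

definition bterm :: "(complex \<Rightarrow> complex) \<Rightarrow> (complex \<Rightarrow> complex) \<Rightarrow> real \<Rightarrow> int \<Rightarrow> (complex \<Rightarrow> complex) \<Rightarrow> complex \<Rightarrow> complex"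
  where "bterm A B c m h z = A z * cnj (B z) * homog c m (h z)"

text \<open>The Wirtinger derivatives of \<open>bterm A B c m h\<close>, by which we mean the complex coefficients of
  \<open>v\<close> and \<open>cnj v\<close> in the derivative.\<close>

definition bterm_dz :: "(complex \<Rightarrow> complex) \<Rightarrow> (complex \<Rightarrow> complex) \<Rightarrow> real \<Rightarrow> int \<Rightarrow> (complex \<Rightarrow> complex) \<Rightarrow> complex \<Rightarrow> complex"
  where "bterm_dz A B c m h z = bterm (deriv A) B c m h z
    + of_real ((c + m) / 2) * bterm (\<lambda>z. A z * deriv h z) B (c - 1) (m - 1) h z"

definition bterm_dzbar :: "(complex \<Rightarrow> complex) \<Rightarrow> (complex \<Rightarrow> complex) \<Rightarrow> real \<Rightarrow> int \<Rightarrow> (complex \<Rightarrow> complex) \<Rightarrow> complex \<Rightarrow> complex"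
  where "bterm_dzbar A B c m h z = bterm A (deriv B) c m h z
    + of_real ((c - m) / 2) * bterm A (\<lambda>z. B z * deriv h z) (c - 1) (m + 1) h z"

lemma bterm_has_derivative:
  assumes "A holomorphic_on S" "B holomorphic_on S" "h holomorphic_on S" "open S" "z \<in> S"
    and "h z \<noteq> 0 \<or> c > 1"
  shows "(bterm A B c m h has_derivative (\<lambda>v. bterm_dz A B c m h z * v + bterm_dzbar A B c m h z * cnj v)) (at z)"
proof -
  note d = holomorphic_has_derivative[OF _ assms(4,5)]
  have 1: "((\<lambda>z. A z * cnj (B z)) has_derivative
      (\<lambda>v. A z * cnj (deriv B z * v) + deriv A z * v * cnj (B z))) (at z)"
    by (rule has_derivative_mult[OF d[OF assms(1)] bounded_linear.has_derivative[OF bounded_linear_cnj d[OF assms(2)]]])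
  have 2: "((\<lambda>z. homog c m (h z)) has_derivative
     (\<lambda>v. of_real ((c + m) / 2) * homog (c-1) (m-1) (h z) * (deriv h z * v)
           + of_real ((c - m) / 2) * homog (c-1) (m+1) (h z) * cnj (deriv h z * v))) (at z)"
    by (rule has_derivative_compose[OF d[OF assms(3)] homog_has_derivative[OF assms(6)]])
  show ?thesis
    unfolding bterm_def[abs_def]
    by (rule has_derivative_eq_rhs[OF has_derivative_mult[OF 1 2]])
      (simp add: bterm_dz_def bterm_dzbar_def bterm_def fun_eq_iff algebra_simps)
qed

text \<open>The index \<open>e\<close> records the regularity still available: it bounds the degrees
  of all terms from below, and a derivative lowers it by one.\<close>

inductive hclass :: "(complex \<Rightarrow> complex) \<Rightarrow> real \<Rightarrow> (complex \<Rightarrow> complex) \<Rightarrow> bool" for h e where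
  hclass_term: "bounded_derivs A \<Longrightarrow> bounded_derivs B \<Longrightarrow> e \<le> c \<Longrightarrow> hclass h e (bterm A B c m h)"
| hclass_add: "hclass h e f \<Longrightarrow> hclass h e g \<Longrightarrow> hclass h e (\<lambda>z. f z + g z)"

lemma hclass_cmult: "hclass h e f \<Longrightarrow> hclass h e (\<lambda>z. k * f z)"
proof (induction rule: hclass.induct)
  case (hclass_term A B c m)
  have "(\<lambda>z. k * bterm A B c m h z) = bterm (\<lambda>z. k * A z) B c m h"
    by (simp add: bterm_def fun_eq_iff mult.assoc)
  then show ?case using hclass_term bounded_derivs_mult[OF bounded_derivs_const]
    by (auto intro: hclass.hclass_term)
next
  case (hclass_add f g)
  then show ?case using hclass.hclass_add[of h e "\<lambda>z. k * f z" "\<lambda>z. k * g z"] by (simp add: distrib_left)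
qed

lemma hclass_has_derivative:
  assumes "hclass h e f" "bounded_derivs h"
  shows "\<exists>F1 F2. hclass h (e - 1) F1 \<and> hclass h (e - 1) F2 \<and>
    (\<forall>z\<in>D2. h z \<noteq> 0 \<or> e > 1 \<longrightarrow> (f has_derivative (\<lambda>v. F1 z * v + F2 z * cnj v)) (at z))"
  using assms(1)
proof (induction rule: hclass.induct)
  case (hclass_term A B c m)
  have h': "bounded_derivs (deriv h)" using assms(2) by (rule bounded_derivs_deriv)
  have 1: "hclass h (e - 1) (bterm_dz A B c m h)"
    unfolding bterm_dz_def[abs_def]
    by (rule hclass_add hclass_cmult hclass.hclass_term bounded_derivs_mult bounded_derivs_deriv hclass_term h' | use hclass_term(3) in simp)+
  have 2: "hclass h (e - 1) (bterm_dzbar A B c m h)"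
    unfolding bterm_dzbar_def[abs_def]
    by (rule hclass_add hclass_cmult hclass.hclass_term bounded_derivs_mult bounded_derivs_deriv hclass_term h' | use hclass_term(3) in simp)+
  have 3: "(bterm A B c m h has_derivative (\<lambda>v. bterm_dz A B c m h z * v + bterm_dzbar A B c m h z * cnj v)) (at z)"
    if "z \<in> D2" "h z \<noteq> 0 \<or> e > 1" for z
    using that hclass_term assms(2)
    by (intro bterm_has_derivative[of _ D2]) (auto simp: bounded_derivs_holomorphic)
  show ?case using 1 2 3 by blast
next
  case (hclass_add f g)
  obtain F1 F2 where F: "hclass h (e - 1) F1" "hclass h (e - 1) F2"
    "\<And>z. z \<in> D2 \<Longrightarrow> h z \<noteq> 0 \<or> e > 1 \<Longrightarrow> (f has_derivative (\<lambda>v. F1 z * v + F2 z * cnj v)) (at z)"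
    using hclass_add.IH(1) by blast
  obtain G1 G2 where G: "hclass h (e - 1) G1" "hclass h (e - 1) G2"
    "\<And>z. z \<in> D2 \<Longrightarrow> h z \<noteq> 0 \<or> e > 1 \<Longrightarrow> (g has_derivative (\<lambda>v. G1 z * v + G2 z * cnj v)) (at z)"
    using hclass_add.IH(2) by blast
  have "((\<lambda>z. f z + g z) has_derivative (\<lambda>v. (F1 z + G1 z) * v + (F2 z + G2 z) * cnj v)) (at z)"
    if "z \<in> D2" "h z \<noteq> 0 \<or> e > 1" for z
    by (rule has_derivative_eq_rhs[OF has_derivative_add[OF F(3)[OF that] G(3)[OF that]]])
      (simp add: fun_eq_iff algebra_simps)
  then show ?case
    using hclass.hclass_add[OF F(1) G(1)] hclass.hclass_add[OF F(2) G(2)]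
    by (intro exI[of _ "\<lambda>z. F1 z + G1 z"] exI[of _ "\<lambda>z. F2 z + G2 z"]) simp
qed

lemma hclass_partial:
  assumes "hclass h e f" "bounded_derivs h"
  shows "\<exists>F. hclass h (e - 1) F \<and>
    (\<forall>z\<in>D2. h z \<noteq> 0 \<or> e > 1 \<longrightarrow> f differentiable (at z) \<and> partial b f z = F z)"
proof -
  obtain F1 F2 where F: "hclass h (e - 1) F1" "hclass h (e - 1) F2"
    "\<And>z. z \<in> D2 \<Longrightarrow> h z \<noteq> 0 \<or> e > 1 \<Longrightarrow> (f has_derivative (\<lambda>v. F1 z * v + F2 z * cnj v)) (at z)"
    using hclass_has_derivative[OF assms] by blast
  have "hclass h (e - 1) (\<lambda>z. b * F1 z + cnj b * F2 z)"
    by (rule hclass_add[OF hclass_cmult[OF F(1)] hclass_cmult[OF F(2)]])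
  moreover have "f differentiable (at z) \<and> partial b f z = b * F1 z + cnj b * F2 z"
    if "z \<in> D2" "h z \<noteq> 0 \<or> e > 1" for z
    using F(3)[OF that] partial_eq[OF F(3)[OF that], of b] by (auto simp: differentiable_def mult.commute)
  ultimately show ?thesis by (intro exI[of _ "\<lambda>z. b * F1 z + cnj b * F2 z"]) blast
qed

lemma hclass_isCont:
  assumes "hclass h e f" "bounded_derivs h" "z \<in> D2" "h z \<noteq> 0 \<or> e > 0"
  shows "isCont f z"
  using assms(1)
proof (induction rule: hclass.induct)
  case (hclass_term A B c m)
  have c: "isCont F z" if "bounded_derivs F" for F
    using holomorphic_on_imp_continuous_on[OF bounded_derivs_holomorphic[OF that]] assms(3)
    by (simp add: continuous_on_eq_continuous_at)
  have "isCont (homog c m) (h z)"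
  proof (cases "h z = 0")
    case True
    then show ?thesis using continuous_on_homog[of c UNIV m] hclass_term assms(4)
      by (simp add: continuous_on_eq_continuous_at)
  qed (use homog_has_derivative_nz has_derivative_continuous in blast)
  then have "isCont (\<lambda>z. homog c m (h z)) z"
    using isCont_o2[OF c[OF assms(2)]] by blast
  moreover have "isCont (\<lambda>z. cnj (B z)) z"
    using isCont_o2[OF c[OF hclass_term(2)], of cnj] by (simp add: continuous_cnj)
  ultimately show ?case unfolding bterm_def[abs_def]
    by (intro isCont_mult c[OF hclass_term(1)])
qed auto

text \<open>The alternative is decided point by point: off the zeros of \<open>h\<close> the order
  is unlimited, across a zero the degree must exceed it. One induction thus serves both the Hoelder
  class on the disc and the smoothness away from the vortices.\<close>

lemma hclass_Ck_on:
  assumes "hclass h e f" "bounded_derivs h" "open S" "S \<subseteq> D2" "\<And>z. z \<in> S \<Longrightarrow> h z \<noteq> 0 \<or> e > real k"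
  shows "Ck_on k S f"
  using assms(1,5)
proof (induction k arbitrary: e f)
  case 0
  then show ?case using assms hclass_isCont[of h e f]
    by (auto intro!: continuous_at_imp_continuous_on)
next
  case (Suc k)
  have n: "h z \<noteq> 0 \<or> e > 1" "h z \<noteq> 0 \<or> e - 1 > real k" if "z \<in> S" for z
    using Suc.prems(2)[OF that] by auto
  show ?case unfolding Ck_on.simps
  proof (intro conjI ballI)
    fix x assume x: "x \<in> S"
    show "f differentiable at x"
      using hclass_partial[OF Suc.prems(1) assms(2), of 1] n[OF x] x assms(4) by blast
  next
    fix b
    obtain F where F: "hclass h (e - 1) F" "\<And>z. z \<in> D2 \<Longrightarrow> h z \<noteq> 0 \<or> e > 1 \<Longrightarrow> partial b f z = F z"
      using hclass_partial[OF Suc.prems(1) assms(2), of b] by blast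
    have "Ck_on k S F" using Suc.IH[OF F(1)] n(2) by blast
    then show "Ck_on k S (partial b f)"
      by (rule Ck_on_cong[OF assms(3), rotated]) (use F(2) n(1) assms(4) in force)
  qed
qed

lemma hclass_partials:
  assumes "hclass h e f" "bounded_derivs h" "real (length bs) < e"
  shows "\<exists>F. hclass h (e - length bs) F \<and> (\<forall>z\<in>D2. partials bs f z = F z)"
  using assms(3)
proof (induction bs)
  case Nil
  then show ?case using assms(1) by auto
next
  case (Cons b bs)
  obtain F where F: "hclass h (e - length bs) F" "\<And>z. z \<in> D2 \<Longrightarrow> partials bs f z = F z"
    using Cons by auto
  obtain G where G: "hclass h (e - length bs - 1) G"
    "\<And>z. z \<in> D2 \<Longrightarrow> h z \<noteq> 0 \<or> e - length bs > 1 \<Longrightarrow> partial b F z = G z"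
    using hclass_partial[OF F(1) assms(2)] by blast
  have "partials (b # bs) f z = G z" if "z \<in> D2" for z
  proof -
    have "partial b (partials bs f) z = partial b F z"
      using F(2) that by (intro partial_cong_open[of D2]) auto
    also have "\<dots> = G z" using G(2) that Cons.prems by simp
    finally show ?thesis by simp
  qed
  moreover have "e - length (b # bs) = e - length bs - 1" by simp
  ultimately show ?case using G(1) by metis
qed

lemma homog_comp_bounded:
  assumes "bounded_derivs h" "c \<ge> 0"
  obtains C where "C \<ge> 0" "\<And>z. z \<in> D2 \<Longrightarrow> norm (homog c m (h z)) \<le> C"
proof -
  obtain M where M: "M \<ge> 0" "\<And>z. z \<in> D2 \<Longrightarrow> norm (h z) \<le> M"
    using bounded_derivs_bounded[OF assms(1)] by blast
  have "norm (homog c m (h z)) \<le> M powr c" if "z \<in> D2" for z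
    using norm_homog_le[of c m "h z"] powr_mono2[OF assms(2) _ M(2)[OF that]] by auto
  with that[of "M powr c"] show ?thesis by simp
qed

lemma bterm_bounded:
  assumes "bounded_derivs A" "bounded_derivs B" "bounded_derivs h" "c \<ge> 0"
  obtains C where "C \<ge> 0" "\<And>z. z \<in> D2 \<Longrightarrow> norm (bterm A B c m h z) \<le> C"
proof -
  obtain a where a: "a \<ge> 0" "\<And>z. z \<in> D2 \<Longrightarrow> norm (A z) \<le> a"
    using bounded_derivs_bounded[OF assms(1)] by blast
  obtain b where b: "b \<ge> 0" "\<And>z. z \<in> D2 \<Longrightarrow> norm (B z) \<le> b"
    using bounded_derivs_bounded[OF assms(2)] by blast
  obtain C where C: "C \<ge> 0" "\<And>z. z \<in> D2 \<Longrightarrow> norm (homog c m (h z)) \<le> C"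
    using homog_comp_bounded[OF assms(3,4)] by blast
  have "norm (bterm A B c m h z) \<le> a * b * C" if "z \<in> D2" for z
    unfolding bterm_def norm_mult complex_mod_cnj using that a b C by (intro mult_mono) auto
  with that[of "a * b * C"] a b C show ?thesis by simp
qed

lemma hclass_bounded:
  assumes "hclass h e f" "bounded_derivs h" "0 \<le> e"
  shows "bounded (f ` D2)"
  using assms(1)
proof (induction rule: hclass.induct)
  case (hclass_term A B c m)
  have "c \<ge> 0" using hclass_term(3) assms(3) by simp
  then obtain C where "\<And>z. z \<in> D2 \<Longrightarrow> norm (bterm A B c m h z) \<le> C"
    using bterm_bounded[OF hclass_term(1,2) assms(2)] by blast
  then show ?case unfolding bounded_iff by blast
qed (rule bounded_plus_comp)

text \<open>\<open>h\<close> is bounded and Lipschitz on the disc, so the Hoelder estimate for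
  \<open>homog\<close> on bounded sets composes with it without loss in the exponent.\<close>

lemma hclass_holder_cont:
  assumes "hclass h e f" "bounded_derivs h" "0 < e" "e < 1"
  shows "holder_cont e f"
  using assms(1)
proof (induction rule: hclass.induct)
  case (hclass_term A B c m)
  obtain M where M: "M \<ge> 0" "\<And>z. z \<in> D2 \<Longrightarrow> norm (h z) \<le> M"
    using bounded_derivs_bounded[OF assms(2)] by blast
  obtain L where L: "L \<ge> 0" "\<And>x y. x \<in> D2 \<Longrightarrow> y \<in> D2 \<Longrightarrow> norm (h x - h y) \<le> L * norm (x - y)"
    using bounded_derivs_Lipschitz[OF assms(2)] by blast
  obtain C where C: "C \<ge> 0" "\<And>x y. norm x \<le> M \<Longrightarrow> norm y \<le> M \<Longrightarrow>
    norm (homog c m x - homog c m y) \<le> C * norm (x - y) powr e"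
    using homog_holder[of e c M m] assms hclass_term by blast
  obtain N where N: "N \<ge> 0" "\<And>z. z \<in> D2 \<Longrightarrow> norm (homog c m (h z)) \<le> N"
    using homog_comp_bounded[OF assms(2), of c m] assms hclass_term by auto
  have "holder_cont e (\<lambda>z. homog c m (h z))"
  proof (rule holder_contI[OF N(2), of _ "C * L powr e"])
    fix x y assume xy: "x \<in> D2" "y \<in> D2"
    have "norm (homog c m (h x) - homog c m (h y)) \<le> C * norm (h x - h y) powr e"
      using xy M by (intro C) auto
    also have "\<dots> \<le> C * (L * norm (x - y)) powr e"
      using xy L(2) C(1) assms by (intro mult_left_mono powr_mono2) auto
    finally show "norm (homog c m (h x) - homog c m (h y)) \<le> C * L powr e * dist x y powr e"
      using L(1) by (simp add: powr_mult dist_norm mult.assoc)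
  qed
  then show ?case unfolding bterm_def[abs_def]
    using bounded_derivs_holder_cont[OF hclass_term(1) assms(3,4)]
      bounded_derivs_holder_cont[OF hclass_term(2) assms(3,4)]
    by (intro holder_cont_mult holder_cont_cnj)
qed (rule holder_cont_add)

text \<open>A non-integer \<open>a\<close> lies strictly between \<open>\<lfloor>a\<rfloor>\<close>
  and \<open>\<lfloor>a\<rfloor> + 1\<close>. Hence derivatives of order
  \<open>\<lfloor>a\<rfloor>\<close> have an index in the open unit interval, equal to the Hoelder
  exponent that is required of them.\<close>

lemma hclass_holder_space:
  assumes "hclass h a f" "bounded_derivs h" "0 < a" "a \<notin> \<int>"
  shows "f \<in> holder_space a D2"
proof -
  define k where "k = nat \<lfloor>a\<rfloor>"
  have k: "real k = of_int \<lfloor>a\<rfloor>" using assms(3) by (simp add: k_def)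
  have kl: "real k < a" "a < real k + 1"
    using assms(4) of_int_floor_le[of a] floor_less_iff[of a "\<lfloor>a\<rfloor> + 1"] unfolding k
    by (metis Ints_of_int less_eq_real_def, simp)
  have "Ck_on k D2 f" using kl by (intro hclass_Ck_on[OF assms(1,2)]) auto
  moreover have "bounded (partials bs f ` D2)" if "length bs \<le> k" for bs
  proof -
    have l: "real (length bs) < a" using that kl by linarith
    obtain F where F: "hclass h (a - length bs) F" "\<And>z. z \<in> D2 \<Longrightarrow> partials bs f z = F z"
      using hclass_partials[OF assms(1,2) l] by blast
    have "bounded (F ` D2)" using hclass_bounded[OF F(1) assms(2)] l by simp
    then show ?thesis using F(2) image_cong[of D2 D2 "partials bs f" F] by metis
  qed
  moreover have "\<exists>C. \<forall>x\<in>D2. \<forall>y\<in>D2.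
           norm (partials bs f x - partials bs f y) \<le> C * dist x y powr (a - \<lfloor>a\<rfloor>)" if "length bs = k" for bs
  proof -
    have l: "real (length bs) < a" using that kl by linarith
    obtain F where F: "hclass h (a - length bs) F" "\<And>z. z \<in> D2 \<Longrightarrow> partials bs f z = F z"
      using hclass_partials[OF assms(1,2) l] by blast
    have "holder_cont (a - length bs) F" using hclass_holder_cont[OF F(1) assms(2)] l kl that by simp
    then show ?thesis using F(2) that k unfolding holder_cont_def by simp
  qed
  ultimately show ?thesis unfolding holder_space_def k_def[symmetric] by blast
qed

section \<open>Integration by parts and the Cauchy kernel\<close>

lemma partial_1_i_linear:
  fixes \<phi> :: "complex \<Rightarrow> 'b::real_normed_vector"
  assumes "\<phi> differentiable (at z)"
  shows "frechet_derivative \<phi> (at z) v = Re v *\<^sub>R partial 1 \<phi> z + Im v *\<^sub>R partial \<i> \<phi> z"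
proof -
  have lin: "linear (frechet_derivative \<phi> (at z))"
    using assms linear_frechet_derivative by blast
  have "frechet_derivative \<phi> (at z) v = frechet_derivative \<phi> (at z) (Re v *\<^sub>R 1 + Im v *\<^sub>R \<i>)"
    by (rule arg_cong[where f = "frechet_derivative \<phi> (at z)"]) (simp add: complex_eq_iff)
  then show ?thesis by (simp only: linear_add[OF lin] linear_scale[OF lin] partial_def)
qed

lemma test_function_bounds:
  assumes "\<phi> \<in> test_functions \<Omega>"
  obtains M where "M \<ge> 0" "\<And>z. \<bar>\<phi> z\<bar> \<le> M" "\<And>z. \<bar>partial 1 \<phi> z\<bar> \<le> M" "\<And>z. \<bar>partial \<i> \<phi> z\<bar> \<le> M"
    "\<And>x y. \<bar>\<phi> x - \<phi> y\<bar> \<le> 2 * M * norm (x - y)"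
proof -
  obtain K where K: "compact K" "\<And>z. z \<notin> K \<Longrightarrow> \<phi> z = 0" "\<And>b z. z \<notin> K \<Longrightarrow> partial b \<phi> z = 0"
    using test_functionE[OF assms] by metis
  have bdd: "\<exists>B. \<forall>z. \<bar>f z\<bar> \<le> B" if "continuous_on K f" "\<And>z. z \<notin> K \<Longrightarrow> f z = 0" for f :: "complex \<Rightarrow> real"
  proof -
    have "bounded (f ` K)" using that(1) K(1) by (simp add: compact_continuous_image compact_imp_bounded)
    then obtain B where B: "\<And>z. z \<in> K \<Longrightarrow> \<bar>f z\<bar> \<le> B" unfolding bounded_iff by auto
    have "\<bar>f z\<bar> \<le> \<bar>B\<bar>" for z using B[of z] that(2)[of z] by (cases "z \<in> K") auto
    then show ?thesis by blast
  qed
  obtain A where A: "\<And>z. \<bar>\<phi> z\<bar> \<le> A" using bdd[OF test_function_continuous[OF assms] K(2)] by blast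
  obtain B where B: "\<And>z. \<bar>partial 1 \<phi> z\<bar> \<le> B"
    using bdd[OF test_function_partial_continuous[OF assms] K(3)] by (auto simp: Basis_complex_def)
  obtain C where C: "\<And>z. \<bar>partial \<i> \<phi> z\<bar> \<le> C"
    using bdd[OF test_function_partial_continuous[OF assms] K(3)] by (auto simp: Basis_complex_def)
  define M where "M = max A (max B C)"
  have M0: "M \<ge> 0" using A[of 0] by (simp add: M_def)
  have M: "\<bar>\<phi> z\<bar> \<le> M" "\<bar>partial 1 \<phi> z\<bar> \<le> M" "\<bar>partial \<i> \<phi> z\<bar> \<le> M" for z
    using A[of z] B[of z] C[of z] by (auto simp: M_def)
  have "\<bar>\<phi> x - \<phi> y\<bar> \<le> 2 * M * norm (x - y)" for x y
  proof -
    have "norm (\<phi> x - \<phi> y) \<le> 2 * M * norm (x - y)"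
    proof (rule differentiable_bound[of UNIV \<phi> "\<lambda>z. frechet_derivative \<phi> (at z)"])
      fix z
      show "(\<phi> has_derivative frechet_derivative \<phi> (at z)) (at z within UNIV)"
        using test_function_differentiable[OF assms] frechet_derivative_works by auto
      show "onorm (frechet_derivative \<phi> (at z)) \<le> 2 * M"
      proof (rule onorm_bound)
        fix v :: complex
        have "frechet_derivative \<phi> (at z) v = Re v * partial 1 \<phi> z + Im v * partial \<i> \<phi> z"
          using partial_1_i_linear[OF test_function_differentiable[OF assms]] by simp
        also have "norm \<dots> \<le> norm v * M + norm v * M"
          unfolding real_norm_def using abs_Re_le_cmod[of v] abs_Im_le_cmod[of v] M M0
          by (intro order_trans[OF abs_triangle_ineq] add_mono) (auto simp: abs_mult intro!: mult_mono)
        finally show "norm (frechet_derivative \<phi> (at z) v) \<le> 2 * M * norm v" by (simp add: algebra_simps)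
      qed (use M0 in auto)
    qed auto
    then show ?thesis by simp
  qed
  with M M0 that show ?thesis by blast
qed

lemma has_derivative_directional:
  fixes f :: "'a::real_normed_vector \<Rightarrow> 'b::real_normed_vector"
  assumes "(f has_derivative D) (at z)"
  shows "((\<lambda>t::real. f (z + t *\<^sub>R b)) has_vector_derivative D b) (at 0)"
proof -
  have a: "((\<lambda>t::real. z + t *\<^sub>R b) has_vector_derivative b) (at 0)"
    by (auto intro!: derivative_eq_intros)
  have "(f has_derivative D) (at (z + 0 *\<^sub>R b))" using assms by simp
  from vector_derivative_diff_chain_within[OF a has_derivative_at_withinI[OF this]] show ?thesis
    by (simp add: o_def)
qed

lemma integrable_compact_support:
  fixes f :: "'a::euclidean_space \<Rightarrow> 'b::{banach, second_countable_topology}"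
  assumes "compact K" "continuous_on K f" "\<And>z. z \<notin> K \<Longrightarrow> f z = 0"
  shows "integrable lborel f"
proof -
  have "(\<lambda>x. indicator K x *\<^sub>R f x) = f" using assms(3) by (auto simp: indicator_def fun_eq_iff)
  then show ?thesis using borel_integrable_compact[OF assms(1,2)] by simp
qed

text \<open>By translation invariance the difference quotients of \<open>w\<close> have integral zero.\<close>

lemma integral_directional_derivative_eq_0:
  fixes w w' :: "complex \<Rightarrow> complex"
  assumes Lip: "\<And>x y. norm (w x - w y) \<le> M * norm (x - y)"
    and K: "compact K" "\<And>z. z \<notin> K \<Longrightarrow> w z = 0"
    and meas: "w' \<in> borel_measurable borel"
    and deriv: "AE z in lborel. ((\<lambda>t::real. w (z + t *\<^sub>R b)) has_vector_derivative w' z) (at 0)"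
  shows "integrable lborel w'" "integral\<^sup>L lborel w' = 0"
proof -
  have M0: "M * norm v \<ge> 0" for v :: complex using order_trans[OF norm_ge_zero Lip[of v 0]] by simp
  have cont: "continuous_on UNIV w"
  proof (rule lipschitz_on_continuous_on)
    show "M-lipschitz_on UNIV w" using Lip M0[of 1] by (auto intro!: lipschitz_onI simp: dist_norm)
  qed
  have wm: "w \<in> borel_measurable borel" using cont by (rule borel_measurable_continuous_onI)
  have wi: "integrable lborel w"
    by (rule integrable_compact_support[OF K(1) continuous_on_subset[OF cont] K(2)]) auto
  obtain R where R: "K \<subseteq> cball 0 R" using compact_imp_bounded[OF K(1)] unfolding bounded_iff by (metis mem_cball_0 subsetI)
  \<comment> \<open>All steps have length at most \<open>norm b\<close>, so the supports of the
    quotients lie in one ball, and a constant times its indicator dominates them.\<close>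
  define d where "d n z = real (Suc n) *\<^sub>R (w (z + (1 / real (Suc n)) *\<^sub>R b) - w z)" for n z
  have dm: "d n \<in> borel_measurable lborel" for n
    unfolding d_def[abs_def] using wm by measurable
  have bound: "norm (d n z) \<le> indicator (cball 0 (R + norm b)) z *\<^sub>R (M * norm b)" for n z
  proof (cases "z \<in> cball 0 (R + norm b)")
    case True
    have "norm (d n z) = real (Suc n) * norm (w (z + (1 / real (Suc n)) *\<^sub>R b) - w z)"
      unfolding d_def by (simp del: of_nat_Suc)
    also have "\<dots> \<le> real (Suc n) * (M * norm (z + (1 / real (Suc n)) *\<^sub>R b - z))"
      by (intro mult_left_mono Lip) auto
    also have "\<dots> = M * norm b" by (simp del: of_nat_Suc)
    finally show ?thesis using True by simp
  next
    case False
    have "norm ((1 / real (Suc n)) *\<^sub>R b) \<le> norm b" by (simp add: divide_le_eq mult_le_cancel_left1 del: of_nat_Suc)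
    then have "z + (1 / real (Suc n)) *\<^sub>R b \<notin> cball 0 R" "z \<notin> cball 0 R"
      using False norm_triangle_ineq2[of z "- ((1 / real (Suc n)) *\<^sub>R b)"]
      by (auto simp del: of_nat_Suc norm_scaleR) (smt (verit) norm_ge_zero)
    then have "z + (1 / real (Suc n)) *\<^sub>R b \<notin> K" "z \<notin> K" using R by blast+
    then have "d n z = 0" unfolding d_def using K(2) by simp
    then show ?thesis using False by simp
  qed
  have lim: "AE z in lborel. (\<lambda>n. d n z) \<longlonglongrightarrow> w' z"
    using deriv
  proof eventually_elim
    case (elim z)
    have "filterlim (\<lambda>n. 1 / real (Suc n)) (at 0) sequentially"
      by (rule filterlim_atI) (use LIMSEQ_inverse_real_of_nat in \<open>auto simp: inverse_eq_divide\<close>)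
    moreover have "((\<lambda>t. (w (z + t *\<^sub>R b) - w z) /\<^sub>R t) \<longlongrightarrow> w' z) (at 0)"
    proof -
      have "((\<lambda>t. norm (w (z + t *\<^sub>R b) - w z - t *\<^sub>R w' z) / norm t) \<longlongrightarrow> 0) (at 0)"
        using elim by (simp add: has_vector_derivative_def has_derivative_at)
      moreover have "eventually (\<lambda>t. norm (w (z + t *\<^sub>R b) - w z - t *\<^sub>R w' z) / norm t
          = norm ((w (z + t *\<^sub>R b) - w z) /\<^sub>R t - w' z)) (at 0)"
      proof -
        have "norm (w (z + t *\<^sub>R b) - w z - t *\<^sub>R w' z) / norm t
          = norm ((w (z + t *\<^sub>R b) - w z) /\<^sub>R t - w' z)" if "t \<noteq> 0" for t
        proof -
          have "(w (z + t *\<^sub>R b) - w z) /\<^sub>R t - w' z = inverse t *\<^sub>R (w (z + t *\<^sub>R b) - w z - t *\<^sub>R w' z)"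
            using that by (simp add: scaleR_diff_right)
          then show ?thesis by (simp add: divide_inverse mult.commute)
        qed
        then show ?thesis by (auto simp: eventually_at_filter intro!: always_eventually)
      qed
      ultimately have "((\<lambda>t. norm ((w (z + t *\<^sub>R b) - w z) /\<^sub>R t - w' z)) \<longlongrightarrow> 0) (at 0)"
        by (rule Lim_transform_eventually)
      then show ?thesis by (simp add: tendsto_norm_zero_iff LIM_zero_iff)
    qed
    ultimately have "(\<lambda>n. (w (z + (1 / real (Suc n)) *\<^sub>R b) - w z) /\<^sub>R (1 / real (Suc n))) \<longlonglongrightarrow> w' z"
      by (rule filterlim_compose[rotated])
    then show ?case by (simp add: d_def[abs_def] del: of_nat_Suc)
  qed
  have dom: "integrable lborel (\<lambda>z. indicator (cball (0::complex) (R + norm b)) z *\<^sub>R (M * norm b))"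
    by (rule borel_integrable_compact) auto
  have m': "w' \<in> borel_measurable lborel" using meas by simp
  show "integrable lborel w'"
    by (rule integrable_dominated_convergence[OF m' dm dom lim AE_I2[OF bound]])
  have "(\<lambda>n. integral\<^sup>L lborel (d n)) \<longlonglongrightarrow> integral\<^sup>L lborel w'"
    by (rule integral_dominated_convergence[OF m' dm dom lim AE_I2[OF bound]])
  moreover have "integral\<^sup>L lborel (d n) = 0" for n
  proof -
    let ?c = "(1 / real (Suc n)) *\<^sub>R b"
    have tr: "integrable lborel (\<lambda>z. w (?c + z))" "(LINT z|lborel. w (?c + z)) = integral\<^sup>L lborel w"
      using integrable_distr[of "(+) ?c" lborel borel w] integral_distr[of "(+) ?c" lborel borel w] wi wm
      by (simp_all add: lborel_distr_plus)
    have "integral\<^sup>L lborel (d n) = real (Suc n) *\<^sub>R ((LINT z|lborel. w (?c + z)) - integral\<^sup>L lborel w)"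
      unfolding d_def[abs_def] using tr wi by (simp add: add.commute del: of_nat_Suc)
    then show ?thesis using tr by simp
  qed
  ultimately show "integral\<^sup>L lborel w' = 0" by (simp add: LIMSEQ_const_iff)
qed

lemma continuous_on_extend_0:
  fixes f :: "'a::t2_space \<Rightarrow> 'b::real_normed_vector"
  assumes "open S" "compact K" "K \<subseteq> S" "continuous_on S f" "\<And>z. z \<notin> K \<Longrightarrow> f z = 0"
  shows "continuous_on UNIV f"
proof -
  have "continuous_on (S \<union> - K) f"
  proof (rule continuous_on_open_Un)
    show "open (- K)" using assms(2) by (simp add: compact_imp_closed open_Compl)
    show "continuous_on (- K) f" using assms(5) continuous_on_cong[of "-K" "-K" f "\<lambda>_. 0"] by auto
  qed (use assms in auto)
  moreover have "S \<union> - K = UNIV" using assms(3) by auto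
  ultimately show ?thesis by simp
qed

text \<open>The product of \<open>\<phi>\<close> and \<open>v\<close>, extended by zero, is
  Lipschitz with compact support, so its directional derivative has integral zero; the product rule
  splits this integral into the two sides.\<close>

lemma integral_by_parts_test:
  fixes v F1 F2 :: "complex \<Rightarrow> complex"
  assumes phi: "\<phi> \<in> test_functions \<Omega>" and O: "open \<Omega>"
    and deriv: "\<And>z. z \<in> \<Omega> \<Longrightarrow> (v has_derivative (\<lambda>h. F1 z * h + F2 z * cnj h)) (at z)"
    and cont: "continuous_on \<Omega> F1" "continuous_on \<Omega> F2"
    and b: "b \<in> Basis"
  shows "(LINT z:\<Omega>|lborel. \<phi> z *\<^sub>R (F1 z * b + F2 z * cnj b)) = - (LINT z:\<Omega>|lborel. partial b \<phi> z *\<^sub>R v z)"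
    and "set_integrable lborel \<Omega> (\<lambda>z. \<phi> z *\<^sub>R (F1 z * b + F2 z * cnj b))"
    and "set_integrable lborel \<Omega> (\<lambda>z. partial b \<phi> z *\<^sub>R v z)"
proof -
  obtain K where K: "compact K" "K \<subseteq> \<Omega>" "\<And>z. z \<notin> K \<Longrightarrow> \<phi> z = 0" "\<And>b z. z \<notin> K \<Longrightarrow> partial b \<phi> z = 0"
    using test_functionE[OF phi] by metis
  have vc: "continuous_on \<Omega> v"
    using deriv has_derivative_continuous by (blast intro: continuous_at_imp_continuous_on)
  note pc = test_function_continuous[OF phi] test_function_partial_continuous[OF phi]
  have oc: "1 \<in> (Basis::complex set)" "\<i> \<in> (Basis::complex set)" by (auto simp: Basis_complex_def)
  define w where "w z = (if z \<in> \<Omega> then \<phi> z *\<^sub>R v z else 0)" for z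
  define f1 where "f1 z = (if z \<in> \<Omega> then \<phi> z *\<^sub>R (F1 z * b + F2 z * cnj b) else 0)" for z
  define f2 where "f2 z = (if z \<in> \<Omega> then partial b \<phi> z *\<^sub>R v z else 0)" for z
  have ext: "continuous_on UNIV (\<lambda>z. if z \<in> \<Omega> then g z else 0)"
    if "continuous_on \<Omega> g" "\<And>z. z \<notin> K \<Longrightarrow> g z = 0" for g :: "complex \<Rightarrow> complex"
    by (rule continuous_on_extend_0[OF O K(1,2)]) (use that in \<open>auto cong: continuous_on_cong_simp\<close>)
  have f1c: "continuous_on UNIV f1" unfolding f1_def[abs_def]
    by (rule ext) (use K(3) in \<open>auto intro!: continuous_intros pc cont\<close>)
  have f2c: "continuous_on UNIV f2" unfolding f2_def[abs_def]
    by (rule ext) (use K(4) b in \<open>auto intro!: continuous_intros pc vc\<close>)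
  have f1i: "integrable lborel f1"
    by (rule integrable_compact_support[OF K(1) continuous_on_subset[OF f1c]]) (auto simp: f1_def K)
  have f2i: "integrable lborel f2"
    by (rule integrable_compact_support[OF K(1) continuous_on_subset[OF f2c]]) (auto simp: f2_def K)
  have eqs: "(\<lambda>z. indicator \<Omega> z *\<^sub>R (\<phi> z *\<^sub>R (F1 z * b + F2 z * cnj b))) = f1"
    "(\<lambda>z. indicator \<Omega> z *\<^sub>R (partial b \<phi> z *\<^sub>R v z)) = f2"
    by (auto simp: f1_def f2_def fun_eq_iff)
  show "set_integrable lborel \<Omega> (\<lambda>z. \<phi> z *\<^sub>R (F1 z * b + F2 z * cnj b))"
    "set_integrable lborel \<Omega> (\<lambda>z. partial b \<phi> z *\<^sub>R v z)"
    unfolding set_integrable_def eqs by (fact f1i f2i)+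
  define w' where "w' z h = (if z \<in> \<Omega> then \<phi> z *\<^sub>R (F1 z * h + F2 z * cnj h)
      + frechet_derivative \<phi> (at z) h *\<^sub>R v z else 0)" for z h
  have wd: "(w has_derivative w' z) (at z)" for z
  proof (cases "z \<in> \<Omega>")
    case True
    have "((\<lambda>z. \<phi> z *\<^sub>R v z) has_derivative (\<lambda>h. \<phi> z *\<^sub>R (F1 z * h + F2 z * cnj h)
        + frechet_derivative \<phi> (at z) h *\<^sub>R v z)) (at z)"
      using has_derivative_scaleR[OF _ deriv[OF True]] test_function_differentiable[OF phi] frechet_derivative_works
      by blast
    then have "((\<lambda>z. \<phi> z *\<^sub>R v z) has_derivative w' z) (at z)"
      using True by (simp add: w'_def[abs_def])
    then show ?thesis
      by (rule has_derivative_transform_within_open[OF _ O True]) (simp add: w_def)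
  next
    case False
    then have z: "z \<in> - K" using K(2) by auto
    have "((\<lambda>z. 0) has_derivative w' z) (at z)" using False by (simp add: w'_def[abs_def])
    then show ?thesis
      by (rule has_derivative_transform_within_open[of _ _ _ _ "- K"])
        (use z K in \<open>auto simp: w_def compact_imp_closed open_Compl\<close>)
  qed
  \<comment> \<open>A continuous majorant of the operator norm of the derivative of
    \<open>w\<close>, supported in \<open>K\<close>; a bound for it on \<open>K\<close> is a global
    Lipschitz constant.\<close>
  define B where "B z = (if z \<in> \<Omega> then of_real (\<bar>\<phi> z\<bar> * (norm (F1 z) + norm (F2 z))
     + (\<bar>partial 1 \<phi> z\<bar> + \<bar>partial \<i> \<phi> z\<bar>) * norm (v z)) else 0 :: complex)" for z
  have "continuous_on UNIV B" unfolding B_def[abs_def]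
    by (rule ext) (use K(3,4) oc in \<open>auto intro!: continuous_intros pc vc cont\<close>)
  then have "bounded (B ` K)"
    using K(1) by (meson compact_continuous_image compact_imp_bounded continuous_on_subset top_greatest)
  then obtain M where M: "\<And>z. z \<in> K \<Longrightarrow> norm (B z) \<le> M" unfolding bounded_iff by auto
  have M': "norm (B z) \<le> \<bar>M\<bar>" for z
    using M[of z] K(3,4) by (cases "z \<in> K") (auto simp: B_def)
  have w'b: "norm (w' z h) \<le> \<bar>M\<bar> * norm h" for z h
  proof (cases "z \<in> \<Omega>")
    case True
    have "norm (w' z h) \<le> \<bar>\<phi> z\<bar> * (norm (F1 z) * norm h + norm (F2 z) * norm h)
       + (\<bar>partial 1 \<phi> z\<bar> * norm h + \<bar>partial \<i> \<phi> z\<bar> * norm h) * norm (v z)"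
    proof -
      have "norm (F1 z * h + F2 z * cnj h) \<le> norm (F1 z) * norm h + norm (F2 z) * norm h"
        by (intro order_trans[OF norm_triangle_ineq]) (simp add: norm_mult)
      moreover have "\<bar>frechet_derivative \<phi> (at z) h\<bar> \<le> \<bar>partial 1 \<phi> z\<bar> * norm h + \<bar>partial \<i> \<phi> z\<bar> * norm h"
        unfolding partial_1_i_linear[OF test_function_differentiable[OF phi]] real_scaleR_def
        using abs_Re_le_cmod[of h] abs_Im_le_cmod[of h]
        by (intro order_trans[OF abs_triangle_ineq] add_mono) (auto simp: abs_mult mult.commute intro!: mult_mono)
      ultimately show ?thesis using True unfolding w'_def
        by (auto intro!: order_trans[OF norm_triangle_ineq] add_mono mult_left_mono mult_right_mono)
    qed
    also have "\<dots> = norm (B z) * norm h" using True unfolding B_def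
      by (simp only: if_True norm_of_real) (subst abs_of_nonneg, auto simp: algebra_simps)
    finally show ?thesis using mult_right_mono[OF M'[of z] norm_ge_zero[of h]] by linarith
  qed (simp add: w'_def)
  have Lip: "norm (w x - w y) \<le> \<bar>M\<bar> * norm (x - y)" for x y
    by (rule differentiable_bound[of UNIV w w']) (use wd w'b in \<open>auto intro!: onorm_bound\<close>)
  have w'e: "w' z b = f1 z + f2 z" for z by (simp add: w'_def f1_def f2_def partial_def)
  have "((\<lambda>t::real. w (z + t *\<^sub>R b)) has_vector_derivative w' z b) (at 0)" for z
    by (rule has_derivative_directional[OF wd])
  then have "integral\<^sup>L lborel (\<lambda>z. w' z b) = 0"
    using Lip K(1) f1c f2c unfolding w'e
    by (intro integral_directional_derivative_eq_0(2)[of w "\<bar>M\<bar>" K _ b])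
      (auto simp: w_def K(3) intro!: borel_measurable_continuous_onI continuous_intros)
  then have "integral\<^sup>L lborel f1 + integral\<^sup>L lborel f2 = 0"
    using f1i f2i by (simp add: w'e)
  then show "(LINT z:\<Omega>|lborel. \<phi> z *\<^sub>R (F1 z * b + F2 z * cnj b)) = - (LINT z:\<Omega>|lborel. partial b \<phi> z *\<^sub>R v z)"
    unfolding set_lebesgue_integral_def eqs by (simp add: add_eq_0_iff2)
qed

section \<open>Integrability of negative powers of the distance\<close>

lemma nn_integral_bounded_by_series:
  assumes F: "\<And>n. F n \<in> borel_measurable M" "\<And>n. (\<integral>\<^sup>+z. F n z \<partial>M) \<le> ennreal (c n)" "\<And>n. c n \<ge> 0" "summable c"
    and H: "H \<in> borel_measurable M" "(\<integral>\<^sup>+z. H z \<partial>M) < \<infinity>"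
    and le: "\<And>z. z \<in> space M \<Longrightarrow> \<exists>n. f z \<le> H z + F n z"
  shows "(\<integral>\<^sup>+z. f z \<partial>M) < \<infinity>"
proof -
  have "(\<integral>\<^sup>+z. f z \<partial>M) \<le> (\<integral>\<^sup>+z. H z + (\<Sum>n. F n z) \<partial>M)"
  proof (rule nn_integral_mono)
    fix z assume "z \<in> space M"
    \<comment> \<open>The index varies with the point; replacing the selected \<open>F n\<close> by
      the sum of all of them removes the choice at the cost of a convergent series.\<close>
    then obtain n where n: "f z \<le> H z + F n z" using le by blast
    have "F n z = (\<Sum>k\<in>{n}. F k z)" by simp
    also have "\<dots> \<le> (\<Sum>n. F n z)" by (rule sum_le_suminf) auto
    finally show "f z \<le> H z + (\<Sum>n. F n z)" using n add_left_mono order_trans by blast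
  qed
  also have "\<dots> = (\<integral>\<^sup>+z. H z \<partial>M) + (\<integral>\<^sup>+z. (\<Sum>n. F n z) \<partial>M)"
    using F(1) H(1) by (intro nn_integral_add borel_measurable_suminf_order) auto
  also have "(\<integral>\<^sup>+z. (\<Sum>n. F n z) \<partial>M) = (\<Sum>n. \<integral>\<^sup>+z. F n z \<partial>M)" by (rule nn_integral_suminf) (fact F(1))
  also have "(\<Sum>n. \<integral>\<^sup>+z. F n z \<partial>M) \<le> (\<Sum>n. ennreal (c n))" by (rule suminf_le) (use F(2) in auto)
  also have "(\<integral>\<^sup>+z. H z \<partial>M) + (\<Sum>n. ennreal (c n)) < \<infinity>"
    using ennreal_suminf_neq_top[OF F(4,3)] H(2) by (simp add: less_top)
  finally show ?thesis by (simp add: add_left_mono)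
qed

lemma emeasure_ball_complex:
  fixes q :: complex
  assumes "r \<ge> 0" shows "emeasure lborel (ball q r) = ennreal (pi * r\<^sup>2)"
  using emeasure_ball[OF assms, of q] by (simp add: unit_ball_vol_2)

text \<open>Dyadic discs replace polar coordinates: between the radii \<open>R / 2 ^ (n + 1)\<close>
  and \<open>R / 2 ^ n\<close> the integrand is at most its value at the inner radius, so only areas
  of discs are needed. The resulting series is geometric with ratio \<open>2 powr p / 4\<close>,
  which is below \<open>1\<close> for \<open>p < 2\<close>.\<close>

lemma nn_integral_norm_powr:
  fixes q :: complex
  assumes "0 \<le> p" "p < 2" "0 < R"
  shows "(\<integral>\<^sup>+z. ennreal (indicator (ball q R) z * norm (z - q) powr (- p)) \<partial>lborel) < \<infinity>"
proof (rule nn_integral_bounded_by_series)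
  define F where "F n z = ennreal ((R / 2 ^ (Suc n)) powr (- p)) * indicator (ball q (R / 2 ^ n)) z" for n :: nat and z
  define c where "c n = (R / 2 ^ (Suc n)) powr (- p) * (pi * (R / 2 ^ n)\<^sup>2)" for n :: nat
  show "F n \<in> borel_measurable lborel" for n unfolding F_def[abs_def]
    by (intro borel_measurable_times_ennreal borel_measurable_const borel_measurable_indicator) simp
  show "(\<integral>\<^sup>+z. F n z \<partial>lborel) \<le> ennreal (c n)" for n
    unfolding F_def c_def using assms
    by (simp add: nn_integral_cmult_indicator emeasure_ball_complex ennreal_mult)
  show "c n \<ge> 0" for n by (simp add: c_def)
  have "c n = ((R / 2) powr (- p) * (pi * R\<^sup>2)) * (2 powr p / 4) ^ n" for n
  proof -
    have "(R / 2 ^ (Suc n)) powr (- p) = (R / 2) powr (- p) * (2 powr p) ^ n"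
    proof -
      have "(R / 2 ^ (Suc n)) powr (- p) = (R / 2 * inverse (2 ^ n)) powr (- p)" by (simp add: field_simps)
      also have "\<dots> = (R / 2) powr (- p) * (inverse (2 ^ n)) powr (- p)" by (rule powr_mult; use assms in simp)
      also have "(inverse (2 ^ n)) powr (- p) = (2 powr p) ^ n"
      proof -
        have "inverse (2 ^ n) = 2 powr (- real n)" by (simp add: powr_minus powr_realpow)
        moreover have "(2 powr p) ^ n = (2 powr p) powr real n" by (simp add: powr_realpow)
        ultimately show ?thesis by (simp only: powr_powr mult.commute minus_mult_minus)
      qed
      finally show ?thesis .
    qed
    moreover have "(R / 2 ^ n)\<^sup>2 = R\<^sup>2 / 4 ^ n" 
      using power_mult[of "2::real" 2 n] power_mult[of "2::real" n 2] by (simp add: power_divide mult.commute)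
    ultimately show ?thesis unfolding c_def power_divide[of "2 powr p"] by (simp only: times_divide_eq_left times_divide_eq_right mult_ac)
  qed
  moreover have "2 powr p / 4 < 1"
    using powr_less_mono[of p 2 2] assms by simp
  then have "summable (\<lambda>n. ((R / 2) powr (- p) * (pi * R\<^sup>2)) * (2 powr p / 4) ^ n)"
    by (intro summable_mult summable_geometric) auto
  ultimately show "summable c" by presburger
  show "(\<lambda>_. 0) \<in> borel_measurable lborel" "(\<integral>\<^sup>+z. 0 \<partial>(lborel :: complex measure)) < \<infinity>" by auto
  fix z :: complex
  have "\<exists>n. ennreal (indicator (ball q R) z * norm (z - q) powr (- p)) \<le> F n z"
  proof (cases "z \<in> ball q R \<and> z \<noteq> q")
    case False
    then show ?thesis by (intro exI[of _ 0]) (auto simp: indicator_def)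
  next
    case True
    define r where "r = norm (z - q)"
    have r: "0 < r" "r < R" using True by (auto simp: r_def dist_norm norm_minus_commute)
    have "\<exists>n. R / 2 ^ n \<le> r"
    proof -
      obtain n where "(1/2) ^ n < r / R" using real_arch_pow_inv[of "r / R" "1/2"] r by auto
      then show ?thesis using r by (intro exI[of _ n]) (simp add: field_simps power_divide)
    qed
    then obtain n where n: "R / 2 ^ n \<le> r" "\<And>k. k < n \<Longrightarrow> \<not> R / 2 ^ k \<le> r"
      using exists_least_iff[of "\<lambda>n. R / 2 ^ n \<le> r"] by auto
    \<comment> \<open>\<open>n\<close> is the first scale not above \<open>r\<close>. It is positive
      since \<open>r < R\<close>, and its predecessor labels the shell that contains the
      point.\<close>
    have "n \<noteq> 0" using n(1) r by (cases n) auto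
    then obtain k where k: "n = Suc k" by (cases n) auto
    have "r < R / 2 ^ k" using n(2)[of k] k by simp
    moreover have "r powr (- p) \<le> (R / 2 ^ (Suc k)) powr (- p)"
      using n(1) k r assms by (intro powr_mono2') auto
    ultimately show ?thesis using True unfolding F_def r_def
      by (intro exI[of _ k]) (auto simp: dist_norm norm_minus_commute indicator_def intro!: ennreal_leI)
  qed
  then show "\<exists>n. ennreal (indicator (ball q R) z * norm (z - q) powr (- p)) \<le> 0 + F n z" by simp
qed

text \<open>The singularities of the logarithmic derivative have infinitely many centres; they all
  share one value of this integral, so only coefficients have to be summed.\<close>

lemma nn_integral_norm_powr_translate:
  fixes q :: complex
  shows "(\<integral>\<^sup>+z. ennreal (indicator (ball q R) z * norm (z - q) powr (- p)) \<partial>lborel)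
    = (\<integral>\<^sup>+z. ennreal (indicator (ball 0 R) z * norm (z::complex) powr (- p)) \<partial>lborel)"
proof -
  let ?g = "\<lambda>z::complex. ennreal (indicator (ball 0 R) z * norm z powr (- p))"
  have m: "?g \<in> borel_measurable borel"
    unfolding powr_def by (intro measurable_compose[OF _ measurable_ennreal] borel_measurable_times borel_measurable_indicator) simp_all
  have "(\<integral>\<^sup>+z. ?g z \<partial>lborel) = (\<integral>\<^sup>+z. ?g z \<partial>(distr lborel borel ((+) (- q))))"
    by (simp add: lborel_distr_plus)
  also have "\<dots> = (\<integral>\<^sup>+z. ?g (- q + z) \<partial>lborel)"
    by (rule nn_integral_distr) (use m in auto)
  also have "\<dots> = (\<integral>\<^sup>+z. ennreal (indicator (ball q R) z * norm (z - q) powr (- p)) \<partial>lborel)"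
    by (intro nn_integral_cong) (auto simp: indicator_def dist_norm norm_minus_commute)
  finally show ?thesis by simp
qed

section \<open>The Cauchy kernel as a fundamental solution\<close>

text \<open>Twice the Wirtinger derivative with respect to \<open>cnj z\<close>.\<close>

definition dbar :: "(complex \<Rightarrow> real) \<Rightarrow> complex \<Rightarrow> complex" where
  "dbar \<phi> z = of_real (partial 1 \<phi> z) + \<i> * of_real (partial \<i> \<phi> z)"

text \<open>A Lipschitz regularisation of \<open>1 / z\<close>: holomorphic for \<open>|z| > \<epsilon>\<close>, while \<open>dbar\<close> of it is the
  constant \<open>2 / \<epsilon>\<^sup>2\<close> for \<open>|z| < \<epsilon>\<close>, so that only the area of a disc is needed in the limit.\<close>

definition cauchy_reg :: "real \<Rightarrow> complex \<Rightarrow> complex" where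
  "cauchy_reg \<epsilon> z = cnj z / of_real ((max (norm z) \<epsilon>)\<^sup>2)"

lemma cauchy_reg_outer: "\<epsilon> > 0 \<Longrightarrow> norm z \<ge> \<epsilon> \<Longrightarrow> cauchy_reg \<epsilon> z = inverse z"
proof -
  assume e: "\<epsilon> > 0" "norm z \<ge> \<epsilon>"
  then have "cauchy_reg \<epsilon> z = cnj z / (z * cnj z)"
    unfolding cauchy_reg_def complex_norm_square[symmetric] by (simp add: max_def)
  moreover have "z \<noteq> 0" using e by auto
  ultimately show ?thesis by (simp add: divide_inverse)
qed

lemma cauchy_reg_inner: "norm z \<le> \<epsilon> \<Longrightarrow> cauchy_reg \<epsilon> z = cnj z / of_real (\<epsilon>\<^sup>2)"
  by (simp add: cauchy_reg_def max_def)

lemma norm_cauchy_reg_le: "\<epsilon> > 0 \<Longrightarrow> norm (cauchy_reg \<epsilon> z) \<le> 1 / \<epsilon>" "\<epsilon> > 0 \<Longrightarrow> z \<noteq> 0 \<Longrightarrow> norm (cauchy_reg \<epsilon> z) \<le> 1 / norm z"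
proof -
  assume e: "\<epsilon> > 0"
  define m where "m = max (norm z) \<epsilon>"
  have m: "m > 0" "norm z \<le> m" "\<epsilon> \<le> m" using e by (auto simp: m_def)
  have n: "norm (cauchy_reg \<epsilon> z) = norm z / m\<^sup>2"
    unfolding cauchy_reg_def m_def[symmetric] by (simp add: norm_divide norm_power)
  have "norm z / m\<^sup>2 \<le> m / m\<^sup>2" using m by (intro divide_right_mono) auto
  also have "\<dots> = 1 / m" using m by (simp add: power2_eq_square)
  also have "\<dots> \<le> 1 / \<epsilon>" using m e by (simp add: frac_le)
  finally show "norm (cauchy_reg \<epsilon> z) \<le> 1 / \<epsilon>" using n by simp
  assume z: "z \<noteq> 0"
  have "norm z / m\<^sup>2 \<le> norm z / (norm z)\<^sup>2" using m z by (intro divide_left_mono) (auto intro: power_mono)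
  also have "\<dots> = 1 / norm z" using z by (simp add: power2_eq_square)
  finally show "norm (cauchy_reg \<epsilon> z) \<le> 1 / norm z" using n by simp
qed

text \<open>Inside the circle of radius \<open>\<epsilon>\<close> the function is a multiple of
  conjugation, outside it is inversion, and both satisfy the bound. A segment joining the two
  regions is cut where it meets the circle, and the lengths of its parts add up.\<close>

lemma cauchy_reg_Lipschitz:
  assumes e: "\<epsilon> > 0"
  shows "norm (cauchy_reg \<epsilon> x - cauchy_reg \<epsilon> y) \<le> 1 / \<epsilon>\<^sup>2 * norm (x - y)"
proof -
  have inner: "norm (cauchy_reg \<epsilon> x - cauchy_reg \<epsilon> y) \<le> 1 / \<epsilon>\<^sup>2 * norm (x - y)"
    if "norm x \<le> \<epsilon>" "norm y \<le> \<epsilon>" for x y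
  proof -
    have "cauchy_reg \<epsilon> x - cauchy_reg \<epsilon> y = cnj (x - y) / of_real (\<epsilon>\<^sup>2)"
      using that by (simp add: cauchy_reg_inner diff_divide_distrib)
    then show ?thesis by (simp add: norm_divide norm_power del: complex_cnj_diff)
  qed
  have outer: "norm (cauchy_reg \<epsilon> x - cauchy_reg \<epsilon> y) \<le> 1 / \<epsilon>\<^sup>2 * norm (x - y)"
    if xy: "\<epsilon> \<le> norm x" "\<epsilon> \<le> norm y" for x y
  proof -
    have nz: "x \<noteq> 0" "y \<noteq> 0" using xy e by auto
    have "cauchy_reg \<epsilon> x - cauchy_reg \<epsilon> y = (y - x) / (x * y)"
      using xy e nz by (simp add: cauchy_reg_outer field_simps)
    then have "norm (cauchy_reg \<epsilon> x - cauchy_reg \<epsilon> y) = norm (x - y) / (norm x * norm y)"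
      by (simp add: norm_divide norm_mult norm_minus_commute)
    also have "\<dots> \<le> norm (x - y) / (\<epsilon> * \<epsilon>)"
      using xy e nz by (intro divide_left_mono mult_mono) auto
    finally show ?thesis by (simp add: power2_eq_square)
  qed
  have mixed: "norm (cauchy_reg \<epsilon> x - cauchy_reg \<epsilon> y) \<le> 1 / \<epsilon>\<^sup>2 * norm (x - y)"
    if xy: "norm x \<le> \<epsilon>" "\<epsilon> \<le> norm y" for x y
  proof -
    have "\<exists>t\<ge>0. t \<le> 1 \<and> norm (x + t *\<^sub>R (y - x)) = \<epsilon>"
      by (rule IVT') (use xy in \<open>auto intro!: continuous_intros\<close>)
    then obtain t where t: "0 \<le> t" "t \<le> 1" "norm (x + t *\<^sub>R (y - x)) = \<epsilon>" by blast
    define p where "p = x + t *\<^sub>R (y - x)"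
    have p: "norm p = \<epsilon>" using t by (simp add: p_def)
    have 1: "norm (x - p) = t * norm (x - y)" using t by (simp add: p_def norm_minus_commute)
    have "p - y = (1 - t) *\<^sub>R (x - y)" by (simp add: p_def algebra_simps)
    then have 2: "norm (p - y) = (1 - t) * norm (x - y)" using t by simp
    have "norm (cauchy_reg \<epsilon> x - cauchy_reg \<epsilon> y) \<le> norm (cauchy_reg \<epsilon> x - cauchy_reg \<epsilon> p) + norm (cauchy_reg \<epsilon> p - cauchy_reg \<epsilon> y)"
      using norm_triangle_ineq[of "cauchy_reg \<epsilon> x - cauchy_reg \<epsilon> p" "cauchy_reg \<epsilon> p - cauchy_reg \<epsilon> y"] by simp
    also have "\<dots> \<le> 1 / \<epsilon>\<^sup>2 * norm (x - p) + 1 / \<epsilon>\<^sup>2 * norm (p - y)"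
      using xy p by (intro add_mono inner outer) auto
    also have "\<dots> = 1 / \<epsilon>\<^sup>2 * norm (x - y)" unfolding 1 2 by (simp add: algebra_simps diff_divide_distrib)
    finally show ?thesis .
  qed
  show ?thesis
    using inner[of x y] outer[of x y] mixed[of x y] mixed[of y x]
    by (cases "norm x \<le> \<epsilon>"; cases "norm y \<le> \<epsilon>") (auto simp: norm_minus_commute)
qed

text \<open>On the circle the derivative of the regularised kernel jumps, so directional derivatives
  are available only almost everywhere.\<close>

lemma null_sets_sphere: "sphere (q::complex) r \<in> null_sets lborel"
proof -
  have "negligible (sphere q r)" using negligible_sphere by auto
  then have "sphere q r \<in> null_sets lebesgue" by (simp add: negligible_iff_null_sets)
  then show ?thesis by (simp add: null_sets_completion_iff)
qed

text \<open>The product of \<open>\<phi>\<close> with the regularised kernel is Lipschitz, so its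
  derivatives in the directions \<open>1\<close> and \<open>\<i>\<close> have integral zero; the
  first plus \<open>\<i>\<close> times the second isolates \<open>dbar\<close> of each
  factor.\<close>

lemma integral_dbar_cauchy_reg:
  assumes phi: "\<phi> \<in> test_functions \<Omega>" and e: "\<epsilon> > 0"
  shows "(LINT z|lborel. dbar \<phi> z * cauchy_reg \<epsilon> (z - q)) =
    - (LINT z|lborel. of_real (2 / \<epsilon>\<^sup>2 * \<phi> z * indicator (ball q \<epsilon>) z))"
proof -
  obtain K where K: "compact K" "\<And>z. z \<notin> K \<Longrightarrow> \<phi> z = 0" "\<And>b z. z \<notin> K \<Longrightarrow> partial b \<phi> z = 0"
    using test_functionE[OF phi] by metis
  obtain M where M: "M \<ge> 0" "\<And>z. \<bar>\<phi> z\<bar> \<le> M" "\<And>x y. \<bar>\<phi> x - \<phi> y\<bar> \<le> 2 * M * norm (x - y)"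
    using test_function_bounds[OF phi] by metis
  define k where "k z = cauchy_reg \<epsilon> (z - q)" for z
  have kb: "norm (k z) \<le> 1 / \<epsilon>" for z using norm_cauchy_reg_le(1)[OF e] by (simp add: k_def)
  have kL: "norm (k x - k y) \<le> 1 / \<epsilon>\<^sup>2 * norm (x - y)" for x y
    using cauchy_reg_Lipschitz[OF e, of "x - q" "y - q"] by (simp add: k_def)
  have kc: "continuous_on A k" for A
  proof (rule continuous_on_subset[OF lipschitz_on_continuous_on])
    show "(1 / \<epsilon>\<^sup>2)-lipschitz_on UNIV k" using kL by (auto intro!: lipschitz_onI simp: dist_norm)
  qed auto
  \<comment> \<open>The directional derivative of the kernel off the circle: conjugate linear in
    \<open>b\<close> inside, complex linear outside.\<close>
  define k' where "k' b z = (if norm (z - q) < \<epsilon> then cnj b / of_real (\<epsilon>\<^sup>2) else - b / (z - q)\<^sup>2)" for b z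
  define w where "w z = \<phi> z *\<^sub>R k z" for z
  have Lip: "norm (w x - w y) \<le> (M / \<epsilon>\<^sup>2 + 2 * M / \<epsilon>) * norm (x - y)" for x y
  proof -
    have "w x - w y = \<phi> x *\<^sub>R (k x - k y) + (\<phi> x - \<phi> y) *\<^sub>R k y"
      by (simp add: w_def algebra_simps)
    then have "norm (w x - w y) \<le> \<bar>\<phi> x\<bar> * norm (k x - k y) + \<bar>\<phi> x - \<phi> y\<bar> * norm (k y)"
      by (metis norm_scaleR norm_triangle_ineq)
    also have "\<dots> \<le> M * (1 / \<epsilon>\<^sup>2 * norm (x - y)) + (2 * M * norm (x - y)) * (1 / \<epsilon>)"
      using M kL kb e by (intro add_mono mult_mono) auto
    finally show ?thesis by (simp add: algebra_simps)
  qed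
  have k'm: "k' b \<in> borel_measurable borel" for b
    unfolding k'_def[abs_def] by measurable
  have phm: "\<phi> \<in> borel_measurable borel"
    by (rule borel_measurable_continuous_onI[OF test_function_continuous[OF phi]])
  have pm: "partial b \<phi> \<in> borel_measurable borel" if "b \<in> Basis" for b
    by (rule borel_measurable_continuous_onI[OF test_function_partial_continuous[OF phi that]])
  have km: "k \<in> borel_measurable borel"
    by (rule borel_measurable_continuous_onI[OF kc])
  have kd: "((\<lambda>t::real. k (z + t *\<^sub>R b)) has_vector_derivative k' b z) (at 0)" if "z \<notin> sphere q \<epsilon>" for z b
  proof (cases "norm (z - q) < \<epsilon>")
    case True
    have d: "(k has_derivative (\<lambda>h. cnj h / of_real (\<epsilon>\<^sup>2))) (at z)"
    proof (rule has_derivative_transform_within_open)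
      show "((\<lambda>x. cnj (x - q) / of_real (\<epsilon>\<^sup>2)) has_derivative (\<lambda>h. cnj h / of_real (\<epsilon>\<^sup>2))) (at z)"
        by (rule bounded_linear.has_derivative[OF bounded_linear_compose[OF bounded_linear_divide bounded_linear_cnj]])
          (auto intro!: derivative_eq_intros)
      show "open (ball q \<epsilon>)" "z \<in> ball q \<epsilon>" using True by (auto simp: dist_norm norm_minus_commute)
      show "cnj (x - q) / of_real (\<epsilon>\<^sup>2) = k x" if "x \<in> ball q \<epsilon>" for x
        using that by (simp add: k_def cauchy_reg_inner dist_norm norm_minus_commute)
    qed
    show ?thesis using has_derivative_directional[OF d, of b] True by (simp add: k'_def)
  next
    case False
    then have z: "\<epsilon> < norm (z - q)" using that by (auto simp: dist_norm norm_minus_commute)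
    have zq: "z - q \<noteq> 0" using z e by auto
    have d: "(k has_derivative (\<lambda>h. - h / (z - q)\<^sup>2)) (at z)"
    proof (rule has_derivative_transform_within_open)
      show "((\<lambda>x. inverse (x - q)) has_derivative (\<lambda>h. - h / (z - q)\<^sup>2)) (at z)"
        using zq by (auto intro!: derivative_eq_intros simp: power2_eq_square field_simps)
      show "open (- cball q \<epsilon>)" "z \<in> - cball q \<epsilon>" using z by (auto simp: dist_norm norm_minus_commute)
      show "inverse (x - q) = k x" if "x \<in> - cball q \<epsilon>" for x
        using that e by (simp add: k_def cauchy_reg_outer dist_norm norm_minus_commute)
    qed
    show ?thesis using has_derivative_directional[OF d, of b] False by (simp add: k'_def)
  qed
  have phd: "((\<lambda>t::real. \<phi> (z + t *\<^sub>R b)) has_vector_derivative partial b \<phi> z) (at 0)" for z b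
    unfolding partial_def
    by (rule has_derivative_directional) (use test_function_differentiable[OF phi] frechet_derivative_works in blast)
  define w' where "w' b z = \<phi> z *\<^sub>R k' b z + partial b \<phi> z *\<^sub>R k z" for b z
  have wd: "((\<lambda>t::real. w (z + t *\<^sub>R b)) has_vector_derivative w' b z) (at 0)" if "z \<notin> sphere q \<epsilon>" for z b
    using has_vector_derivative_scaleR[OF phd[of z b, unfolded has_real_derivative_iff_has_vector_derivative[symmetric]] kd[OF that, of b]]
    by (simp add: w_def[abs_def] w'_def)
  have AE: "AE z in lborel. ((\<lambda>t::real. w (z + t *\<^sub>R b)) has_vector_derivative w' b z) (at 0)" for b
    by (rule AE_I'[OF null_sets_sphere[of q \<epsilon>]]) (use wd in blast)
  have I: "integrable lborel (w' b)" "integral\<^sup>L lborel (w' b) = 0" if "b \<in> Basis" for b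
  proof -
    have m: "w' b \<in> borel_measurable borel"
      unfolding w'_def[abs_def] using k'm[of b] km pm[OF that] phm by measurable
    have w0: "w z = 0" if "z \<notin> K" for z using K(2)[OF that] by (simp add: w_def)
    show "integrable lborel (w' b)"
      by (rule integral_directional_derivative_eq_0(1)[OF Lip K(1) w0 m AE])
    show "integral\<^sup>L lborel (w' b) = 0"
      by (rule integral_directional_derivative_eq_0(2)[OF Lip K(1) w0 m AE])
  qed
  have oc: "1 \<in> (Basis::complex set)" "\<i> \<in> (Basis::complex set)" by (auto simp: Basis_complex_def)
  have pi: "integrable lborel (\<lambda>z. partial b \<phi> z *\<^sub>R k z)" if "b \<in> Basis" for b
    by (rule integrable_compact_support[OF K(1)])
      (use K(3) in \<open>auto intro!: continuous_intros test_function_partial_continuous[OF phi that] kc\<close>)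
  have "integral\<^sup>L lborel (w' 1) + \<i> * integral\<^sup>L lborel (w' \<i>) = 0" using I oc by simp
  then have "(LINT z|lborel. w' 1 z + \<i> * w' \<i> z) = 0" using I oc by simp
  \<comment> \<open>Outside, the two kernel contributions cancel because
    \<open>\<i> * \<i> = -1\<close>; inside they add up to
    \<open>2 / \<epsilon>\<^sup>2\<close>.\<close>
  moreover have "w' 1 z + \<i> * w' \<i> z = of_real (2 / \<epsilon>\<^sup>2 * \<phi> z * indicator (ball q \<epsilon>) z) + dbar \<phi> z * k z" for z
    using e unfolding w'_def k'_def dbar_def
    by (auto simp: scaleR_conv_of_real dist_norm norm_minus_commute field_simps)
  ultimately have "(LINT z|lborel. of_real (2 / \<epsilon>\<^sup>2 * \<phi> z * indicator (ball q \<epsilon>) z) + dbar \<phi> z * k z) = 0" by simp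
  moreover have d: "integrable lborel (\<lambda>z. dbar \<phi> z * k z)"
  proof -
    have "(\<lambda>z. dbar \<phi> z * k z) = (\<lambda>z. partial 1 \<phi> z *\<^sub>R k z + \<i> * (partial \<i> \<phi> z *\<^sub>R k z))"
      by (simp add: dbar_def fun_eq_iff scaleR_conv_of_real algebra_simps)
    then show ?thesis using Bochner_Integration.integrable_add[OF pi[OF oc(1)] integrable_mult_right[OF pi[OF oc(2)]], of \<i>]
      by (simp only:)
  qed
  moreover have "integrable lborel (\<lambda>z. of_real (2 / \<epsilon>\<^sup>2 * \<phi> z * indicator (ball q \<epsilon>) z) :: complex)"
  proof -
    have "integrable lborel (\<lambda>z. \<phi> z)"
      by (rule integrable_compact_support[OF K(1) test_function_continuous[OF phi] K(2)])
    then have "integrable lborel (\<lambda>z. indicator (ball q \<epsilon>) z *\<^sub>R \<phi> z)"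
      by (intro integrable_mult_indicator) auto
    then have "integrable lborel (\<lambda>z. 2 / \<epsilon>\<^sup>2 * (indicator (ball q \<epsilon>) z *\<^sub>R \<phi> z))" by (rule integrable_mult_right)
    then show ?thesis by (intro integrable_of_real) (simp add: mult_ac)
  qed
  ultimately show ?thesis unfolding k_def[symmetric] by (simp add: add_eq_0_iff)
qed

lemma integrable_norm_powr:
  fixes q :: complex
  assumes "0 \<le> p" "p < 2" "0 < R"
  shows "integrable lborel (\<lambda>z. indicator (ball q R) z * norm (z - q) powr (- p))"
proof (rule integrableI_nonneg)
  show "(\<lambda>z. indicator (ball q R) z * norm (z - q) powr (- p)) \<in> borel_measurable lborel"
    unfolding powr_def by (intro borel_measurable_times borel_measurable_indicator) simp_all
qed (use nn_integral_norm_powr[OF assms, of q] in auto)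

lemma test_dbar_bound:
  assumes "\<phi> \<in> test_functions \<Omega>"
  obtains M where "M \<ge> 0" "\<And>z. norm (dbar \<phi> z) \<le> M"
proof -
  obtain M where M: "M \<ge> 0" "\<And>z. \<bar>partial 1 \<phi> z\<bar> \<le> M" "\<And>z. \<bar>partial \<i> \<phi> z\<bar> \<le> M"
    using test_function_bounds[OF assms] by metis
  have "norm (dbar \<phi> z) \<le> 2 * M" for z
    unfolding dbar_def using M(2)[of z] M(3)[of z]
    by (intro order_trans[OF norm_triangle_ineq]) (simp add: norm_mult)
  with that[of "2 * M"] M(1) show ?thesis by simp
qed

lemma test_dbar_continuous:
  assumes "\<phi> \<in> test_functions \<Omega>"
  shows "continuous_on A (dbar \<phi>)"
proof -
  have "1 \<in> (Basis::complex set)" "\<i> \<in> (Basis::complex set)" by (auto simp: Basis_complex_def)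
  then show ?thesis unfolding dbar_def[abs_def]
    by (intro continuous_intros test_function_partial_continuous[OF assms])
qed

text \<open>In classical terms, \<open>1 / (2 * pi * z)\<close> is a fundamental solution of
  \<open>dbar\<close>. As the regularisation is removed, one side is dominated by a multiple of
  \<open>1 / norm (z - q)\<close> near the support, and the other side is \<open>- 2 * pi\<close>
  times the mean of \<open>\<phi>\<close> over a shrinking disc.\<close>

lemma
  assumes phi: "\<phi> \<in> test_functions \<Omega>"
  shows integrable_dbar_cauchy: "integrable lborel (\<lambda>z. dbar \<phi> z * inverse (z - q))"
    and integral_dbar_cauchy: "(LINT z|lborel. dbar \<phi> z * inverse (z - q)) = - (2 * pi * \<phi> q)"
proof -
  obtain K where K: "compact K" "\<And>z. z \<notin> K \<Longrightarrow> \<phi> z = 0" "\<And>b z. z \<notin> K \<Longrightarrow> partial b \<phi> z = 0"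
    using test_functionE[OF phi] by metis
  obtain R0 where R0: "\<And>z. z \<in> K \<Longrightarrow> dist q z \<le> R0"
    using compact_imp_bounded[OF K(1)] bounded_any_center[of K q] by auto
  define R where "R = \<bar>R0\<bar> + 1"
  have R: "R > 0" "K \<subseteq> ball q R" using R0 by (force simp: R_def)+
  obtain D where D: "D \<ge> 0" "\<And>z. norm (dbar \<phi> z) \<le> D" using test_dbar_bound[OF phi] by blast
  obtain M where M: "M \<ge> 0" "\<And>z. \<bar>\<phi> z\<bar> \<le> M" "\<And>x y. \<bar>\<phi> x - \<phi> y\<bar> \<le> 2 * M * norm (x - y)"
    using test_function_bounds[OF phi] by metis
  define \<epsilon> where "\<epsilon> n = 1 / real (Suc n)" for n
  have e0: "\<epsilon> n > 0" for n by (simp add: \<epsilon>_def)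
  have elim: "\<epsilon> \<longlonglongrightarrow> 0" unfolding \<epsilon>_def using LIMSEQ_inverse_real_of_nat by (simp add: inverse_eq_divide)
  define s where "s n z = dbar \<phi> z * cauchy_reg (\<epsilon> n) (z - q)" for n z
  define W where "W z = D * (indicator (ball q R) z * norm (z - q) powr (- 1))" for z
  have dm: "dbar \<phi> \<in> borel_measurable borel" by (rule borel_measurable_continuous_onI[OF test_dbar_continuous[OF phi]])
  have cm: "cauchy_reg e \<in> borel_measurable borel" if "e > 0" for e
  proof (rule borel_measurable_continuous_onI, rule lipschitz_on_continuous_on)
    show "(1 / e\<^sup>2)-lipschitz_on UNIV (cauchy_reg e)"
      using cauchy_reg_Lipschitz[OF that] by (auto intro!: lipschitz_onI simp: dist_norm)
  qed
  have sm: "s n \<in> borel_measurable lborel" for n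
    unfolding s_def[abs_def] using dm cm[OF e0[of n]] by measurable
  have fm: "(\<lambda>z. dbar \<phi> z * inverse (z - q)) \<in> borel_measurable lborel"
    using dm by measurable
  have Wi: "integrable lborel W"
    unfolding W_def[abs_def] using integrable_norm_powr[of 1 R q] R by (intro integrable_mult_right) auto
  have bound: "norm (s n z) \<le> W z" for n z
  proof (cases "z \<in> K \<and> z \<noteq> q")
    case True
    have "norm (s n z) \<le> D * (1 / norm (z - q))"
      unfolding s_def norm_mult using D norm_cauchy_reg_le(2)[OF e0, of "z - q" n] True
      by (intro mult_mono) auto
    then show ?thesis using True R by (auto simp: W_def powr_minus divide_inverse)
  next
    case False
    then have "s n z = 0" using K(3)[of z] by (auto simp: s_def dbar_def cauchy_reg_def)
    then show ?thesis using D by (simp add: W_def)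
  qed
  have lim: "(\<lambda>n. s n z) \<longlonglongrightarrow> dbar \<phi> z * inverse (z - q)" for z
  proof (cases "z = q")
    case True
    then show ?thesis by (simp add: s_def cauchy_reg_def)
  next
    case False
    then have "eventually (\<lambda>n. \<epsilon> n < norm (z - q)) sequentially"
      using order_tendstoD(2)[OF elim] by simp
    then have "eventually (\<lambda>n. s n z = dbar \<phi> z * inverse (z - q)) sequentially"
      by eventually_elim (use e0 in \<open>simp add: s_def cauchy_reg_outer\<close>)
    then show ?thesis by (rule tendsto_eventually)
  qed
  show "integrable lborel (\<lambda>z. dbar \<phi> z * inverse (z - q))"
    by (rule integrable_dominated_convergence[OF fm sm Wi AE_I2[OF lim] AE_I2[OF bound]])
  have 1: "(\<lambda>n. integral\<^sup>L lborel (s n)) \<longlonglongrightarrow> (LINT z|lborel. dbar \<phi> z * inverse (z - q))"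
    by (rule integral_dominated_convergence[OF fm sm Wi AE_I2[OF lim] AE_I2[OF bound]])
  define J where "J n = (LINT z|lborel. 2 / (\<epsilon> n)\<^sup>2 * \<phi> z * indicator (ball q (\<epsilon> n)) z)" for n
  have sJ: "integral\<^sup>L lborel (s n) = - of_real (J n)" for n
    unfolding s_def[abs_def] J_def using integral_dbar_cauchy_reg[OF phi e0[of n]]
    by (simp only: integral_complex_of_real)
  \<comment> \<open>Replacing \<open>\<phi> z\<close> by \<open>\<phi> q\<close> costs at most
    \<open>2 * M * \<epsilon> n\<close> on the disc, to be multiplied by
    \<open>2 / (\<epsilon> n)\<^sup>2\<close> and by the area
    \<open>pi * (\<epsilon> n)\<^sup>2\<close>.\<close>
  have "norm (J n - 2 * pi * \<phi> q) \<le> 4 * M * pi * \<epsilon> n" for n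
  proof -
    have mb: "measure lborel (ball q (\<epsilon> n)) = pi * (\<epsilon> n)\<^sup>2"
      using emeasure_ball_complex[of "\<epsilon> n" q] e0[of n] by (simp add: measure_def)
    have ii: "integrable lborel (\<lambda>z. indicator (ball q (\<epsilon> n)) z :: real)"
      by (rule integrable_real_indicator) (use emeasure_ball_complex[OF less_imp_le[OF e0[of n]], of q] in auto)
    have pi: "integrable lborel \<phi>"
      by (rule integrable_compact_support[OF K(1) test_function_continuous[OF phi] K(2)])
    have i1: "integrable lborel (\<lambda>z. 2 / (\<epsilon> n)\<^sup>2 * \<phi> z * indicator (ball q (\<epsilon> n)) z)"
      using integrable_mult_right[OF integrable_mult_indicator[OF _ pi, of "ball q (\<epsilon> n)"], of "2 / (\<epsilon> n)\<^sup>2"]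
      by (simp add: mult_ac)
    have i2: "integrable lborel (\<lambda>z. 2 / (\<epsilon> n)\<^sup>2 * \<phi> q * indicator (ball q (\<epsilon> n)) z)"
      using ii by (rule integrable_mult_right)
    have "(LINT z|lborel. 2 / (\<epsilon> n)\<^sup>2 * \<phi> q * indicator (ball q (\<epsilon> n)) z) = 2 * pi * \<phi> q"
      using mb e0[of n] by simp
    then have eq: "J n - 2 * pi * \<phi> q = (LINT z|lborel. 2 / (\<epsilon> n)\<^sup>2 * \<phi> z * indicator (ball q (\<epsilon> n)) z
        - 2 / (\<epsilon> n)\<^sup>2 * \<phi> q * indicator (ball q (\<epsilon> n)) z)"
      unfolding J_def using i1 i2 by simp
    have "norm (J n - 2 * pi * \<phi> q) \<le> (LINT z|lborel. norm (2 / (\<epsilon> n)\<^sup>2 * \<phi> z * indicator (ball q (\<epsilon> n)) z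
        - 2 / (\<epsilon> n)\<^sup>2 * \<phi> q * indicator (ball q (\<epsilon> n)) z))"
      unfolding eq by (rule integral_norm_bound)
    also have "\<dots> \<le> (LINT z|lborel. 2 / (\<epsilon> n)\<^sup>2 * (2 * M * \<epsilon> n) * indicator (ball q (\<epsilon> n)) z)"
    proof (rule integral_mono)
      fix z
      show "norm (2 / (\<epsilon> n)\<^sup>2 * \<phi> z * indicator (ball q (\<epsilon> n)) z
        - 2 / (\<epsilon> n)\<^sup>2 * \<phi> q * indicator (ball q (\<epsilon> n)) z) \<le> 2 / (\<epsilon> n)\<^sup>2 * (2 * M * \<epsilon> n) * indicator (ball q (\<epsilon> n)) z"
      proof (cases "z \<in> ball q (\<epsilon> n)")
        case True
        then have "\<bar>\<phi> z - \<phi> q\<bar> \<le> 2 * M * \<epsilon> n"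
          using M(1) M(3)[of z q] by (intro order_trans[OF M(3)] mult_left_mono) (auto simp: dist_norm norm_minus_commute)
        then have "2 / (\<epsilon> n)\<^sup>2 * \<bar>\<phi> z - \<phi> q\<bar> \<le> 2 / (\<epsilon> n)\<^sup>2 * (2 * M * \<epsilon> n)"
          by (intro mult_left_mono) auto
        moreover have "norm (2 / (\<epsilon> n)\<^sup>2 * \<phi> z - 2 / (\<epsilon> n)\<^sup>2 * \<phi> q) = 2 / (\<epsilon> n)\<^sup>2 * \<bar>\<phi> z - \<phi> q\<bar>"
          unfolding right_diff_distrib[symmetric] real_norm_def abs_mult
          by (simp only: abs_divide abs_power2 abs_numeral)
        ultimately show ?thesis using True by simp
      qed simp
    next
      show "integrable lborel (\<lambda>z. 2 / (\<epsilon> n)\<^sup>2 * (2 * M * \<epsilon> n) * indicator (ball q (\<epsilon> n)) z)"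
        using ii by (rule integrable_mult_right)
    qed (use i1 i2 in auto)
    also have "\<dots> = 4 * M * pi * \<epsilon> n"
      using mb e0[of n] by (simp add: power2_eq_square)
    finally show ?thesis .
  qed
  moreover have "(\<lambda>n. 4 * M * pi * \<epsilon> n) \<longlonglongrightarrow> 0" using tendsto_mult_right_zero[OF elim] .
  ultimately have "(\<lambda>n. J n - 2 * pi * \<phi> q) \<longlonglongrightarrow> 0"
    by (rule Lim_null_comparison[OF always_eventually, OF allI])
  then have "J \<longlonglongrightarrow> 2 * pi * \<phi> q" by (simp add: LIM_zero_iff)
  then have "(\<lambda>n. integral\<^sup>L lborel (s n)) \<longlonglongrightarrow> - of_real (2 * pi * \<phi> q)"
    unfolding sJ by (intro tendsto_minus tendsto_of_real)
  then show "(LINT z|lborel. dbar \<phi> z * inverse (z - q)) = - (2 * pi * \<phi> q)"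
    using LIMSEQ_unique[OF 1] by simp
qed

text \<open>Moving both derivatives onto \<open>F\<close> leaves
  \<open>deriv F z + \<i> * (\<i> * deriv F z) = 0\<close>, the Cauchy-Riemann equations in weak
  form.\<close>

lemma
  assumes phi: "\<phi> \<in> test_functions \<Omega>" and O: "open \<Omega>" and F: "F holomorphic_on \<Omega>"
  shows set_integrable_dbar_holomorphic: "set_integrable lborel \<Omega> (\<lambda>z. dbar \<phi> z * F z)"
    and integral_dbar_holomorphic: "(LINT z:\<Omega>|lborel. dbar \<phi> z * F z) = 0"
proof -
  have oc: "1 \<in> (Basis::complex set)" "\<i> \<in> (Basis::complex set)" by (auto simp: Basis_complex_def)
  have d: "(F has_derivative (\<lambda>h. deriv F z * h + 0 * cnj h)) (at z)" if "z \<in> \<Omega>" for z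
    using holomorphic_derivI[OF F O that] by (simp add: has_field_derivative_def)
  have c: "continuous_on \<Omega> (deriv F)" using holomorphic_deriv[OF F O] by (rule holomorphic_on_imp_continuous_on)
  note P = integral_by_parts_test[OF phi O d c continuous_on_const, simplified]
  have i: "set_integrable lborel \<Omega> (\<lambda>z. partial 1 \<phi> z *\<^sub>R F z)" "set_integrable lborel \<Omega> (\<lambda>z. partial \<i> \<phi> z *\<^sub>R F z)"
    using P(3) oc by auto
  have eq: "(\<lambda>z. dbar \<phi> z * F z) = (\<lambda>z. partial 1 \<phi> z *\<^sub>R F z + \<i> * (partial \<i> \<phi> z *\<^sub>R F z))"
    by (simp add: dbar_def fun_eq_iff scaleR_conv_of_real algebra_simps)
  have i2: "set_integrable lborel \<Omega> (\<lambda>z. \<i> * (partial \<i> \<phi> z *\<^sub>R F z))"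
    using i(2) by (rule set_integrable_mult_right)
  show "set_integrable lborel \<Omega> (\<lambda>z. dbar \<phi> z * F z)"
    unfolding eq by (rule set_integral_add(1)[OF i(1) i2])
  let ?X = "LINT z:\<Omega>|lborel. \<phi> z *\<^sub>R deriv F z"
  have A: "(LINT z:\<Omega>|lborel. partial 1 \<phi> z *\<^sub>R F z) = - ?X" using P(1)[OF oc(1)] by simp
  have "(LINT z:\<Omega>|lborel. \<phi> z *\<^sub>R (deriv F z * \<i>)) = ?X * \<i>"
    using set_integral_mult_left[of lborel \<Omega> "\<lambda>z. \<phi> z *\<^sub>R deriv F z" \<i>] by simp
  then have B: "(LINT z:\<Omega>|lborel. partial \<i> \<phi> z *\<^sub>R F z) = - (?X * \<i>)"
    using P(1)[OF oc(2)] by (metis add.inverse_inverse)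
  have "(LINT z:\<Omega>|lborel. dbar \<phi> z * F z) = (LINT z:\<Omega>|lborel. partial 1 \<phi> z *\<^sub>R F z)
      + (LINT z:\<Omega>|lborel. \<i> * (partial \<i> \<phi> z *\<^sub>R F z))"
    unfolding eq by (rule set_integral_add(2)[OF i(1) i2])
  also have "\<dots> = - ?X + \<i> * (- (?X * \<i>))"
    by (simp only: set_integral_mult_right A B)
  also have "\<dots> = 0" by (simp add: complex_eq_iff)
  finally show "(LINT z:\<Omega>|lborel. dbar \<phi> z * F z) = 0" .
qed

section \<open>A flat holomorphic function with infinitely many zeros\<close>

text \<open>\<open>Ln 0\<close> is unspecified; the value \<open>0\<close> at the boundary point \<open>1\<close> makes \<open>vortex 1 = 0\<close>.\<close>

definition disc_log :: "complex \<Rightarrow> complex" where "disc_log z = (if z = 1 then 0 else Ln (1 - z))"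

definition vortex :: "complex \<Rightarrow> complex" where
  "vortex z = exp (- (disc_log z)\<^sup>2) * sin (of_real pi * disc_log z)"

text \<open>The distances to the boundary point \<open>1\<close> form the geometric sequence
  \<open>exp (- k)\<close>, starting with the origin; this spacing is behind the convergence of the
  sum over all vortices in the L^p estimate.\<close>

definition vortex_pt :: "nat \<Rightarrow> complex" where "vortex_pt k = of_real (1 - exp (- real k))"

text \<open>The half-plane \<open>Re z < 1\<close> is the working domain: it is open, contains the
  closed disc except for \<open>1\<close>, and keeps \<open>1 - z\<close> off the branch cut of
  \<open>Ln\<close>.\<close>

lemma cball_Re_less_1: "z \<in> cball 0 1 \<Longrightarrow> z \<noteq> 1 \<Longrightarrow> Re z < 1"
proof -
  assume z: "z \<in> cball 0 1" "z \<noteq> (1::complex)"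
  have "norm z \<le> 1" using z by simp
  then have le: "(Re z)\<^sup>2 + (Im z)\<^sup>2 \<le> 1"
    using cmod_power2[of z] by (metis norm_ge_zero power_le_one)
  have "Re z \<noteq> 1" using le z(2) by (auto simp: complex_eq_iff)
  moreover have "Re z \<le> 1" using abs_Re_le_cmod[of z] z by auto
  ultimately show ?thesis by simp
qed

lemma D2_Re_less_1: "z \<in> D2 \<Longrightarrow> Re z < 1"
  using abs_Re_le_cmod[of z] by auto

lemma exp_disc_log: "z \<noteq> 1 \<Longrightarrow> exp (disc_log z) = 1 - z"
  by (simp add: disc_log_def)

text \<open>Writing \<open>- exp (- disc_log z)\<close> instead of \<open>- 1 / (1 - z)\<close>
  keeps all further derivatives functions of the logarithm alone.\<close>

lemma disc_log_deriv:
  assumes "Re z < 1"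
  shows "(disc_log has_field_derivative - exp (- disc_log z)) (at z)"
proof -
  have nz: "1 - z \<noteq> 0" "1 - z \<notin> \<real>\<^sub>\<le>\<^sub>0" using assms by (auto simp: complex_nonpos_Reals_iff)
  have "exp (- disc_log z) = 1 / (1 - z)" using nz exp_disc_log[of z] by (simp add: exp_minus divide_inverse)
  then have "((\<lambda>z. Ln (1 - z)) has_field_derivative - exp (- disc_log z)) (at z)"
    using nz by (auto intro!: derivative_eq_intros simp: divide_inverse)
  then show ?thesis
    by (rule has_field_derivative_transform_within_open[of _ _ _ "{z. Re z < 1}"])
      (use assms in \<open>auto simp: disc_log_def open_halfspace_Re_lt\<close>)
qed

lemma disc_log_Im: "Re z < 1 \<Longrightarrow> \<bar>Im (disc_log z)\<bar> \<le> pi / 2"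
  unfolding disc_log_def using Re_Ln_pos_le[of "1 - z"] by (cases "z = 1") auto

lemma disc_log_Re: "z \<noteq> 1 \<Longrightarrow> Re (disc_log z) = ln (norm (1 - z))"
  by (simp add: disc_log_def)

text \<open>These are the factors that arise when \<open>vortex\<close> is differentiated, as
  functions of \<open>w = disc_log z\<close>. The Gaussian is left out because it can be factored
  out of every derivative.\<close>

inductive exp_poly :: "(complex \<Rightarrow> complex) \<Rightarrow> bool" where
  "exp_poly (\<lambda>_. c)"
| "exp_poly (\<lambda>w. w)"
| "exp_poly (\<lambda>w. exp (- w))"
| "exp_poly (\<lambda>w. sin (of_real pi * w))"
| "exp_poly (\<lambda>w. cos (of_real pi * w))"
| "exp_poly P \<Longrightarrow> exp_poly Q \<Longrightarrow> exp_poly (\<lambda>w. P w + Q w)"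
| "exp_poly P \<Longrightarrow> exp_poly Q \<Longrightarrow> exp_poly (\<lambda>w. P w * Q w)"

lemma exp_poly_deriv:
  "exp_poly P \<Longrightarrow> \<exists>Q. exp_poly Q \<and> (\<forall>w. (P has_field_derivative Q w) (at w))"
proof (induction rule: exp_poly.induct)
  case (1 c)
  show ?case by (intro exI[of _ "\<lambda>_. 0"]) (auto intro: exp_poly.intros)
next
  case 2
  show ?case by (intro exI[of _ "\<lambda>_. 1"]) (auto intro: exp_poly.intros)
next
  case 3
  have "exp_poly (\<lambda>w. (-1) * exp (- w))" by (intro exp_poly.intros)
  then show ?case by (intro exI conjI) (auto intro!: derivative_eq_intros)
next
  case 4
  have "exp_poly (\<lambda>w. of_real pi * cos (of_real pi * w))" by (intro exp_poly.intros)
  then show ?case by (intro exI conjI) (auto intro!: derivative_eq_intros)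
next
  case 5
  have "exp_poly (\<lambda>w. (- of_real pi) * sin (of_real pi * w))" by (intro exp_poly.intros)
  then show ?case by (intro exI conjI) (auto intro!: derivative_eq_intros)
next
  case (6 P Q)
  then obtain P' Q' where "exp_poly P'" "\<forall>w. (P has_field_derivative P' w) (at w)"
    "exp_poly Q'" "\<forall>w. (Q has_field_derivative Q' w) (at w)" by blast
  then show ?case
    by (intro exI[of _ "\<lambda>w. P' w + Q' w"]) (auto intro!: exp_poly.intros(6) derivative_intros)
next
  case (7 P Q)
  then obtain P' Q' where "exp_poly P'" "\<forall>w. (P has_field_derivative P' w) (at w)"
    "exp_poly Q'" "\<forall>w. (Q has_field_derivative Q' w) (at w)" by blast
  then show ?case using 7
    by (intro exI[of _ "\<lambda>w. P' w * Q w + P w * Q' w"])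
      (auto intro!: exp_poly.intros(6,7) derivative_eq_intros)
qed

lemma norm_sin_le_exp: "norm (sin (z::complex)) \<le> exp \<bar>Im z\<bar>"
proof -
  have "norm (sin z) = norm (exp (\<i> * z) - exp (- (\<i> * z))) / 2"
    by (simp add: sin_exp_eq norm_divide norm_mult)
  also have "norm (exp (\<i> * z) - exp (- (\<i> * z))) \<le> exp (- Im z) + exp (Im z)"
    by (intro order_trans[OF norm_triangle_ineq4]) (simp add: norm_exp_eq_Re)
  also have "\<dots> \<le> 2 * exp \<bar>Im z\<bar>" by (simp add: abs_if)
  finally show ?thesis by simp
qed

lemma norm_cos_le_exp: "norm (cos (z::complex)) \<le> exp \<bar>Im z\<bar>"
proof -
  have "norm (cos z) = norm (exp (\<i> * z) + exp (- (\<i> * z))) / 2"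
    by (simp add: cos_exp_eq norm_divide norm_mult)
  also have "norm (exp (\<i> * z) + exp (- (\<i> * z))) \<le> exp (- Im z) + exp (Im z)"
    by (intro order_trans[OF norm_triangle_ineq]) (simp add: norm_exp_eq_Re)
  also have "\<dots> \<le> 2 * exp \<bar>Im z\<bar>" by (simp add: abs_if)
  finally show ?thesis by simp
qed

text \<open>The set is a parameter because growth is measured on the whole strip of logarithms for
  the derivatives of \<open>vortex\<close>, but for the trace on a subset that avoids the poles of
  \<open>cot\<close>.\<close>

definition exp_growth :: "complex set \<Rightarrow> (complex \<Rightarrow> complex) \<Rightarrow> bool" where
  "exp_growth S P \<longleftrightarrow> (\<exists>C k. C \<ge> 0 \<and> k \<ge> 0 \<and> (\<forall>w\<in>S. norm (P w) \<le> C * exp (k * \<bar>Re w\<bar>)))"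

lemma exp_growthI_bounded: "(\<And>w. w \<in> S \<Longrightarrow> norm (P w) \<le> C) \<Longrightarrow> exp_growth S P"
  unfolding exp_growth_def by (rule exI[of _ "\<bar>C\<bar>"], rule exI[of _ 0]) (auto intro: order_trans[OF _ abs_ge_self])

lemma exp_growth_add:
  assumes "exp_growth S P" "exp_growth S Q"
  shows "exp_growth S (\<lambda>w. P w + Q w)"
proof -
  obtain C k where C: "C \<ge> 0" "k \<ge> 0" "\<And>w. w \<in> S \<Longrightarrow> norm (P w) \<le> C * exp (k * \<bar>Re w\<bar>)"
    using assms(1) unfolding exp_growth_def by blast
  obtain D l where D: "D \<ge> 0" "l \<ge> 0" "\<And>w. w \<in> S \<Longrightarrow> norm (Q w) \<le> D * exp (l * \<bar>Re w\<bar>)"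
    using assms(2) unfolding exp_growth_def by blast
  have "norm (P w + Q w) \<le> (C + D) * exp ((k + l) * \<bar>Re w\<bar>)" if w: "w \<in> S" for w
  proof -
    have "norm (P w + Q w) \<le> C * exp (k * \<bar>Re w\<bar>) + D * exp (l * \<bar>Re w\<bar>)"
      using C(3)[OF w] D(3)[OF w] norm_triangle_ineq[of "P w" "Q w"] by linarith
    also have "\<dots> \<le> C * exp ((k + l) * \<bar>Re w\<bar>) + D * exp ((k + l) * \<bar>Re w\<bar>)"
      using C D by (intro add_mono mult_left_mono) (auto intro!: mult_right_mono)
    finally show ?thesis by (simp add: distrib_right)
  qed
  then show ?thesis unfolding exp_growth_def using C D by (intro exI[of _ "C + D"] exI[of _ "k + l"]) auto
qed

lemma exp_growth_mult:
  assumes "exp_growth S P" "exp_growth S Q"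
  shows "exp_growth S (\<lambda>w. P w * Q w)"
proof -
  obtain C k where C: "C \<ge> 0" "k \<ge> 0" "\<And>w. w \<in> S \<Longrightarrow> norm (P w) \<le> C * exp (k * \<bar>Re w\<bar>)"
    using assms(1) unfolding exp_growth_def by blast
  obtain D l where D: "D \<ge> 0" "l \<ge> 0" "\<And>w. w \<in> S \<Longrightarrow> norm (Q w) \<le> D * exp (l * \<bar>Re w\<bar>)"
    using assms(2) unfolding exp_growth_def by blast
  have "norm (P w * Q w) \<le> (C * D) * exp ((k + l) * \<bar>Re w\<bar>)" if w: "w \<in> S" for w
  proof -
    have "norm (P w * Q w) \<le> (C * exp (k * \<bar>Re w\<bar>)) * (D * exp (l * \<bar>Re w\<bar>))"
      unfolding norm_mult using C D w by (intro mult_mono) auto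
    also have "\<dots> = C * D * exp ((k + l) * \<bar>Re w\<bar>)" by (simp add: distrib_right exp_add)
    finally show ?thesis .
  qed
  then show ?thesis unfolding exp_growth_def using C D by (intro exI[of _ "C * D"] exI[of _ "k + l"]) auto
qed

lemma exp_growth_basic:
  assumes "S \<subseteq> {w. \<bar>Im w\<bar> \<le> pi / 2}"
  shows "exp_growth S (\<lambda>w. w)" "exp_growth S (\<lambda>w. exp (- w))"
    "exp_growth S (\<lambda>w. sin (of_real pi * w))" "exp_growth S (\<lambda>w. cos (of_real pi * w))"
proof -
  have "norm w \<le> 2 * exp (1 * \<bar>Re w\<bar>)" if "w \<in> S" for w
  proof -
    have "norm w \<le> \<bar>Re w\<bar> + \<bar>Im w\<bar>" by (rule cmod_le)
    also have "\<dots> \<le> 2 * (1 + \<bar>Re w\<bar>)" using assms that pi_half_less_two by fastforce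
    also have "\<dots> \<le> 2 * exp \<bar>Re w\<bar>" by (intro mult_left_mono exp_ge_add_one_self) auto
    finally show ?thesis by simp
  qed
  then show "exp_growth S (\<lambda>w. w)" unfolding exp_growth_def by (intro exI[of _ 2] exI[of _ 1]) auto
  have "norm (exp (- w)) \<le> 1 * exp (1 * \<bar>Re w\<bar>)" for w :: complex by simp
  then show "exp_growth S (\<lambda>w. exp (- w))" unfolding exp_growth_def by (intro exI[of _ 1]) auto
  have b: "exp \<bar>Im (of_real pi * w)\<bar> \<le> exp (pi * (pi / 2))" if "w \<in> S" for w
    using assms that by (auto simp: abs_mult intro!: mult_left_mono)
  show "exp_growth S (\<lambda>w. sin (of_real pi * w))"
    by (rule exp_growthI_bounded[OF order_trans[OF norm_sin_le_exp b]])
  show "exp_growth S (\<lambda>w. cos (of_real pi * w))"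
    by (rule exp_growthI_bounded[OF order_trans[OF norm_cos_le_exp b]])
qed

lemma exp_poly_growth:
  assumes "exp_poly P" shows "exp_growth {w. \<bar>Im w\<bar> \<le> pi / 2} P"
  using assms
  by (induction rule: exp_poly.induct)
    (auto intro: exp_growth_basic exp_growth_add exp_growth_mult exp_growthI_bounded)

text \<open>The real part of \<open>- w\<^sup>2\<close> is
  \<open>(Im w)\<^sup>2 - (Re w)\<^sup>2\<close>, and in the strip the first square costs only a
  constant.\<close>

lemma norm_exp_neg_square_le:
  assumes "\<bar>Im w\<bar> \<le> pi / 2"
  shows "norm (exp (- w\<^sup>2)) \<le> exp ((pi / 2)\<^sup>2) * exp (- (Re w)\<^sup>2)"
proof -
  have "(Im w)\<^sup>2 \<le> (pi / 2)\<^sup>2" using assms by (metis abs_ge_zero power2_abs power_mono)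
  then show ?thesis by (simp add: norm_exp_eq_Re Re_power2 flip: exp_add)
qed

text \<open>Completing the square; the maximum is attained at \<open>t = k / 2\<close>. This is how
  the Gaussian beats every exponential in the logarithm.\<close>

lemma exp_quadratic_le: "exp (k * t) * exp (- t\<^sup>2) \<le> exp (k\<^sup>2 / 4)" for k t :: real
proof -
  have "0 \<le> (t - k / 2)\<^sup>2" by simp
  also have "(t - k / 2)\<^sup>2 = t\<^sup>2 - k * t + k\<^sup>2 / 4" by (simp add: power2_eq_square field_simps)
  finally have "k * t - t\<^sup>2 \<le> k\<^sup>2 / 4" by simp
  then show ?thesis by (simp flip: exp_add)
qed

lemma vortex_higher_deriv:
  "\<exists>P. exp_poly P \<and> (\<forall>z. Re z < 1 \<longrightarrow> (deriv ^^ n) vortex z = P (disc_log z) * exp (- (disc_log z)\<^sup>2))"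
proof (induction n)
  case 0
  show ?case by (intro exI[of _ "\<lambda>w. sin (of_real pi * w)"]) (auto simp: vortex_def intro: exp_poly.intros)
next
  case (Suc n)
  then obtain P where P: "exp_poly P"
    "\<And>z. Re z < 1 \<Longrightarrow> (deriv ^^ n) vortex z = P (disc_log z) * exp (- (disc_log z)\<^sup>2)" by blast
  obtain Q where Q: "exp_poly Q" "\<And>w. (P has_field_derivative Q w) (at w)"
    using exp_poly_deriv[OF P(1)] by blast
  \<comment> \<open>The Gaussian contributes \<open>(-2) * w\<close> when differentiated, and the
    chain rule contributes the common factor \<open>- exp (- w)\<close>.\<close>
  define R where "R w = (-1) * exp (- w) * (Q w + (-2) * w * P w)" for w
  have "exp_poly R" unfolding R_def[abs_def]
    by (intro exp_poly.intros P(1) Q(1))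
  moreover have "(deriv ^^ Suc n) vortex z = R (disc_log z) * exp (- (disc_log z)\<^sup>2)" if z: "Re z < 1" for z
  proof -
    have "eventually (\<lambda>x. x \<in> {x. Re x < 1}) (nhds z)"
      using z open_halfspace_Re_lt[of 1] by (intro eventually_nhds_in_open) auto
    then have "eventually (\<lambda>x. (deriv ^^ n) vortex x = P (disc_log x) * exp (- (disc_log x)\<^sup>2)) (nhds z)"
      by eventually_elim (use P(2) in auto)
    then have "deriv ((deriv ^^ n) vortex) z = deriv (\<lambda>x. P (disc_log x) * exp (- (disc_log x)\<^sup>2)) z"
      by (rule deriv_cong_ev) simp
    also have "\<dots> = R (disc_log z) * exp (- (disc_log z)\<^sup>2)"
    proof (rule DERIV_imp_deriv)
      have "((\<lambda>x. P (disc_log x)) has_field_derivative Q (disc_log z) * (- exp (- disc_log z))) (at z)"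
        by (rule DERIV_chain2[OF Q(2) disc_log_deriv[OF z]])
      moreover have "((\<lambda>x. exp (- (disc_log x)\<^sup>2)) has_field_derivative
          exp (- (disc_log z)\<^sup>2) * (- (2 * disc_log z * (- exp (- disc_log z))))) (at z)"
        using disc_log_deriv[OF z] by (auto intro!: derivative_eq_intros)
      ultimately show "((\<lambda>x. P (disc_log x) * exp (- (disc_log x)\<^sup>2)) has_field_derivative R (disc_log z) * exp (- (disc_log z)\<^sup>2)) (at z)"
        by (rule DERIV_cong[OF DERIV_mult]) (simp add: R_def algebra_simps)
    qed
    finally show ?thesis by simp
  qed
  ultimately show ?case by blast
qed

lemma vortex_holomorphic: "vortex holomorphic_on {z. Re z < 1}"
proof -
  have "disc_log holomorphic_on {z. Re z < 1}"
    using disc_log_deriv by (auto simp: holomorphic_on_def field_differentiable_def intro: has_field_derivative_at_within)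
  then show ?thesis unfolding vortex_def[abs_def] by (intro holomorphic_intros)
qed

text \<open>The factor in front of the Gaussian grows at most exponentially in
  \<open>Re (disc_log z)\<close>, so Gaussian decay bounds every derivative uniformly up to the
  accumulation point.\<close>

lemma bounded_derivs_vortex: "bounded_derivs vortex"
  unfolding bounded_derivs_def
proof (intro conjI allI)
  show "vortex holomorphic_on D2"
    by (rule holomorphic_on_subset[OF vortex_holomorphic]) (use D2_Re_less_1 in auto)
  fix n
  obtain P where P: "exp_poly P"
    "\<And>z. Re z < 1 \<Longrightarrow> (deriv ^^ n) vortex z = P (disc_log z) * exp (- (disc_log z)\<^sup>2)"
    using vortex_higher_deriv by blast
  obtain C k where C: "C \<ge> 0" "k \<ge> 0" "\<And>w. \<bar>Im w\<bar> \<le> pi / 2 \<Longrightarrow> norm (P w) \<le> C * exp (k * \<bar>Re w\<bar>)"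
    using exp_poly_growth[OF P(1)] unfolding exp_growth_def by auto
  have "norm ((deriv ^^ n) vortex z) \<le> C * exp ((pi / 2)\<^sup>2) * exp (k\<^sup>2 / 4)" if "z \<in> D2" for z
  proof -
    define w where "w = disc_log z"
    have z: "Re z < 1" using D2_Re_less_1[OF that] .
    have w: "\<bar>Im w\<bar> \<le> pi / 2" using disc_log_Im[OF z] by (simp add: w_def)
    have "norm ((deriv ^^ n) vortex z) = norm (P w) * norm (exp (- w\<^sup>2))"
      unfolding P(2)[OF z] w_def by (simp add: norm_mult)
    also have "\<dots> \<le> (C * exp (k * \<bar>Re w\<bar>)) * (exp ((pi / 2)\<^sup>2) * exp (- (Re w)\<^sup>2))"
      using C w norm_exp_neg_square_le[OF w] by (intro mult_mono) auto
    also have "\<dots> = C * exp ((pi / 2)\<^sup>2) * (exp (k * \<bar>Re w\<bar>) * exp (- \<bar>Re w\<bar>\<^sup>2))" by simp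
    also have "\<dots> \<le> C * exp ((pi / 2)\<^sup>2) * exp (k\<^sup>2 / 4)"
      using C by (intro mult_left_mono exp_quadratic_le) auto
    finally show ?thesis .
  qed
  then show "bounded ((deriv ^^ n) vortex ` D2)" unfolding bounded_iff by blast
qed

lemma vortex_deriv:
  assumes "Re z < 1"
  shows "deriv vortex z = (2 * disc_log z * sin (of_real pi * disc_log z) - of_real pi * cos (of_real pi * disc_log z))
     * exp (- (disc_log z)\<^sup>2) * exp (- disc_log z)"
proof (rule DERIV_imp_deriv)
  note d = disc_log_deriv[OF assms]
  show "(vortex has_field_derivative (2 * disc_log z * sin (of_real pi * disc_log z) - of_real pi * cos (of_real pi * disc_log z))
     * exp (- (disc_log z)\<^sup>2) * exp (- disc_log z)) (at z)"
    unfolding vortex_def[abs_def]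
    by (rule derivative_eq_intros d refl)+ (simp add: algebra_simps)
qed

section \<open>Location and simplicity of the zeros\<close>

lemma vortex_pt_in_D2: "vortex_pt k \<in> D2"
proof -
  have "norm (vortex_pt k) = \<bar>1 - exp (- real k)\<bar>" unfolding vortex_pt_def norm_of_real ..
  then show ?thesis by (simp add: abs_if)
qed

lemma inj_vortex_pt: "inj vortex_pt"
  by (auto simp: inj_def vortex_pt_def)

lemma vortex_pt_tendsto: "vortex_pt \<longlonglongrightarrow> 1"
proof -
  have "(\<lambda>k. exp (- real k)) \<longlonglongrightarrow> 0"
    by (intro filterlim_compose[OF exp_at_bot] filterlim_compose[OF filterlim_uminus_at_bot_at_top] filterlim_real_sequentially)
  then have "(\<lambda>k. of_real (1 - exp (- real k)) :: complex) \<longlonglongrightarrow> of_real (1 - 0)"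
    by (intro tendsto_of_real tendsto_diff tendsto_const)
  then show ?thesis by (simp add: vortex_pt_def[abs_def])
qed

lemma disc_log_vortex_pt: "disc_log (vortex_pt k) = - of_nat k"
proof -
  have "1 - vortex_pt k = of_real (exp (- real k))" by (simp add: vortex_pt_def)
  moreover from this have "vortex_pt k \<noteq> 1" by auto
  ultimately have "disc_log (vortex_pt k) = Ln (of_real (exp (- real k)))" unfolding disc_log_def by simp
  also have "\<dots> = of_real (ln (exp (- real k)))" by (rule Ln_of_real) simp
  finally show ?thesis by simp
qed

text \<open>A zero of the sine forces \<open>disc_log z\<close> to be an integer \<open>n\<close>,
  hence \<open>z = 1 - exp n\<close>; in the closed disc \<open>exp n \<le> 2\<close> excludes
  positive \<open>n\<close>. The closed disc is used because the trace requires that the circle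
  carry no zero besides \<open>1\<close>.\<close>

lemma vortex_eq_0_iff:
  assumes "z \<in> cball 0 1" "z \<noteq> 1"
  shows "vortex z = 0 \<longleftrightarrow> z \<in> range vortex_pt"
proof
  assume "vortex z = 0"
  then have "sin (of_real pi * disc_log z) = 0" by (simp add: vortex_def)
  then obtain n :: int where "of_real pi * disc_log z = of_real (real_of_int n * pi)"
    unfolding sin_eq_0 by blast
  then have "of_real pi * disc_log z = of_real pi * (of_real (real_of_int n) :: complex)" by (simp add: mult.commute)
  then have n: "disc_log z = of_real (real_of_int n)" by (simp only: mult_cancel_left of_real_eq_0_iff pi_neq_zero) simp
  then have "1 - z = of_real (exp (real_of_int n))"
    using exp_disc_log[OF assms(2)] by (simp flip: exp_of_real)
  then have z: "z = of_real (1 - exp (real_of_int n))" by (simp add: algebra_simps)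
  have "norm z = \<bar>1 - exp (real_of_int n)\<bar>" unfolding z norm_of_real ..
  then have "exp (real_of_int n) \<le> 2" using assms(1) by simp
  have "n \<le> 0"
  proof (rule ccontr)
    assume "\<not> n \<le> 0"
    then have "exp 1 \<le> exp (real_of_int n)" by simp
    moreover have "exp (1::real) > 2" using exp_lower_Taylor_quadratic[of 1] by simp
    ultimately show False using \<open>exp (real_of_int n) \<le> 2\<close> by linarith
  qed
  then have "real_of_int n = - real (nat (- n))" by simp
  then have "z = vortex_pt (nat (- n))" unfolding z vortex_pt_def by (simp only:)
  then show "z \<in> range vortex_pt" by simp
next
  assume "z \<in> range vortex_pt"
  then obtain k where "z = vortex_pt k" by auto
  then have "sin (of_real pi * disc_log z) = - sin (of_real (pi * real k))"
    by (simp add: disc_log_vortex_pt)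
  also have "of_real (pi * real k) = (of_real (real_of_int (int k) * pi) :: complex)" by (simp add: mult.commute)
  also have "sin \<dots> = 0" unfolding sin_eq_0 by blast
  finally show "vortex z = 0" by (simp add: vortex_def)
qed

text \<open>At a zero only the cosine term of the derivative survives, and its square is
  \<open>1\<close>. Simplicity is what gives each Dirac mass the weight
  \<open>2 * pi\<close>.\<close>

lemma deriv_vortex_pt: "deriv vortex (vortex_pt k) \<noteq> 0"
proof -
  have s: "sin (of_real pi * disc_log (vortex_pt k)) = 0"
    using vortex_eq_0_iff[of "vortex_pt k"] vortex_pt_in_D2[of k] by (cases "vortex_pt k = 1") (auto simp: vortex_def)
  have "(cos (of_real pi * disc_log (vortex_pt k)))\<^sup>2 = 1"
    using sin_cos_squared_add[of "of_real pi * disc_log (vortex_pt k)"] s by simp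
  then have "cos (of_real pi * disc_log (vortex_pt k)) \<noteq> 0" by auto
  then show ?thesis using vortex_deriv[OF D2_Re_less_1[OF vortex_pt_in_D2[of k]]] s by simp
qed

text \<open>With \<open>t = ln (norm (1 - z))\<close> the Gaussian \<open>exp (- t\<^sup>2)\<close>
  is below a constant times \<open>exp (K * t)\<close>, and the latter is the power \<open>K\<close>
  of the distance to \<open>1\<close>.\<close>

lemma vortex_flat:
  assumes "K \<ge> 0"
  obtains C where "C \<ge> 0" "\<And>z. Re z < 1 \<Longrightarrow> norm (vortex z) \<le> C * norm (1 - z) powr K"
proof -
  have "norm (vortex z) \<le> (exp ((pi / 2)\<^sup>2) * exp (pi * (pi / 2)) * exp (K\<^sup>2 / 4)) * norm (1 - z) powr K" if z: "Re z < 1" for z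
  proof -
    define w where "w = disc_log z"
    have w: "\<bar>Im w\<bar> \<le> pi / 2" using disc_log_Im[OF z] by (simp add: w_def)
    have z1: "z \<noteq> 1" using z by auto
    have r: "Re w = ln (norm (1 - z))" using disc_log_Re[OF z1] by (simp add: w_def)
    have p: "norm (1 - z) powr K = exp (K * Re w)" using z1 by (simp add: powr_def r)
    have "norm (vortex z) = norm (exp (- w\<^sup>2)) * norm (sin (of_real pi * w))"
      by (simp add: vortex_def w_def norm_mult)
    also have "\<dots> \<le> (exp ((pi / 2)\<^sup>2) * exp (- (Re w)\<^sup>2)) * exp (pi * (pi / 2))"
    proof (intro mult_mono norm_exp_neg_square_le w order_trans[OF norm_sin_le_exp])
      show "exp \<bar>Im (of_real pi * w)\<bar> \<le> exp (pi * (pi / 2))" using w by (auto simp: abs_mult intro!: mult_left_mono)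
    qed auto
    also have "exp (- (Re w)\<^sup>2) \<le> exp (K\<^sup>2 / 4) * exp (K * Re w)"
      using exp_quadratic_le[of "- K" "Re w"] by (simp add: exp_minus field_simps)
    finally show ?thesis unfolding p by (simp add: mult_ac)
  qed
  with that show ?thesis by (metis exp_ge_zero mult_nonneg_nonneg)
qed

lemma vortex_1: "vortex 1 = 0"
  by (simp add: vortex_def disc_log_def)

text \<open>Only the point \<open>1\<close> needs an argument beyond holomorphy; flatness of order
  one gives the limit \<open>0\<close>, the value prescribed by the convention for
  \<open>disc_log\<close>.\<close>

lemma continuous_on_vortex: "continuous_on (cball 0 1) vortex"
proof -
  have "continuous (at z within cball 0 1) vortex" if z: "z \<in> cball 0 1" for z
  proof (cases "z = 1")
    case False
    then have "Re z < 1" using cball_Re_less_1 z by blast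
    then have "isCont vortex z"
      using holomorphic_on_imp_continuous_on[OF vortex_holomorphic] open_halfspace_Re_lt[of 1]
      by (simp add: continuous_on_eq_continuous_at)
    then show ?thesis by (rule continuous_at_imp_continuous_at_within)
  next
    case True
    obtain C where C: "C \<ge> 0" "\<And>z. Re z < 1 \<Longrightarrow> norm (vortex z) \<le> C * norm (1 - z) powr 1"
      using vortex_flat[of 1] by auto
    have "isCont (\<lambda>z. C * norm (1 - z)) 1" by (intro continuous_intros)
    then have "((\<lambda>z. C * norm (1 - z)) \<longlongrightarrow> 0) (at 1 within cball 0 1)"
      unfolding isCont_def by (auto intro: tendsto_within_subset)
    moreover have "eventually (\<lambda>z. norm (vortex z) \<le> C * norm (1 - z)) (at 1 within cball 0 1)"
      unfolding eventually_at_filter using C(2) cball_Re_less_1 by (auto intro!: always_eventually)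
    ultimately have "(vortex \<longlongrightarrow> 0) (at 1 within cball 0 1)"
      by (rule Lim_null_comparison[rotated])
    then show ?thesis using True by (simp add: continuous_within vortex_1)
  qed
  then show ?thesis by (simp add: continuous_on_eq_continuous_within)
qed

section \<open>Size of the logarithmic derivative\<close>

definition vortex_logd :: "complex \<Rightarrow> complex" where
  "vortex_logd z = deriv vortex z / vortex z"

lemma vortex_logd_eq:
  assumes "Re z < 1" "vortex z \<noteq> 0"
  shows "vortex_logd z = (2 * disc_log z - of_real pi * cot (of_real pi * disc_log z)) / (1 - z)"
proof -
  have s: "sin (of_real pi * disc_log z) \<noteq> 0" using assms(2) by (auto simp: vortex_def)
  have e: "exp (- disc_log z) = 1 / (1 - z)"
    using assms(1) exp_disc_log[of z] by (cases "z = 1") (auto simp: exp_minus divide_inverse)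
  have alg: "(2 * l * s - q * c) * E * (1 / w) / (E * s) = (2 * l - q * (c / s)) / w"
    if "s \<noteq> 0" "E \<noteq> 0" "w \<noteq> 0" for l s q c E w :: complex
    using that by (simp add: divide_simps)
  show ?thesis unfolding vortex_logd_def vortex_deriv[OF assms(1)] vortex_def e cot_def
    by (rule alg[OF s]) (use assms(1) in auto)
qed

lemma norm_sin_pi_shift: "norm (sin (of_real pi * (v + of_int n))) = norm (sin (of_real pi * (v::complex)))"
proof -
  have s: "sin (of_real pi * of_int n :: complex) = 0"
    unfolding sin_eq_0 by (intro exI[of _ n]) (simp add: mult.commute)
  have "(cos (of_real pi * of_int n :: complex))\<^sup>2 = 1"
    using sin_cos_squared_add[of "of_real pi * of_int n :: complex"] s by simp
  then have "(norm (cos (of_real pi * of_int n :: complex)))\<^sup>2 = 1" by (metis norm_power norm_one)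
  then have "norm (cos (of_real pi * of_int n :: complex)) = 1" by (simp add: power2_eq_1_iff) (smt (verit) norm_ge_zero)
  then show ?thesis using s by (simp add: distrib_left sin_add norm_mult)
qed

text \<open>\<open>sin (of_real pi * v) / v\<close> extends to an entire function with value
  \<open>pi\<close> at \<open>0\<close>. It has no zero in the compact rectangle, so its modulus has
  a positive minimum there.\<close>

lemma norm_sin_pi_lower:
  obtains c where "c > 0" "\<And>v. \<bar>Re v\<bar> \<le> 1/2 \<Longrightarrow> \<bar>Im v\<bar> \<le> pi/2 \<Longrightarrow> c * norm v \<le> norm (sin (of_real pi * v))"
proof -
  let ?s = "\<lambda>v::complex. sin (of_real pi * v)"
  define F where "F v = (if v = 0 then deriv ?s 0 else (?s v - ?s 0) / (v - 0))" for v
  have "?s holomorphic_on UNIV" by (intro holomorphic_intros)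
  then have "F holomorphic_on UNIV" unfolding F_def[abs_def] by (rule pole_lemma_open) auto
  then have c: "continuous_on S F" for S using holomorphic_on_imp_continuous_on continuous_on_subset by blast
  have d: "deriv ?s 0 = of_real pi" by (rule DERIV_imp_deriv) (auto intro!: derivative_eq_intros)
  define B where "B = cbox (Complex (-1/2) (-pi/2)) (Complex (1/2) (pi/2))"
  have B: "v \<in> B \<longleftrightarrow> \<bar>Re v\<bar> \<le> 1/2 \<and> \<bar>Im v\<bar> \<le> pi/2" for v
    unfolding B_def in_cbox_complex_iff by auto
  have "0 \<in> B" by (simp add: B)
  moreover have "compact B" by (simp add: B_def)
  moreover have "continuous_on B (\<lambda>v. norm (F v))" using c by (intro continuous_intros)
  ultimately obtain v0 where v0: "v0 \<in> B" "\<And>v. v \<in> B \<Longrightarrow> norm (F v0) \<le> norm (F v)"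
    using continuous_attains_inf[of B "\<lambda>v. norm (F v)"] by blast
  have "F v0 \<noteq> 0"
  proof (cases "v0 = 0")
    case False
    have "?s v0 \<noteq> 0"
    proof
      assume "?s v0 = 0"
      then obtain n :: int where "of_real pi * v0 = of_real (real_of_int n * pi)" unfolding sin_eq_0 by blast
      then have "of_real pi * v0 = of_real pi * (of_real (real_of_int n) :: complex)" by (simp add: mult.commute)
      then have n: "v0 = of_real (real_of_int n)" by (simp only: mult_cancel_left of_real_eq_0_iff pi_neq_zero) simp
      then have "n = 0" using v0(1) by (simp add: B)
      then show False using n False by simp
    qed
    then show ?thesis using False by (simp add: F_def)
  qed (simp add: F_def d)
  moreover have "norm (F v0) * norm v \<le> norm (?s v)" if "\<bar>Re v\<bar> \<le> 1/2" "\<bar>Im v\<bar> \<le> pi/2" for v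
  proof (cases "v = 0")
    case False
    have "norm (F v0) \<le> norm (?s v) / norm v"
      using v0(2)[of v] that False by (simp add: B F_def norm_divide)
    then show ?thesis using False by (simp add: field_simps)
  qed simp
  ultimately show ?thesis using that[of "norm (F v0)"] by simp
qed

text \<open>The zeros of \<open>vortex\<close> shifted by one index: the extra point \<open>1 - exp 1\<close> outside the disc is the
  nearest one when \<open>|1 - z| > exp (1 / 2)\<close>.\<close>

definition log_lattice_pt :: "nat \<Rightarrow> complex" where
  "log_lattice_pt k = of_real (1 - exp (1 - real k))"

text \<open>The Gaussian yields the first term; the sine yields a cotangent, whose nearest pole is
  found by rounding \<open>Re L\<close> to \<open>n\<close>. With \<open>L = n + v\<close> and
  \<open>1 - z = exp L\<close>, the distance of \<open>1 - z\<close> from \<open>exp n\<close> is at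
  most a multiple of \<open>norm v * norm (1 - z)\<close>, which turns the pole in \<open>v\<close>
  into a pole at a lattice point. The second estimate records the scale \<open>exp (1 - k)\<close>
  on which this pole is used.\<close>

lemma vortex_logd_bound:
  obtains K where "K \<ge> 0" "\<And>z. z \<in> D2 \<Longrightarrow> \<exists>k.
     norm (vortex_logd z) \<le> 2 * norm (disc_log z) / norm (1 - z) + K / norm (z - log_lattice_pt k) \<and>
     norm (z - log_lattice_pt k) \<le> 3 * exp (1 - real k)"
proof -
  obtain c where c: "c > 0" "\<And>v. \<bar>Re v\<bar> \<le> 1/2 \<Longrightarrow> \<bar>Im v\<bar> \<le> pi/2 \<Longrightarrow> c * norm v \<le> norm (sin (of_real pi * v))"
    using norm_sin_pi_lower by blast
  \<comment> \<open>\<open>E\<close> bounds the ratio of \<open>norm w\<close> and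
    \<open>exp n\<close> in both directions, as \<open>Re L\<close> is within \<open>1/2\<close> of
    \<open>n\<close>; it is also a Lipschitz constant of \<open>exp\<close> on
    \<open>Re v \<le> 1/2\<close>.\<close>
  define E where "E = exp (1/2 :: real)"
  have E: "E > 0" by (simp add: E_def)
  have "E\<^sup>2 = exp 1" by (simp add: E_def flip: exp_double)
  then have "E\<^sup>2 \<le> 2\<^sup>2" using exp_le by simp
  then have E2: "E \<le> 2" by (rule power2_le_imp_le) simp
  define Cc where "Cc = pi * exp (pi * (pi / 2))"
  define K where "K = Cc * E * E / c"
  have K0: "K \<ge> 0" using c E by (simp add: K_def Cc_def)
  have "\<exists>k. norm (vortex_logd z) \<le> 2 * norm (disc_log z) / norm (1 - z) + K / norm (z - log_lattice_pt k) \<and>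
     norm (z - log_lattice_pt k) \<le> 3 * exp (1 - real k)" if z: "z \<in> D2" for z
  proof -
    define L where "L = disc_log z"
    define n where "n = round (Re L)"
    define v where "v = L - of_int n"
    define w where "w = 1 - z"
    have zr: "Re z < 1" "z \<noteq> 1" using D2_Re_less_1[OF z] by auto
    have w: "w = exp L" "w \<noteq> 0" using exp_disc_log[OF zr(2)] zr by (auto simp: w_def L_def)
    have nw: "norm w = exp (Re L)" unfolding w(1) by simp
    have rv: "\<bar>Re v\<bar> \<le> 1/2" using of_int_round_abs_le[of "Re L"] by (simp add: v_def n_def abs_minus_commute)
    have iv: "\<bar>Im v\<bar> \<le> pi/2" using disc_log_Im[OF zr(1)] by (simp add: v_def L_def)
    have "norm w < 2" using z norm_triangle_ineq4[of 1 z] by (simp add: w_def)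
    moreover have "2 < exp (1::real)" using exp_lower_Taylor_quadratic[of 1] by simp
    ultimately have "exp (Re L) < exp 1" using nw by linarith
    moreover have "real_of_int n \<le> Re L + 1/2" using of_int_round_le by (simp add: n_def)
    ultimately have "real_of_int n < 2" by simp
    \<comment> \<open>From \<open>norm w < 2 < exp 1\<close>: the rounded exponent may be
      \<open>1\<close> but not larger, which accounts for the shift in
      \<open>k = nat (1 - n)\<close>.\<close>
    then have n1: "n \<le> 1" by linarith
    define k where "k = nat (1 - n)"
    have k: "real_of_int n = 1 - real k" using n1 by (simp add: k_def)
    have en: "exp (of_int n) = (of_real (exp (real_of_int n)) :: complex)" by (simp flip: exp_of_real)
    have zk: "norm (z - log_lattice_pt k) = norm (w - exp (of_int n))"
      unfolding log_lattice_pt_def k[symmetric] en w_def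
      by (metis (no_types, lifting) add_diff_cancel_left' diff_diff_eq2 norm_minus_commute of_real_1 of_real_diff diff_add_eq diff_diff_add)
    have nn: "norm (exp (of_int n) :: complex) = exp (real_of_int n)" unfolding en by simp
    have wn: "w - exp (of_int n) = exp (of_int n) * (exp v - 1)"
      unfolding w(1) by (simp add: v_def exp_diff right_diff_distrib)
    have wE: "norm w \<le> exp (real_of_int n) * E" "exp (real_of_int n) \<le> E * norm w"
    proof -
      have "Re L \<le> real_of_int n + 1/2" "real_of_int n \<le> 1/2 + Re L"
        using of_int_round_abs_le[of "Re L"] unfolding n_def by linarith+
      then show "norm w \<le> exp (real_of_int n) * E" "exp (real_of_int n) \<le> E * norm w"
        unfolding nw E_def exp_add[symmetric] by (simp_all only: exp_le_cancel_iff)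
    qed
    have "norm (w - exp (of_int n)) \<le> norm w + exp (real_of_int n)"
      using norm_triangle_ineq4[of w "exp (of_int n)"] nn by simp
    also have "\<dots> \<le> exp (real_of_int n) * 2 + exp (real_of_int n)"
    proof (rule add_right_mono)
      have "exp (real_of_int n) * E \<le> exp (real_of_int n) * 2" by (rule mult_left_mono[OF E2]) simp
      then show "norm w \<le> exp (real_of_int n) * 2" using wE(1) by (rule order_trans[rotated])
    qed
    finally have b2: "norm (z - log_lattice_pt k) \<le> 3 * exp (1 - real k)" unfolding zk k[symmetric] by simp
    have "norm (vortex_logd z) \<le> 2 * norm (disc_log z) / norm (1 - z) + K / norm (z - log_lattice_pt k)"
    proof (cases "vortex z = 0")
      \<comment> \<open>Division by zero gives the quotient the value \<open>0\<close> at a vortex,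
        so the bound is trivial there.\<close>
      case True
      then show ?thesis using K0 by (simp add: vortex_logd_def)
    next
      case False
      have s: "sin (of_real pi * L) \<noteq> 0" using False by (auto simp: vortex_def L_def)
      have sv: "norm (sin (of_real pi * L)) = norm (sin (of_real pi * v))"
        using norm_sin_pi_shift[of v n] by (simp add: v_def)
      have v0: "v \<noteq> 0" using s sv by auto
      have "norm (cos (of_real pi * L)) \<le> exp (pi * (pi / 2))"
        using disc_log_Im[OF zr(1)] by (intro order_trans[OF norm_cos_le_exp]) (auto simp: L_def abs_mult)
      then have cs: "pi * norm (cot (of_real pi * L)) \<le> Cc / (c * norm v)"
        unfolding cot_def norm_divide sv Cc_def
        using c(2)[OF rv iv] c(1) v0 by (auto intro!: frac_le mult_left_mono simp flip: times_divide_eq_right)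
      have ev: "norm (exp v - 1) \<le> E * norm v"
      proof -
        have "norm (exp v - exp 0) \<le> E * norm (v - 0)"
          by (rule field_differentiable_bound[OF convex_halfspace_Re_le[of "1/2"], of exp exp])
            (use rv in \<open>auto simp: E_def abs_le_iff intro!: derivative_eq_intros\<close>)
        then show ?thesis by simp
      qed
      have e1: "exp v \<noteq> 1"
      proof
        assume "exp v = 1"
        then obtain m :: int where m: "Re v = 0" "Im v = of_int (2 * m) * pi" unfolding exp_eq_1 by blast
        then have "\<bar>real_of_int (2 * m)\<bar> * pi \<le> 1 / 2 * pi" using iv by (simp add: abs_mult)
        then have "\<bar>real_of_int (2 * m)\<bar> \<le> 1 / 2" by (simp only: mult_le_cancel_right_pos pi_gt_zero)
        then have "m = 0" by simp
        then show False using m v0 by (simp add: complex_eq_iff)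
      qed
      have "pi * norm (cot (of_real pi * L)) / norm w \<le> K / norm (w - exp (of_int n))"
      proof -
        have "pi * norm (cot (of_real pi * L)) / norm w \<le> Cc / (c * norm v) / norm w"
          using cs by (rule divide_right_mono) simp
        also have "\<dots> = Cc / c * (1 / (norm v * norm w))" by simp
        also have "\<dots> \<le> Cc / c * (E * E / norm (w - exp (of_int n)))"
        proof (rule mult_left_mono)
          have "norm (w - exp (of_int n)) = exp (real_of_int n) * norm (exp v - 1)"
            unfolding wn norm_mult nn ..
          also have "\<dots> \<le> (E * norm w) * (E * norm v)"
            using wE ev E by (intro mult_mono) auto
          finally have "norm (w - exp (of_int n)) \<le> E * E * (norm v * norm w)" by (simp add: mult_ac)
          moreover have "norm (w - exp (of_int n)) > 0" using wn e1 by simp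
          ultimately show "1 / (norm v * norm w) \<le> E * E / norm (w - exp (of_int n))"
            using v0 w(2) by (simp add: field_simps)
          show "0 \<le> Cc / c" using c(1) by (simp add: Cc_def)
        qed
        also have "Cc / c * (E * E / norm (w - exp (of_int n))) = K / norm (w - exp (of_int n))"
          by (simp add: K_def)
        finally show ?thesis .
      qed
      moreover have "norm (vortex_logd z) \<le> 2 * norm L / norm w + pi * norm (cot (of_real pi * L)) / norm w"
        unfolding vortex_logd_eq[OF zr(1) False] norm_divide L_def[symmetric] w_def[symmetric] add_divide_distrib[symmetric]
        by (intro divide_right_mono order_trans[OF norm_triangle_ineq4]) (auto simp: norm_mult)
      ultimately show ?thesis unfolding zk by (simp add: L_def w_def)
    qed
    then show ?thesis using b2 by blast
  qed
  with K0 that show ?thesis by blast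
qed

text \<open>For \<open>t \<le> 1\<close>, the inequality \<open>ln x \<le> x\<close> at
  \<open>x = t powr (- \<delta>)\<close> gives the coefficient \<open>1 / \<delta>\<close>. The
  constant \<open>8\<close> absorbs the imaginary part and the range \<open>1 < t < 2\<close>, where
  the power is at least \<open>1 / 2\<close>.\<close>

lemma norm_disc_log_le:
  assumes "0 < \<delta>" "\<delta> \<le> 1" "z \<in> D2"
  shows "norm (disc_log z) \<le> (1 / \<delta> + 8) * norm (1 - z) powr (- \<delta>)"
proof -
  define t where "t = norm (1 - z)"
  have zr: "Re z < 1" "z \<noteq> 1" using D2_Re_less_1[OF assms(3)] by auto
  have t: "0 < t" "t < 2" using assms(3) zr norm_triangle_ineq4[of 1 z] by (auto simp: t_def)
  have "norm (disc_log z) \<le> \<bar>ln t\<bar> + 2"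
    using cmod_le[of "disc_log z"] disc_log_Im[OF zr(1)] disc_log_Re[OF zr(2)] pi_half_less_two by (simp add: t_def)
  also have "\<dots> \<le> (1 / \<delta> + 8) * t powr (- \<delta>)"
  proof (cases "t \<le> 1")
    case True
    have "- ln t = ln (t powr (- \<delta>)) / \<delta>" using assms t by (simp add: ln_powr)
    also have "\<dots> \<le> t powr (- \<delta>) / \<delta>" using assms t by (intro divide_right_mono ln_bound) auto
    finally have "\<bar>ln t\<bar> \<le> t powr (- \<delta>) / \<delta>" using True t by simp
    moreover have "1 \<le> t powr (- \<delta>)" using True t assms powr_mono2'[of "- \<delta>" t 1] by simp
    ultimately show ?thesis by (simp add: distrib_right)
  next
    case False
    have "ln t \<le> ln 2" using t by simp
    moreover have "0 \<le> ln t" using False by simp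
    ultimately have "\<bar>ln t\<bar> \<le> 1" using ln_2_less_1 by linarith
    moreover have "1 / 2 \<le> t powr (- \<delta>)"
    proof -
      have "1 / 2 = 2 powr (- 1 :: real)" by (simp add: powr_minus)
      also have "\<dots> \<le> 2 powr (- \<delta>)" using assms by (intro powr_mono) auto
      also have "\<dots> \<le> t powr (- \<delta>)" using assms t by (intro powr_mono2') auto
      finally show ?thesis .
    qed
    moreover have "0 \<le> 1 / \<delta> * t powr (- \<delta>)" using assms by simp
    ultimately show ?thesis by (simp add: distrib_right)
  qed
  finally show ?thesis by (simp add: t_def)
qed

lemma powr_add_le: "0 \<le> a \<Longrightarrow> 0 \<le> b \<Longrightarrow> 0 \<le> p \<Longrightarrow> (a + b) powr p \<le> 2 powr p * (a powr p + b powr p)" for a b p :: real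
proof -
  assume h: "0 \<le> a" "0 \<le> b" "0 \<le> p"
  have "(a + b) powr p \<le> (2 * max a b) powr p" using h by (intro powr_mono2) auto
  also have "\<dots> = 2 powr p * max a b powr p" using h by (simp add: powr_mult)
  also have "max a b powr p \<le> a powr p + b powr p" by (simp add: max_def)
  finally show ?thesis by (simp add: mult_left_mono)
qed

lemma borel_measurable_vortex_logd: "(\<lambda>z. indicator D2 z *\<^sub>R vortex_logd z) \<in> borel_measurable borel"
proof -
  have h: "vortex holomorphic_on D2" by (rule bounded_derivs_holomorphic[OF bounded_derivs_vortex])
  have 1: "(\<lambda>z. indicator D2 z *\<^sub>R vortex z) \<in> borel_measurable borel"
    by (rule borel_measurable_continuous_on_indicator) (use h in \<open>auto intro: holomorphic_on_imp_continuous_on\<close>)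
  have 2: "(\<lambda>z. indicator D2 z *\<^sub>R deriv vortex z) \<in> borel_measurable borel"
    by (rule borel_measurable_continuous_on_indicator) (use h in \<open>auto intro!: holomorphic_on_imp_continuous_on holomorphic_deriv\<close>)
  have "(\<lambda>z. (indicator D2 z *\<^sub>R deriv vortex z) / (indicator D2 z *\<^sub>R vortex z)) \<in> borel_measurable borel"
    using 1 2 by measurable
  also have "(\<lambda>z. (indicator D2 z *\<^sub>R deriv vortex z) / (indicator D2 z *\<^sub>R vortex z)) = (\<lambda>z. indicator D2 z *\<^sub>R vortex_logd z)"
    by (auto simp: vortex_logd_def indicator_def)
  finally show ?thesis .
qed

text \<open>An exponent \<open>r\<close> strictly between \<open>p\<close> and \<open>2\<close> is
  fixed. The selected lattice point is within a distance of order \<open>exp (- k)\<close>, so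
  passing from the power \<open>- p\<close> to \<open>- r\<close> gains a factor of order
  \<open>exp (- \<sigma> * k)\<close>. This gain makes the sum over infinitely many poles converge,
  while the power \<open>- r\<close> is still integrable.\<close>

lemma vortex_logd_Lp:
  assumes p: "1 \<le> p" "p < 2"
  shows "set_integrable lborel D2 (\<lambda>z. norm (vortex_logd z) powr p)"
proof -
  define r where "r = (p + 2) / 2"
  define \<sigma> where "\<sigma> = r - p"
  \<comment> \<open>Chosen so that \<open>(1 + \<delta>) * p = r\<close>: with the logarithm
    estimated by the power \<open>- \<delta>\<close>, the Gaussian term acquires the same exponent
    \<open>- r\<close>.\<close>
  define \<delta> where "\<delta> = r / p - 1"
  have r: "0 \<le> r" "r < 2" "0 < \<sigma>" using p by (auto simp: r_def \<sigma>_def field_simps)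
  have \<delta>: "0 < \<delta>" "\<delta> \<le> 1" "(1 + \<delta>) * p = r" using p by (auto simp: r_def \<delta>_def field_simps)
  obtain K where K: "K \<ge> 0" "\<And>z. z \<in> D2 \<Longrightarrow> \<exists>k.
     norm (vortex_logd z) \<le> 2 * norm (disc_log z) / norm (1 - z) + K / norm (z - log_lattice_pt k) \<and>
     norm (z - log_lattice_pt k) \<le> 3 * exp (1 - real k)"
    using vortex_logd_bound by blast
  define A where "A = 2 powr p * (2 * (1 / \<delta> + 8)) powr p"
  define B where "B k = 2 powr p * (K powr p * (3 * exp (1 - real k)) powr \<sigma>)" for k :: nat
  \<comment> \<open>The radius \<open>10\<close> exceeds all distances involved:
    \<open>norm (1 - z) < 2\<close>, and the distance to the selected lattice point is at most
    \<open>3 * exp 1\<close>.\<close>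
  define P where "P q z = indicator (ball q 10) z * norm (z - q) powr (- r)" for q z :: complex
  define I where "I = (\<integral>\<^sup>+z. ennreal (P 0 z) \<partial>lborel)"
  have I: "I < \<infinity>" unfolding I_def P_def by (rule nn_integral_norm_powr) (use r in auto)
  have Iq: "(\<integral>\<^sup>+z. ennreal (P q z) \<partial>lborel) = I" for q
    unfolding I_def P_def using nn_integral_norm_powr_translate[of q 10 r] by simp
  have Pm: "P q \<in> borel_measurable borel" for q
    unfolding P_def[abs_def] powr_def by (intro borel_measurable_times borel_measurable_indicator) simp_all
  have IC: "(\<integral>\<^sup>+z. ennreal (C * P q z) \<partial>lborel) = ennreal C * I" if "C \<ge> 0" for C q
  proof -
    have "(\<integral>\<^sup>+z. ennreal (C * P q z) \<partial>lborel) = (\<integral>\<^sup>+z. ennreal C * ennreal (P q z) \<partial>lborel)"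
      using that by (simp add: ennreal_mult' )
    also have "\<dots> = ennreal C * I" unfolding Iq[of q, symmetric] using Pm[of q] by (intro nn_integral_cmult) simp
    finally show ?thesis .
  qed
  have A0: "A \<ge> 0" by (simp add: A_def)
  have B0: "B k \<ge> 0" for k by (simp add: B_def)
  have main: "(\<integral>\<^sup>+z. ennreal (indicator D2 z * norm (vortex_logd z) powr p) \<partial>lborel) < \<infinity>"
  proof (rule nn_integral_bounded_by_series)
    show "(\<lambda>z. ennreal (B k * P (log_lattice_pt k) z)) \<in> borel_measurable lborel" for k
      using Pm by simp
    show "(\<lambda>z. ennreal (A * P 1 z)) \<in> borel_measurable lborel" using Pm by simp
    show "(\<integral>\<^sup>+z. ennreal (A * P 1 z) \<partial>lborel) < \<infinity>"
      using I by (simp add: IC[OF A0] ennreal_mult_less_top)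
    show "(\<integral>\<^sup>+z. ennreal (B k * P (log_lattice_pt k) z) \<partial>lborel) \<le> ennreal (B k * enn2real I)" for k
      using I B0 by (simp add: IC[OF B0] ennreal_mult)
    show "B k * enn2real I \<ge> 0" for k using B0 by simp
    have "B k = 2 powr p * K powr p * (3 * exp 1) powr \<sigma> * exp (- \<sigma>) ^ k" for k
    proof -
      have "(3 * exp (1 - real k)) powr \<sigma> = (3 * exp 1 * exp (- real k)) powr \<sigma>"
        by (simp add: exp_diff exp_minus divide_inverse mult.assoc)
      also have "\<dots> = (3 * exp 1) powr \<sigma> * exp (- real k) powr \<sigma>" by (rule powr_mult; simp)
      also have "exp (- real k) powr \<sigma> = exp (- \<sigma>) ^ k"
        by (simp add: powr_def exp_of_nat_mult[symmetric] mult.commute)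
      finally show ?thesis by (simp add: B_def)
    qed
    moreover have "summable (\<lambda>k. 2 powr p * K powr p * (3 * exp 1) powr \<sigma> * exp (- \<sigma>) ^ k)"
      using r by (intro summable_mult summable_geometric) simp
    ultimately show "summable (\<lambda>k. B k * enn2real I)" by (intro summable_mult2) simp
    fix z :: complex
    show "\<exists>k. ennreal (indicator D2 z * norm (vortex_logd z) powr p)
       \<le> ennreal (A * P 1 z) + ennreal (B k * P (log_lattice_pt k) z)"
    proof (cases "z \<in> D2")
      case True
      define t where "t = norm (1 - z)"
      have t: "t > 0" using D2_Re_less_1[OF True] by (auto simp: t_def)
      obtain k where k: "norm (vortex_logd z) \<le> 2 * norm (disc_log z) / t + K / norm (z - log_lattice_pt k)"
        "norm (z - log_lattice_pt k) \<le> 3 * exp (1 - real k)" using K(2)[OF True] unfolding t_def by blast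
      define d where "d = norm (z - log_lattice_pt k)"
      have "exp (1 - real k) \<le> exp 1" by simp
      then have "d < 10" using k(2) exp_le unfolding d_def by linarith
      then have P2: "P (log_lattice_pt k) z = d powr (- r)"
        by (simp add: P_def d_def dist_norm norm_minus_commute)
      have "t < 10" using True norm_triangle_ineq4[of 1 z] by (simp add: t_def)
      then have P1: "P 1 z = t powr (- r)"
        by (simp add: P_def t_def dist_norm norm_minus_commute)
      have "(2 * norm (disc_log z) / t) powr p \<le> (2 * (1 / \<delta> + 8) * t powr (- (1 + \<delta>))) powr p"
      proof (rule powr_mono2)
        have "2 * norm (disc_log z) / t \<le> 2 * ((1 / \<delta> + 8) * t powr (- \<delta>)) / t"
          using norm_disc_log_le[OF \<delta>(1,2) True] t unfolding t_def by (intro divide_right_mono mult_left_mono) auto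
        also have "\<dots> = 2 * (1 / \<delta> + 8) * (t powr (- \<delta>) / t)" by simp
        also have "t powr (- \<delta>) / t = t powr (- (1 + \<delta>))" 
        proof -
          have "- (1 + \<delta>) = - \<delta> - 1" by simp
          then show ?thesis using t powr_diff[of t "- \<delta>" 1] by (simp only: powr_one)
        qed
        finally show "2 * norm (disc_log z) / t \<le> 2 * (1 / \<delta> + 8) * t powr (- (1 + \<delta>))" .
      qed (use p t in auto)
      also have "\<dots> = (2 * (1 / \<delta> + 8)) powr p * (t powr (- (1 + \<delta>))) powr p"
        by (rule powr_mult; use \<delta> in simp)
      also have "(t powr (- (1 + \<delta>))) powr p = t powr (- r)"
        unfolding powr_powr \<delta>(3)[symmetric] by (simp only: mult_minus_left)
      finally have e1: "(2 * norm (disc_log z) / t) powr p \<le> (2 * (1 / \<delta> + 8)) powr p * t powr (- r)" .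
      have e2: "(K / d) powr p \<le> K powr p * (3 * exp (1 - real k)) powr \<sigma> * d powr (- r)"
      proof (cases "d = 0")
        case False
        then have d0: "d > 0" by (simp add: d_def)
        have "(K / d) powr p = K powr p * d powr (- p)"
        proof -
          have "(K / d) powr p = K powr p / d powr p" by (rule powr_divide; use K(1) d0 in simp)
          then show ?thesis by (simp only: powr_minus divide_inverse)
        qed
        also have "d powr (- p) = d powr \<sigma> * d powr (- r)" by (simp add: \<sigma>_def flip: powr_add)
        also have "\<dots> \<le> (3 * exp (1 - real k)) powr \<sigma> * d powr (- r)"
          using k(2) d0 r unfolding d_def by (intro mult_right_mono powr_mono2) auto
        finally show ?thesis by (simp add: mult_left_mono mult.assoc)
      qed simp
      have "norm (vortex_logd z) powr p \<le> (2 * norm (disc_log z) / t + K / d) powr p"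
        using k(1) p unfolding d_def by (intro powr_mono2) auto
      also have "\<dots> \<le> 2 powr p * ((2 * norm (disc_log z) / t) powr p + (K / d) powr p)"
        using K(1) t p by (intro powr_add_le) (auto simp: d_def)
      also have "\<dots> \<le> 2 powr p * ((2 * (1 / \<delta> + 8)) powr p * t powr (- r)
          + K powr p * (3 * exp (1 - real k)) powr \<sigma> * d powr (- r))"
        by (intro mult_left_mono add_mono e1 e2) simp
      also have "\<dots> = A * P 1 z + B k * P (log_lattice_pt k) z"
        unfolding P1 P2 A_def B_def by (simp add: algebra_simps)
      finally have "indicator D2 z * norm (vortex_logd z) powr p \<le> A * P 1 z + B k * P (log_lattice_pt k) z"
        using True by simp
      then have "ennreal (indicator D2 z * norm (vortex_logd z) powr p) \<le> ennreal (A * P 1 z + B k * P (log_lattice_pt k) z)"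
        by (rule ennreal_leI)
      also have "\<dots> = ennreal (A * P 1 z) + ennreal (B k * P (log_lattice_pt k) z)"
        using A0 B0[of k] P1 P2 by (intro ennreal_plus) auto
      finally show ?thesis by blast
    qed simp
  qed
  have eq: "indicator D2 z * norm (vortex_logd z) powr p = \<bar>norm (indicator D2 z *\<^sub>R vortex_logd z)\<bar> powr p" for z
    by (simp add: indicator_def)
  have "integrable lborel (\<lambda>z. indicator D2 z * norm (vortex_logd z) powr p)"
  proof (rule integrableI_nonneg)
    show "(\<lambda>z. indicator D2 z * norm (vortex_logd z) powr p) \<in> borel_measurable lborel"
      unfolding eq using measurable_abs_powr[OF measurable_compose[OF borel_measurable_vortex_logd borel_measurable_norm]] by simp
  qed (use main in auto)
  then show ?thesis unfolding set_integrable_def by simp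
qed

section \<open>Smoothness of the trace\<close>

text \<open>Differentiating along the circle multiplies by a logarithmic derivative of
  \<open>vortex\<close>, which contains \<open>cot\<close>, and, as \<open>homog\<close> is not
  holomorphic, also by its conjugate.\<close>

inductive circ_poly :: "(complex \<Rightarrow> complex) \<Rightarrow> bool" where
  "circ_poly (\<lambda>_. c)"
| "circ_poly (\<lambda>w. w)"
| "circ_poly (\<lambda>w. exp (- w))"
| "circ_poly (\<lambda>w. cot (of_real pi * w))"
| "circ_poly P \<Longrightarrow> circ_poly (\<lambda>w. cnj (P w))"
| "circ_poly P \<Longrightarrow> circ_poly Q \<Longrightarrow> circ_poly (\<lambda>w. P w + Q w)"
| "circ_poly P \<Longrightarrow> circ_poly Q \<Longrightarrow> circ_poly (\<lambda>w. P w * Q w)"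

text \<open>On the circle \<open>1 - cis \<theta> = exp w\<close>, so the angular derivative
  \<open>- \<i> * cis \<theta> / (1 - cis \<theta>)\<close> of the logarithm is a function of
  \<open>w\<close> alone.\<close>

definition circ_log_deriv :: "complex \<Rightarrow> complex" where
  "circ_log_deriv w = \<i> + (- \<i>) * exp (- w)"

lemma circ_poly_log_deriv: "circ_poly circ_log_deriv"
  unfolding circ_log_deriv_def[abs_def] by (intro circ_poly.intros)

lemma cis_Re_less_1: "cis \<theta> \<noteq> 1 \<Longrightarrow> Re (cis \<theta>) < 1"
  by (rule cball_Re_less_1) auto

lemma vortex_cis_nz: "cis \<theta> \<noteq> 1 \<Longrightarrow> vortex (cis \<theta>) \<noteq> 0"
proof
  assume "cis \<theta> \<noteq> 1" "vortex (cis \<theta>) = 0"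
  then obtain k where "cis \<theta> = vortex_pt k" using vortex_eq_0_iff[of "cis \<theta>"] by auto
  then have "cis \<theta> \<in> D2" using vortex_pt_in_D2 by simp
  then show False by simp
qed

lemma cis_vector_derivative: "(cis has_vector_derivative \<i> * cis \<theta>) (at \<theta>)"
proof -
  have "((\<lambda>t. Complex (cos t) (sin t)) has_vector_derivative Complex (- sin \<theta>) (cos \<theta>)) (at \<theta>)"
    unfolding has_vector_derivative_complex_iff by (auto intro!: derivative_eq_intros)
  moreover have "cis = (\<lambda>t. Complex (cos t) (sin t))" by (auto simp: cis.ctr)
  moreover have "\<i> * cis \<theta> = Complex (- sin \<theta>) (cos \<theta>)" by (simp add: complex_eq_iff)
  ultimately show ?thesis by simp
qed

lemma circ_log_vector_derivative:
  assumes "cis \<theta> \<noteq> 1"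
  shows "((\<lambda>\<theta>. disc_log (cis \<theta>)) has_vector_derivative circ_log_deriv (disc_log (cis \<theta>))) (at \<theta>)"
proof -
  have "((disc_log \<circ> cis) has_vector_derivative (\<i> * cis \<theta>) * - exp (- disc_log (cis \<theta>))) (at \<theta>)"
    by (rule field_vector_diff_chain_at[OF cis_vector_derivative disc_log_deriv[OF cis_Re_less_1[OF assms]]])
  moreover have "cis \<theta> = 1 - exp (disc_log (cis \<theta>))" using exp_disc_log[OF assms] by simp
  then have "(\<i> * cis \<theta>) * - exp (- disc_log (cis \<theta>)) = circ_log_deriv (disc_log (cis \<theta>))"
  proof -
    have "(\<i> * (1 - exp L)) * - exp (- L) = circ_log_deriv L" for L :: complex
      by (simp add: circ_log_deriv_def algebra_simps flip: exp_add)
    then show ?thesis using exp_disc_log[OF assms] by (metis diff_diff_eq2 add_diff_cancel_left' add.commute)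
  qed
  ultimately show ?thesis by (simp add: o_def)
qed

lemma circ_poly_vector_derivative:
  assumes "circ_poly Q"
  shows "\<exists>Q'. circ_poly Q' \<and> (\<forall>\<theta>. cis \<theta> \<noteq> 1 \<longrightarrow>
    ((\<lambda>\<theta>. Q (disc_log (cis \<theta>))) has_vector_derivative Q' (disc_log (cis \<theta>))) (at \<theta>))"
  using assms
proof (induction rule: circ_poly.induct)
  case (1 c)
  show ?case by (intro exI[of _ "\<lambda>_. 0"]) (auto intro: circ_poly.intros)
next
  case 2
  show ?case using circ_poly_log_deriv circ_log_vector_derivative by blast
next
  case 3
  have "circ_poly (\<lambda>w. circ_log_deriv w * ((-1) * exp (- w)))" by (intro circ_poly.intros circ_poly_log_deriv)
  moreover have "((\<lambda>\<theta>. exp (- disc_log (cis \<theta>))) has_vector_derivative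
     circ_log_deriv (disc_log (cis \<theta>)) * ((-1) * exp (- disc_log (cis \<theta>)))) (at \<theta>)" if "cis \<theta> \<noteq> 1" for \<theta>
  proof -
    have "((\<lambda>w. exp (- w)) has_field_derivative (-1) * exp (- disc_log (cis \<theta>))) (at (disc_log (cis \<theta>)))"
      by (auto intro!: derivative_eq_intros)
    from field_vector_diff_chain_at[OF circ_log_vector_derivative[OF that] this] show ?thesis by (simp only: o_def)
  qed
  ultimately show ?case by blast
next
  case 4
  have "circ_poly (\<lambda>w. circ_log_deriv w * ((- of_real pi) * (1 + cot (of_real pi * w) * cot (of_real pi * w))))"
    by (intro circ_poly.intros circ_poly_log_deriv)
  moreover have "((\<lambda>\<theta>. cot (of_real pi * disc_log (cis \<theta>))) has_vector_derivative
     circ_log_deriv (disc_log (cis \<theta>)) * ((- of_real pi) * (1 + cot (of_real pi * disc_log (cis \<theta>)) * cot (of_real pi * disc_log (cis \<theta>))))) (at \<theta>)"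
    if "cis \<theta> \<noteq> 1" for \<theta>
  proof -
    define w where "w = of_real pi * disc_log (cis \<theta>)"
    \<comment> \<open>Apart from \<open>1\<close> the circle contains no zero of
      \<open>vortex\<close>, so \<open>cot\<close> is evaluated away from its poles.\<close>
    have s: "sin w \<noteq> 0" using vortex_cis_nz[OF that] by (auto simp: vortex_def w_def)
    have "- inverse ((sin w)\<^sup>2) = - (1 + cot w * cot w)"
      using s sin_cos_squared_add[of w] by (simp add: cot_def field_simps power2_eq_square)
    then have "(cot has_field_derivative - (1 + cot w * cot w)) (at (of_real pi * disc_log (cis \<theta>)))"
      using DERIV_cot[OF s] by (simp add: w_def)
    moreover have "((\<lambda>w. of_real pi * w) has_field_derivative of_real pi) (at (disc_log (cis \<theta>)))"
      by (auto intro!: derivative_eq_intros)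
    ultimately have "((\<lambda>w. cot (of_real pi * w)) has_field_derivative - (1 + cot w * cot w) * of_real pi) (at (disc_log (cis \<theta>)))"
      by (rule DERIV_chain2)
    then have "((\<lambda>w. cot (of_real pi * w)) has_field_derivative (- of_real pi) * (1 + cot w * cot w)) (at (disc_log (cis \<theta>)))"
      by (rule DERIV_cong) (simp add: algebra_simps)
    from field_vector_diff_chain_at[OF circ_log_vector_derivative[OF that] this] show ?thesis
      by (simp only: o_def w_def)
  qed
  ultimately show ?case by blast
next
  case (5 P)
  then obtain P' where P: "circ_poly P'" "\<And>\<theta>. cis \<theta> \<noteq> 1 \<Longrightarrow>
    ((\<lambda>\<theta>. P (disc_log (cis \<theta>))) has_vector_derivative P' (disc_log (cis \<theta>))) (at \<theta>)" by blast
  have "((\<lambda>\<theta>. cnj (P (disc_log (cis \<theta>)))) has_vector_derivative cnj (P' (disc_log (cis \<theta>)))) (at \<theta>)"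
    if "cis \<theta> \<noteq> 1" for \<theta>
    using bounded_linear.has_vector_derivative[OF bounded_linear_cnj P(2)[OF that]] .
  then show ?case using circ_poly.intros(5)[OF P(1)] by (intro exI[of _ "\<lambda>w. cnj (P' w)"]) simp
next
  case (6 P Q)
  then obtain P' Q' where P: "circ_poly P'" "\<And>\<theta>. cis \<theta> \<noteq> 1 \<Longrightarrow>
    ((\<lambda>\<theta>. P (disc_log (cis \<theta>))) has_vector_derivative P' (disc_log (cis \<theta>))) (at \<theta>)"
    "circ_poly Q'" "\<And>\<theta>. cis \<theta> \<noteq> 1 \<Longrightarrow>
    ((\<lambda>\<theta>. Q (disc_log (cis \<theta>))) has_vector_derivative Q' (disc_log (cis \<theta>))) (at \<theta>)" by blast
  then show ?case by (intro exI[of _ "\<lambda>w. P' w + Q' w"]) (auto intro!: circ_poly.intros(6) has_vector_derivative_add)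
next
  case (7 P Q)
  then obtain P' Q' where P: "circ_poly P'" "\<And>\<theta>. cis \<theta> \<noteq> 1 \<Longrightarrow>
    ((\<lambda>\<theta>. P (disc_log (cis \<theta>))) has_vector_derivative P' (disc_log (cis \<theta>))) (at \<theta>)"
    "circ_poly Q'" "\<And>\<theta>. cis \<theta> \<noteq> 1 \<Longrightarrow>
    ((\<lambda>\<theta>. Q (disc_log (cis \<theta>))) has_vector_derivative Q' (disc_log (cis \<theta>))) (at \<theta>)" by blast
  then show ?case using 7 by (intro exI[of _ "\<lambda>w. P w * Q' w + P' w * Q w"])
    (auto intro!: circ_poly.intros(6,7) has_vector_derivative_mult)
qed

text \<open>The logarithms of \<open>1 - z\<close> for \<open>z\<close> on the circle near
  \<open>1\<close>. They stay away from the real axis, where the poles of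
  \<open>cot (of_real pi * w)\<close> lie.\<close>

definition near_one_logs :: "complex set" where
  "near_one_logs = {disc_log (cis \<theta>) | \<theta>. cis \<theta> \<noteq> 1 \<and> norm (1 - cis \<theta>) \<le> 1/2}"

lemma norm_sin_ge_Im: "\<bar>Im z\<bar> \<le> 2 * norm (sin (z::complex))"
proof -
  have e: "norm (sin z) = norm (exp (\<i> * z) - exp (- (\<i> * z))) / 2"
    by (simp add: sin_exp_eq norm_divide norm_mult)
  have "\<bar>norm (exp (\<i> * z)) - norm (exp (- (\<i> * z)))\<bar> \<le> norm (exp (\<i> * z) - exp (- (\<i> * z)))"
    by (rule norm_triangle_ineq3)
  then have "\<bar>exp (- Im z) - exp (Im z)\<bar> \<le> 2 * norm (sin z)" unfolding e by (simp add: norm_exp_eq_Re)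
  moreover have "\<bar>Im z\<bar> \<le> \<bar>exp (- Im z) - exp (Im z)\<bar>"
  proof (cases "Im z \<ge> 0")
    case True
    then have "exp (- Im z) \<le> 1" "1 + Im z \<le> exp (Im z)" by auto
    then show ?thesis using True by linarith
  next
    case False
    then have "exp (Im z) \<le> 1" "1 + - Im z \<le> exp (- Im z)" using exp_ge_add_one_self[of "- Im z"] by auto
    then show ?thesis using False by linarith
  qed
  ultimately show ?thesis by linarith
qed

text \<open>Near \<open>1\<close> the circle is almost perpendicular to the real axis, so the
  argument of \<open>1 - cis \<theta>\<close> is close to \<open>pi / 2\<close> in absolute value:
  the square of its sine is \<open>(1 + cos \<theta>) / 2\<close>.\<close>

lemma near_one_logs_Im:
  assumes "w \<in> near_one_logs"
  shows "1/2 \<le> \<bar>Im w\<bar>"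
proof -
  obtain \<theta> where t: "w = disc_log (cis \<theta>)" "cis \<theta> \<noteq> 1" "norm (1 - cis \<theta>) \<le> 1/2"
    using assms by (auto simp: near_one_logs_def)
  have e: "exp w = 1 - cis \<theta>" using exp_disc_log t by simp
  have i: "exp (Re w) * sin (Im w) = - sin \<theta>" using arg_cong[OF e, of Im] by (simp add: Im_exp)
  have n: "exp (Re w) = norm (1 - cis \<theta>)" using arg_cong[OF e, of norm] by simp
  have n2: "(exp (Re w))\<^sup>2 = 2 - 2 * cos \<theta>"
  proof -
    have "(norm (1 - cis \<theta>))\<^sup>2 = (1 - cos \<theta>)\<^sup>2 + (sin \<theta>)\<^sup>2" by (simp add: cmod_power2)
    also have "\<dots> = 1 - 2 * cos \<theta> + ((sin \<theta>)\<^sup>2 + (cos \<theta>)\<^sup>2)" by (simp add: power2_diff)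
    finally show ?thesis using n by simp
  qed
  have "(exp (Re w))\<^sup>2 \<le> (1/2)\<^sup>2" using t(3) unfolding n[symmetric] by (intro power_mono) auto
  then have c: "cos \<theta> \<ge> 7/8" unfolding n2 by (simp add: power2_eq_square)
  have "(2 - 2 * cos \<theta>) * (sin (Im w))\<^sup>2 = (1 - cos \<theta>) * (1 + cos \<theta>)"
  proof -
    have "(exp (Re w) * sin (Im w))\<^sup>2 = (sin \<theta>)\<^sup>2" unfolding i by simp
    also have "\<dots> = 1 - (cos \<theta>)\<^sup>2" by (simp add: sin_squared_eq)
    also have "\<dots> = (1 - cos \<theta>) * (1 + cos \<theta>)" by (simp add: power2_eq_square algebra_simps)
    finally show ?thesis by (simp add: power_mult_distrib n2)
  qed
  then have "(1 - cos \<theta>) * (2 * (sin (Im w))\<^sup>2) = (1 - cos \<theta>) * (1 + cos \<theta>)" by (simp add: algebra_simps)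
  moreover have "1 - cos \<theta> \<noteq> 0"
  proof
    assume "1 - cos \<theta> = 0"
    then have "(exp (Re w))\<^sup>2 = 0" using n2 by simp
    then show False by simp
  qed
  ultimately have "2 * (sin (Im w))\<^sup>2 = 1 + cos \<theta>" by simp
  then have "(1/2)\<^sup>2 \<le> \<bar>sin (Im w)\<bar>\<^sup>2" using c by (simp add: power2_eq_square)
  then have "1/2 \<le> \<bar>sin (Im w)\<bar>" by (rule power2_le_imp_le) simp
  also have "\<dots> \<le> \<bar>Im w\<bar>" by (rule abs_sin_x_le_abs_x)
  finally show ?thesis .
qed

lemma circ_poly_growth:
  assumes "circ_poly Q" shows "exp_growth near_one_logs Q"
proof -
  have sub: "near_one_logs \<subseteq> {w. \<bar>Im w\<bar> \<le> pi / 2}"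
    using disc_log_Im cis_Re_less_1 by (auto simp: near_one_logs_def)
  have "exp_growth near_one_logs (\<lambda>w. cot (of_real pi * w))"
  proof (rule exp_growthI_bounded)
    fix w assume w: "w \<in> near_one_logs"
    have "norm (cos (of_real pi * w)) \<le> exp (pi * (pi / 2))"
      using sub w by (intro order_trans[OF norm_cos_le_exp]) (auto simp: abs_mult)
    moreover have "pi / 4 \<le> norm (sin (of_real pi * w))"
    proof -
      have "pi * (1/2) \<le> pi * \<bar>Im w\<bar>" using near_one_logs_Im[OF w] by (intro mult_left_mono) auto
      moreover have "pi * \<bar>Im w\<bar> \<le> 2 * norm (sin (of_real pi * w))"
        using norm_sin_ge_Im[of "of_real pi * w"] by (simp add: abs_mult)
      ultimately show ?thesis by linarith
    qed
    ultimately show "norm (cot (of_real pi * w)) \<le> exp (pi * (pi / 2)) / (pi / 4)"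
      unfolding cot_def norm_divide by (intro frac_le) auto
  qed
  then show ?thesis using assms exp_growth_basic[OF sub]
  proof (induction rule: circ_poly.induct[OF assms])
    case (5 P)
    then show ?case by (simp add: exp_growth_def)
  qed (auto intro: exp_growth_add exp_growth_mult exp_growthI_bounded)
qed

text \<open>The shape is stable under differentiation with the same \<open>a\<close> and
  \<open>m\<close>: the lowered \<open>homog\<close> times the derivative of \<open>vortex\<close>
  is the original \<open>homog\<close> times a logarithmic derivative, which goes into
  \<open>Q\<close>.\<close>

definition circ_fun :: "real \<Rightarrow> int \<Rightarrow> (complex \<Rightarrow> complex) \<Rightarrow> real \<Rightarrow> complex" where
  "circ_fun a m Q \<theta> = homog a m (vortex (cis \<theta>)) * Q (disc_log (cis \<theta>))"

lemma norm_one_minus_cis_le: "norm (1 - cis t) \<le> \<bar>t\<bar>"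
proof -
  have "norm (cis t - cis 0) \<le> 1 * norm (t - 0)"
  proof (rule differentiable_bound[of UNIV cis "\<lambda>\<theta> x. x *\<^sub>R (\<i> * cis \<theta>)"])
    fix x show "(cis has_derivative (\<lambda>h. h *\<^sub>R (\<i> * cis x))) (at x within UNIV)"
      using cis_vector_derivative[of x] by (simp add: has_vector_derivative_def)
    show "onorm (\<lambda>h. h *\<^sub>R (\<i> * cis x)) \<le> 1" by (rule onorm_bound) (auto simp: norm_mult)
  qed auto
  then show ?thesis by (simp add: norm_minus_commute)
qed

lemma quadratic_bound_vector_derivative:
  fixes f :: "real \<Rightarrow> complex"
  assumes "f x = 0" "0 < d" "\<And>y. \<bar>y - x\<bar> < d \<Longrightarrow> norm (f y) \<le> C * \<bar>y - x\<bar>\<^sup>2"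
  shows "(f has_vector_derivative 0) (at x)"
proof -
  have "((\<lambda>h. norm (f (x + h)) / norm h) \<longlongrightarrow> 0) (at 0)"
  proof (rule Lim_null_comparison)
    have "eventually (\<lambda>h. \<bar>h\<bar> < d) (at (0::real))"
      using assms(2) unfolding eventually_at by (intro exI[of _ d]) auto
    moreover have "eventually (\<lambda>h. h \<noteq> 0) (at (0::real))" by (simp add: eventually_at_filter)
    ultimately show "eventually (\<lambda>h. norm (norm (f (x + h)) / norm h) \<le> C * \<bar>h\<bar>) (at 0)"
    proof eventually_elim
      case (elim h)
      have "norm (f (x + h)) \<le> C * \<bar>h\<bar>\<^sup>2" using assms(3)[of "x + h"] elim by simp
      then show ?case using elim by (simp add: field_simps power2_eq_square)
    qed
    have "isCont (\<lambda>h. C * \<bar>h\<bar>) (0::real)" by (intro continuous_intros)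
    then show "((\<lambda>h. C * \<bar>h\<bar>) \<longlongrightarrow> 0) (at (0::real))" by (simp add: isCont_def)
  qed
  then show ?thesis using assms(1) by (simp add: has_vector_derivative_def has_derivative_at)
qed

text \<open>Where \<open>cis \<theta> = 1\<close>, the flatness of \<open>vortex\<close> beats the growth of the factor \<open>Q\<close>, which may
  have an exponential singularity in \<open>disc_log\<close>.\<close>

lemma circ_fun_vector_derivative:
  assumes "circ_poly Q" "a > 0"
  shows "\<exists>Q'. circ_poly Q' \<and> (\<forall>\<theta>. (circ_fun a m Q has_vector_derivative circ_fun a m Q' \<theta>) (at \<theta>))"
proof -
  obtain Q1 where Q1: "circ_poly Q1" "\<And>\<theta>. cis \<theta> \<noteq> 1 \<Longrightarrow>
    ((\<lambda>\<theta>. Q (disc_log (cis \<theta>))) has_vector_derivative Q1 (disc_log (cis \<theta>))) (at \<theta>)"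
    using circ_poly_vector_derivative[OF assms(1)] by blast
  \<comment> \<open>The logarithmic derivative of \<open>vortex (cis \<theta>)\<close> with respect
    to the angle, expressed in \<open>w\<close>.\<close>
  define q where "q w = (-1) * ((2 * w + (- of_real pi) * cot (of_real pi * w)) * circ_log_deriv w)" for w
  have q: "circ_poly q" unfolding q_def[abs_def] by (intro circ_poly.intros circ_poly_log_deriv)
  define R where "R w = of_real ((a + m) / 2) * q w + of_real ((a - m) / 2) * cnj (q w)" for w
  have R: "circ_poly R" unfolding R_def[abs_def] by (intro circ_poly.intros q)
  define Q' where "Q' w = R w * Q w + Q1 w" for w
  have Q': "circ_poly Q'" unfolding Q'_def[abs_def] by (intro circ_poly.intros R assms Q1(1))
  have flat: "(circ_fun a m P has_vector_derivative 0) (at \<theta>)" if P: "circ_poly P" and c1: "cis \<theta> = 1" for \<theta> P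
  proof -
    obtain C k where C: "C \<ge> 0" "k \<ge> 0" "\<And>w. w \<in> near_one_logs \<Longrightarrow> norm (P w) \<le> C * exp (k * \<bar>Re w\<bar>)"
      using circ_poly_growth[OF P] unfolding exp_growth_def by blast
    \<comment> \<open>Raised to the power \<open>a\<close>, the exponent \<open>(k + 2) / a\<close>
      becomes \<open>k + 2\<close>; the growth \<open>t powr (- k)\<close> of \<open>P\<close> then
      leaves \<open>t\<^sup>2\<close>, enough for a vanishing derivative.\<close>
    obtain D where D: "D \<ge> 0" "\<And>z. Re z < 1 \<Longrightarrow> norm (vortex z) \<le> D * norm (1 - z) powr ((k + 2) / a)"
      using vortex_flat[of "(k + 2) / a"] C(2) assms(2) by auto
    show ?thesis
    proof (rule quadratic_bound_vector_derivative)
      show "circ_fun a m P \<theta> = 0" by (simp add: circ_fun_def c1 vortex_1)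
      show "0 < (1/2 :: real)" by simp
      fix y assume y: "\<bar>y - \<theta>\<bar> < 1/2"
      define t where "t = norm (1 - cis y)"
      have "cis y = cis (y - \<theta>)" using c1 by (simp add: cis_divide[symmetric])
      then have ty: "t \<le> \<bar>y - \<theta>\<bar>" using norm_one_minus_cis_le[of "y - \<theta>"] by (simp add: t_def)
      show "norm (circ_fun a m P y) \<le> (D powr a * C) * \<bar>y - \<theta>\<bar>\<^sup>2"
      proof (cases "cis y = 1")
        case True
        then show ?thesis using C D by (simp add: circ_fun_def vortex_1)
      next
        case False
        define w where "w = disc_log (cis y)"
        have t: "t > 0" "t \<le> 1/2" using False ty y by (auto simp: t_def)
        have rw: "Re w = ln t" using disc_log_Re[OF False] by (simp add: w_def t_def)
        have "w \<in> near_one_logs" using False t unfolding near_one_logs_def w_def t_def by blast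
        then have "norm (P w) \<le> C * exp (k * \<bar>Re w\<bar>)" by (rule C(3))
        also have "k * \<bar>Re w\<bar> = - k * ln t" using t by (simp add: rw)
        also have "exp (- k * ln t) = t powr (- k)" using t by (simp add: powr_def)
        finally have 1: "norm (P w) \<le> C * t powr (- k)" .
        have "norm (homog a m (vortex (cis y))) \<le> norm (vortex (cis y)) powr a" by (rule norm_homog_le)
        also have "\<dots> \<le> (D * t powr ((k + 2) / a)) powr a"
          using D(2)[OF cis_Re_less_1[OF False]] assms(2) unfolding t_def by (intro powr_mono2) auto
        also have "\<dots> = D powr a * (t powr ((k + 2) / a)) powr a" by (rule powr_mult; use D in simp)
        also have "(t powr ((k + 2) / a)) powr a = t powr (k + 2)" using assms(2) by (simp add: powr_powr)
        finally have 2: "norm (homog a m (vortex (cis y))) \<le> D powr a * t powr (k + 2)" .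
        have "norm (circ_fun a m P y) \<le> (D powr a * t powr (k + 2)) * (C * t powr (- k))"
          unfolding circ_fun_def norm_mult w_def[symmetric] using 1 2 by (intro mult_mono) auto
        also have "\<dots> = (D powr a * C) * (t powr (k + 2) * t powr (- k))" by simp
        also have "t powr (k + 2) * t powr (- k) = t powr 2" by (simp flip: powr_add)
        also have "\<dots> = t\<^sup>2" using t by (simp add: powr_numeral)
        also have "(D powr a * C) * t\<^sup>2 \<le> (D powr a * C) * \<bar>y - \<theta>\<bar>\<^sup>2"
          using ty t C D by (intro mult_left_mono power_mono) auto
        finally show ?thesis .
      qed
    qed
  qed
  have "(circ_fun a m Q has_vector_derivative circ_fun a m Q' \<theta>) (at \<theta>)" for \<theta>
  proof (cases "cis \<theta> = 1")
    case True
    then show ?thesis using flat[OF assms(1) True] by (simp add: circ_fun_def vortex_1)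
  next
    case False
    define w where "w = disc_log (cis \<theta>)"
    define \<zeta> where "\<zeta> = vortex (cis \<theta>)"
    have z0: "\<zeta> \<noteq> 0" using vortex_cis_nz[OF False] by (simp add: \<zeta>_def)
    have re: "Re (cis \<theta>) < 1" by (rule cis_Re_less_1[OF False])
    have "(vortex has_field_derivative deriv vortex (cis \<theta>)) (at (cis \<theta>))"
      using holomorphic_derivI[OF vortex_holomorphic open_halfspace_Re_lt] re by auto
    from field_vector_diff_chain_at[OF cis_vector_derivative this]
    have h: "((\<lambda>\<theta>. vortex (cis \<theta>)) has_vector_derivative (\<i> * cis \<theta>) * deriv vortex (cis \<theta>)) (at \<theta>)"
      by (simp only: o_def)
    have "deriv vortex (cis \<theta>) = vortex_logd (cis \<theta>) * \<zeta>" using z0 by (simp add: vortex_logd_def \<zeta>_def)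
    moreover have "\<i> * cis \<theta> * vortex_logd (cis \<theta>) = q w"
    proof -
      have "vortex_logd (cis \<theta>) = (2 * w - of_real pi * cot (of_real pi * w)) / exp w"
        using vortex_logd_eq[OF re] z0 exp_disc_log[OF False] by (simp add: w_def \<zeta>_def)
      moreover have "cis \<theta> = 1 - exp w" using exp_disc_log[OF False] by (simp add: w_def)
      moreover have "\<i> * (1 - E) * ((2 * w - P) / E) = (- 1) * ((2 * w + (- P)) * (\<i> + (- \<i>) * inverse E))"
        if "E \<noteq> 0" for E P :: complex using that by (simp add: field_simps)
      ultimately show ?thesis
        by (simp only: q_def circ_log_deriv_def exp_minus exp_not_eq_zero mult_minus_left not_False_eq_True)
    qed
    ultimately have hq: "(\<i> * cis \<theta>) * deriv vortex (cis \<theta>) = q w * \<zeta>" by (metis mult.assoc)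
    have N1: "homog (a - 1) (m - 1) \<zeta> * \<zeta> = homog a m \<zeta>"
      using homog_mult[of "a - 1" "m - 1" \<zeta> 1 1] homog_1_1[OF z0] by simp
    have N2: "homog (a - 1) (m + 1) \<zeta> * cnj \<zeta> = homog a m \<zeta>"
      using homog_mult[of "a - 1" "m + 1" \<zeta> 1 "-1"] cnj_homog[of 1 1 \<zeta>] homog_1_1[OF z0] by simp
    have "((homog a m \<circ> (\<lambda>\<theta>. vortex (cis \<theta>))) has_vector_derivative
       of_real ((a + m) / 2) * homog (a-1) (m-1) \<zeta> * (q w * \<zeta>)
           + of_real ((a - m) / 2) * homog (a-1) (m+1) \<zeta> * cnj (q w * \<zeta>)) (at \<theta>)"
      using vector_derivative_diff_chain_within[OF h has_derivative_at_withinI[OF homog_has_derivative_nz[OF z0[unfolded \<zeta>_def]]]]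
      unfolding hq \<zeta>_def .
    from this[unfolded o_def] have 0: "((\<lambda>\<theta>. homog a m (vortex (cis \<theta>))) has_vector_derivative
       of_real ((a + m) / 2) * homog (a-1) (m-1) \<zeta> * (q w * \<zeta>)
           + of_real ((a - m) / 2) * homog (a-1) (m+1) \<zeta> * cnj (q w * \<zeta>)) (at \<theta>)" .
    have "of_real ((a + m) / 2) * homog (a-1) (m-1) \<zeta> * (q w * \<zeta>)
           + of_real ((a - m) / 2) * homog (a-1) (m+1) \<zeta> * cnj (q w * \<zeta>)
       = of_real ((a + m) / 2) * (homog (a-1) (m-1) \<zeta> * \<zeta>) * q w
           + of_real ((a - m) / 2) * (homog (a-1) (m+1) \<zeta> * cnj \<zeta>) * cnj (q w)"
      by (simp only: complex_cnj_mult mult_ac)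
    also have "\<dots> = homog a m \<zeta> * R w"
      unfolding N1 N2 R_def by (simp only: distrib_left mult_ac)
    finally have 1: "((\<lambda>\<theta>. homog a m (vortex (cis \<theta>))) has_vector_derivative homog a m \<zeta> * R w) (at \<theta>)"
      by (rule has_vector_derivative_eq_rhs[OF 0])
    have "((\<lambda>\<theta>. homog a m (vortex (cis \<theta>)) * Q (disc_log (cis \<theta>))) has_vector_derivative
       homog a m \<zeta> * Q1 w + homog a m \<zeta> * R w * Q w) (at \<theta>)"
      using has_vector_derivative_mult[OF 1 Q1(2)[OF False]] by (simp only: \<zeta>_def w_def)
    moreover have "homog a m \<zeta> * Q1 w + homog a m \<zeta> * R w * Q w = circ_fun a m Q' \<theta>"
      by (simp add: circ_fun_def Q'_def \<zeta>_def w_def algebra_simps)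
    ultimately show ?thesis by (simp only: circ_fun_def[abs_def])
  qed
  with Q' show ?thesis by blast
qed

lemma circ_fun_Ck:
  assumes "a > 0" "circ_poly Q"
  shows "Ck_on k UNIV (circ_fun a m Q)"
  using assms(2)
proof (induction k arbitrary: Q)
  case 0
  obtain Q' where "\<And>\<theta>. (circ_fun a m Q has_vector_derivative circ_fun a m Q' \<theta>) (at \<theta>)"
    using circ_fun_vector_derivative[OF 0 assms(1)] by blast
  then show ?case by (auto intro!: continuous_at_imp_continuous_on has_vector_derivative_continuous)
next
  case (Suc k)
  obtain Q' where Q': "circ_poly Q'" "\<And>\<theta>. (circ_fun a m Q has_vector_derivative circ_fun a m Q' \<theta>) (at \<theta>)"
    using circ_fun_vector_derivative[OF Suc.prems assms(1)] by blast
  have d: "(circ_fun a m Q has_derivative (\<lambda>h. h *\<^sub>R circ_fun a m Q' \<theta>)) (at \<theta>)" for \<theta>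
    using Q'(2) by (simp add: has_vector_derivative_def)
  have "partial 1 (circ_fun a m Q) = circ_fun a m Q'"
    using partial_eq[OF d] by (simp add: fun_eq_iff)
  then show ?case using d Suc.IH[OF Q'(1)] by (auto simp: differentiable_def)
qed

lemma smooth_on_circle_vortex:
  assumes "a > 0"
  shows "smooth_on_circle (\<lambda>z. homog a m (vortex z))"
  using circ_fun_Ck[OF assms circ_poly.intros(1)[of 1], of _ m]
  unfolding smooth_on_circle_def smooth_on_def circ_fun_def by simp

section \<open>Weak derivatives across the zeros\<close>

lemma homog_1_m1: "\<zeta> \<noteq> 0 \<Longrightarrow> homog 1 (-1) \<zeta> = cnj \<zeta>"
  using cnj_homog[of 1 1 \<zeta>] homog_1_1 by simp

text \<open>Two more degrees at the same frequency amount to a factor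
  \<open>|\<zeta>|\<^sup>2\<close>. This makes a singular term differentiable without leaving the
  family.\<close>

lemma homog_square: "homog (c + 2) m \<zeta> = homog c m \<zeta> * (\<zeta> * cnj \<zeta>)"
proof (cases "\<zeta> = 0")
  case False
  have "homog c m \<zeta> * (homog 1 1 \<zeta> * homog 1 (-1) \<zeta>) = homog (c + 2) m \<zeta>"
    by (simp add: homog_mult)
  then show ?thesis using False by (simp add: homog_1_1 homog_1_m1)
qed simp

lemma homog_up_cnj: "homog (c + 1) (m - 1) \<zeta> = homog c m \<zeta> * cnj \<zeta>"
  using homog_mult[of c m \<zeta> 1 "-1"] by (cases "\<zeta> = 0") (auto simp: homog_1_m1)

lemma homog_up: "homog (c + 1) (m + 1) \<zeta> = homog c m \<zeta> * \<zeta>"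
  using homog_mult[of c m \<zeta> 1 1] by (cases "\<zeta> = 0") (auto simp: homog_1_1)

lemma bterm_square: "bterm A B (c + 2) m h z = bterm A B c m h z * (h z * cnj (h z))"
  by (simp add: bterm_def homog_square mult.assoc)

text \<open>The Leibniz rule for \<open>bterm A B c m h\<close> times \<open>|h|\<^sup>2\<close>,
  derived algebraically. It therefore holds at the zeros of \<open>h\<close> too, where the first
  factor need not be differentiable.\<close>

lemma bterm_dz_square:
  "bterm_dz A B (c + 2) m h z = bterm_dz A B c m h z * (h z * cnj (h z)) + bterm A B c m h z * (deriv h z * cnj (h z))"
proof -
  have e1: "homog (c + 2 - 1) (m - 1) (h z) = homog (c - 1) (m - 1) (h z) * (h z * cnj (h z))"
    using homog_square[of "c - 1" "m - 1" "h z"] by (simp add: algebra_simps)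
  have e2: "homog (c - 1) (m - 1) (h z) * (h z * cnj (h z)) = homog c m (h z) * cnj (h z)"
    using homog_up[of "c - 1" "m - 1" "h z"] by simp
  have k: "of_real ((c + 2 + m) / 2) = of_real ((c + m) / 2) + (1 :: complex)"
    by (simp add: add_divide_distrib)
  have T: "bterm (\<lambda>z. A z * deriv h z) B (c + 2 - 1) (m - 1) h z
      = bterm (\<lambda>z. A z * deriv h z) B (c - 1) (m - 1) h z * (h z * cnj (h z))"
    unfolding bterm_def e1 by (simp only: mult.assoc)
  have "A z * deriv h z * cnj (B z) * (homog (c - 1) (m - 1) (h z) * (h z * cnj (h z)))
    = bterm A B c m h z * (deriv h z * cnj (h z))"
    unfolding e2 bterm_def by (simp only: mult_ac)
  then have T2: "bterm (\<lambda>z. A z * deriv h z) B (c - 1) (m - 1) h z * (h z * cnj (h z))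
    = bterm A B c m h z * (deriv h z * cnj (h z))"
    unfolding bterm_def[of "\<lambda>z. A z * deriv h z"] mult.assoc .
  show ?thesis
    unfolding bterm_dz_def bterm_square k T
    by (simp only: distrib_right mult_1 mult.assoc T2 add.assoc)
qed

lemma bterm_dzbar_square:
  "bterm_dzbar A B (c + 2) m h z = bterm_dzbar A B c m h z * (h z * cnj (h z)) + bterm A B c m h z * (h z * cnj (deriv h z))"
proof -
  have e1: "homog (c + 2 - 1) (m + 1) (h z) = homog (c - 1) (m + 1) (h z) * (h z * cnj (h z))"
    using homog_square[of "c - 1" "m + 1" "h z"] by (simp add: algebra_simps)
  have e2: "homog (c - 1) (m + 1) (h z) * (h z * cnj (h z)) = homog c m (h z) * h z"
    using homog_up_cnj[of "c - 1" "m + 1" "h z"] by simp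
  have k: "of_real ((c + 2 - m) / 2) = of_real ((c - m) / 2) + (1 :: complex)"
    by (simp add: add_divide_distrib diff_divide_distrib)
  have T: "bterm A (\<lambda>z. B z * deriv h z) (c + 2 - 1) (m + 1) h z
      = bterm A (\<lambda>z. B z * deriv h z) (c - 1) (m + 1) h z * (h z * cnj (h z))"
    unfolding bterm_def e1 by (simp only: mult.assoc)
  have "A z * cnj (B z * deriv h z) * (homog (c - 1) (m + 1) (h z) * (h z * cnj (h z)))
    = bterm A B c m h z * (h z * cnj (deriv h z))"
    unfolding e2 bterm_def complex_cnj_mult by (simp only: mult_ac)
  then have T2: "bterm A (\<lambda>z. B z * deriv h z) (c - 1) (m + 1) h z * (h z * cnj (h z))
    = bterm A B c m h z * (h z * cnj (deriv h z))"
    unfolding bterm_def[of A "\<lambda>z. B z * deriv h z"] mult.assoc .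
  show ?thesis
    unfolding bterm_dzbar_def bterm_square k T
    by (simp only: distrib_right mult_1 mult.assoc T2 add.assoc)
qed

text \<open>In modulus, a term of degree \<open>c - 1\<close> with the additional factor
  \<open>h'\<close> is a bounded term of degree \<open>c\<close> times \<open>h' / h\<close>.
  Integrability of the logarithmic derivative thus controls singular gradients.\<close>

lemma bterm_lower_bound:
  assumes "bounded_derivs A" "bounded_derivs B" "bounded_derivs h" "c \<ge> 0"
  obtains C where "C \<ge> 0" "\<And>z. z \<in> D2 \<Longrightarrow>
    norm (bterm (\<lambda>z. A z * deriv h z) B (c - 1) m h z) \<le> C * norm (deriv h z / h z)"
    "\<And>z. z \<in> D2 \<Longrightarrow> norm (bterm A (\<lambda>z. B z * deriv h z) (c - 1) m h z) \<le> C * norm (deriv h z / h z)"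
proof -
  obtain C where C: "C \<ge> 0" "\<And>z. z \<in> D2 \<Longrightarrow> norm (bterm A B c (m + 1) h z) \<le> C"
    using bterm_bounded[OF assms] by blast
  have eq: "homog (c - 1) m (h z) = homog c (m + 1) (h z) * inverse (h z)" for z
    using homog_mult[of c "m + 1" "h z" "-1" "-1"] by (simp add: homog_m1_m1)
  have "norm (bterm (\<lambda>z. A z * deriv h z) B (c - 1) m h z) \<le> C * norm (deriv h z / h z)" if "z \<in> D2" for z
  proof -
    have "norm (bterm (\<lambda>z. A z * deriv h z) B (c - 1) m h z) = norm (bterm A B c (m + 1) h z) * norm (deriv h z / h z)"
      by (simp add: bterm_def eq divide_inverse norm_mult)
    then show ?thesis using C that by (simp add: mult_right_mono)
  qed
  moreover have "norm (bterm A (\<lambda>z. B z * deriv h z) (c - 1) m h z) \<le> C * norm (deriv h z / h z)" if "z \<in> D2" for z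
  proof -
    have "norm (bterm A (\<lambda>z. B z * deriv h z) (c - 1) m h z) = norm (bterm A B c (m + 1) h z) * norm (deriv h z / h z)"
      by (simp add: bterm_def eq divide_inverse norm_mult)
    then show ?thesis using C that by (simp add: mult_right_mono)
  qed
  ultimately show ?thesis using that C(1) by blast
qed

lemma bterm_wirtinger_bound:
  assumes "bounded_derivs A" "bounded_derivs B" "bounded_derivs h" "c \<ge> 0"
  obtains C where "C \<ge> 0"
    "\<And>z. z \<in> D2 \<Longrightarrow> norm (bterm_dz A B c m h z) \<le> C * (1 + norm (deriv h z / h z))"
    "\<And>z. z \<in> D2 \<Longrightarrow> norm (bterm_dzbar A B c m h z) \<le> C * (1 + norm (deriv h z / h z))"
proof -
  obtain C1 where C1: "C1 \<ge> 0" "\<And>z. z \<in> D2 \<Longrightarrow> norm (bterm (deriv A) B c m h z) \<le> C1"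
    using bterm_bounded[OF bounded_derivs_deriv[OF assms(1)] assms(2-4)] by blast
  obtain C2 where C2: "C2 \<ge> 0" "\<And>z. z \<in> D2 \<Longrightarrow> norm (bterm A (deriv B) c m h z) \<le> C2"
    using bterm_bounded[OF assms(1) bounded_derivs_deriv[OF assms(2)] assms(3-4)] by blast
  obtain C3 where C3: "C3 \<ge> 0" "\<And>z. z \<in> D2 \<Longrightarrow>
    norm (bterm (\<lambda>z. A z * deriv h z) B (c - 1) (m - 1) h z) \<le> C3 * norm (deriv h z / h z)"
    using bterm_lower_bound[OF assms] by metis
  obtain C4 where C4: "C4 \<ge> 0" "\<And>z. z \<in> D2 \<Longrightarrow>
    norm (bterm A (\<lambda>z. B z * deriv h z) (c - 1) (m + 1) h z) \<le> C4 * norm (deriv h z / h z)"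
    using bterm_lower_bound[OF assms] by metis
  define k l where "k = \<bar>(c + m) / 2\<bar>" "l = \<bar>(c - m) / 2\<bar>"
  define C where "C = C1 + C2 + k * C3 + l * C4"
  have kl: "k \<ge> 0" "l \<ge> 0" "k * C3 \<ge> 0" "l * C4 \<ge> 0" using C3 C4 by (auto simp: k_l_def)
  have Cge: "C1 \<le> C" "C2 \<le> C" "k * C3 \<le> C" "l * C4 \<le> C" "C \<ge> 0" using kl C1 C2 by (auto simp: C_def)
  have 1: "norm (bterm_dz A B c m h z) \<le> C * (1 + norm (deriv h z / h z))" if z: "z \<in> D2" for z
  proof -
    have "norm (bterm_dz A B c m h z) \<le> C1 + k * (C3 * norm (deriv h z / h z))"
      unfolding bterm_dz_def using C1(2)[OF z] C3(2)[OF z] kl(1)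
      by (intro order_trans[OF norm_triangle_ineq] add_mono)
        (simp_all only: norm_mult norm_of_real k_l_def mult_left_mono abs_ge_zero)
    also have "\<dots> \<le> C + C * norm (deriv h z / h z)"
      unfolding mult.assoc[symmetric] using Cge by (intro add_mono mult_right_mono) auto
    finally show ?thesis by (simp add: distrib_left)
  qed
  have 2: "norm (bterm_dzbar A B c m h z) \<le> C * (1 + norm (deriv h z / h z))" if z: "z \<in> D2" for z
  proof -
    have "norm (bterm_dzbar A B c m h z) \<le> C2 + l * (C4 * norm (deriv h z / h z))"
      unfolding bterm_dzbar_def using C2(2)[OF z] C4(2)[OF z] kl(2)
      by (intro order_trans[OF norm_triangle_ineq] add_mono)
        (simp_all only: norm_mult norm_of_real k_l_def mult_left_mono abs_ge_zero)
    also have "\<dots> \<le> C + C * norm (deriv h z / h z)"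
      unfolding mult.assoc[symmetric] using Cge by (intro add_mono mult_right_mono) auto
    finally show ?thesis by (simp add: distrib_left)
  qed
  from that[OF Cge(5) 1 2] show ?thesis .
qed

lemma bterm_continuous_on:
  assumes "A holomorphic_on S" "B holomorphic_on S" "h holomorphic_on S" "c > 0"
  shows "continuous_on S (bterm A B c m h)"
  unfolding bterm_def[abs_def]
  using assms by (intro continuous_intros continuous_on_compose2[OF continuous_on_homog[of c UNIV m]])
    (auto intro: holomorphic_on_imp_continuous_on)

text \<open>The possibly singular function \<open>v\<close> is replaced by \<open>v * |h|\<^sup>2 / (|h|\<^sup>2 + \<epsilon>)\<close>, which is
  continuously differentiable; the error term is dominated by \<open>|v| * |h' / h|\<close> and vanishes in the limit.\<close>

lemma weak_gradient_bterm:
  fixes m :: int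
  assumes A: "bounded_derivs A" and B: "bounded_derivs B" and h: "bounded_derivs h" and c: "c \<ge> 0"
    and L1: "set_integrable lborel D2 (\<lambda>z. norm (deriv h z / h z))"
    and phi: "\<phi> \<in> test_functions D2" and b: "b \<in> Basis"
  defines "v \<equiv> bterm A B c m h"
    and "V \<equiv> (\<lambda>z. bterm_dz A B c m h z * b + bterm_dzbar A B c m h z * cnj b)"
  shows "(LINT z:D2|lborel. \<phi> z *\<^sub>R V z) = - (LINT z:D2|lborel. partial b \<phi> z *\<^sub>R v z)"
    and "set_integrable lborel D2 (\<lambda>z. \<phi> z *\<^sub>R V z)"
    and "set_integrable lborel D2 (\<lambda>z. partial b \<phi> z *\<^sub>R v z)"
proof -
  note hol = bounded_derivs_holomorphic[OF A] bounded_derivs_holomorphic[OF B] bounded_derivs_holomorphic[OF h]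
  have h': "deriv h holomorphic_on D2" "deriv A holomorphic_on D2" "deriv B holomorphic_on D2"
    using hol by (auto intro!: holomorphic_deriv)
  define R where "R z = h z * cnj (h z)" for z
  have Rr: "R z = of_real ((norm (h z))\<^sup>2)" for z unfolding R_def by (rule complex_norm_square[symmetric])
  define e where "e n = 1 / real (Suc n)" for n
  have e0: "e n > 0" for n by (simp add: e_def)
  have elim: "e \<longlonglongrightarrow> 0" unfolding e_def using LIMSEQ_inverse_real_of_nat by (simp add: inverse_eq_divide)
  define S where "S n z = R z + of_real (e n)" for n z
  have Sr: "S n z = of_real ((norm (h z))\<^sup>2 + e n)" for n z by (simp add: S_def Rr)
  have nS: "norm (S n z) = (norm (h z))\<^sup>2 + e n" for n z
    unfolding Sr norm_of_real using e0[of n] by (intro abs_of_nonneg add_nonneg_nonneg) auto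
  have S0: "S n z \<noteq> 0" for n z using nS[of n z] e0[of n] by (metis add_nonneg_eq_0_iff less_imp_le less_numeral_extra(3) norm_zero zero_le_power2)
  \<comment> \<open>The degree \<open>c + 2\<close> exceeds \<open>1\<close>, so
    \<open>W = v * |h|\<^sup>2\<close> is differentiable also at the zeros; \<open>W / S n\<close>
    is the regularisation of \<open>v\<close>.\<close>
  define W where "W = bterm A B (c + 2) m h"
  define W1 where "W1 = bterm_dz A B (c + 2) m h"
  define W2 where "W2 = bterm_dzbar A B (c + 2) m h"
  define F1 where "F1 n z = (W1 z * S n z - W z * (deriv h z * cnj (h z))) / (S n z)\<^sup>2" for n z
  define F2 where "F2 n z = (W2 z * S n z - W z * (h z * cnj (deriv h z))) / (S n z)\<^sup>2" for n z
  define vn where "vn n z = W z / S n z" for n z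
  have d: "(vn n has_derivative (\<lambda>k. F1 n z * k + F2 n z * cnj k)) (at z)" if z: "z \<in> D2" for n z
  proof -
    have dW: "(W has_derivative (\<lambda>k. W1 z * k + W2 z * cnj k)) (at z)"
      unfolding W_def W1_def W2_def using hol z c by (intro bterm_has_derivative[of _ D2]) auto
    note dh = holomorphic_has_derivative[OF hol(3) open_ball z]
    have dS: "(S n has_derivative (\<lambda>k. h z * cnj (deriv h z * k) + deriv h z * k * cnj (h z))) (at z)"
      unfolding S_def[abs_def] R_def
      by (rule has_derivative_eq_rhs[OF has_derivative_add[OF has_derivative_mult[OF dh
        bounded_linear.has_derivative[OF bounded_linear_cnj dh]] has_derivative_const]]) simp
    have "(vn n has_derivative (\<lambda>k. - W z * (inverse (S n z) * (h z * cnj (deriv h z * k) + deriv h z * k * cnj (h z)) * inverse (S n z))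
        + (W1 z * k + W2 z * cnj k) / S n z)) (at z)"
      unfolding vn_def[abs_def] by (rule has_derivative_divide[OF dW dS S0])
    moreover have "- w * (inverse s * (hz * cnj (dh * k) + dh * k * cnj hz) * inverse s) + (w1 * k + w2 * cnj k) / s
       = (w1 * s - w * (dh * cnj hz)) / s\<^sup>2 * k + (w2 * s - w * (hz * cnj dh)) / s\<^sup>2 * cnj k" if "s \<noteq> 0" for w s hz dh k w1 w2 :: complex
      using that by (simp add: divide_simps power2_eq_square) (simp add: algebra_simps)
    ultimately show ?thesis unfolding F1_def F2_def using S0 by (simp only: not_False_eq_True)
  qed
  have hc: "continuous_on D2 h" "continuous_on D2 (deriv h)"
    using hol h' by (auto intro: holomorphic_on_imp_continuous_on)
  have Sc: "continuous_on D2 (S n)" for n unfolding S_def[abs_def] R_def by (intro continuous_intros hc)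
  have Wc: "continuous_on D2 W" unfolding W_def using hol c by (intro bterm_continuous_on) auto
  have W1c: "continuous_on D2 W1" unfolding W1_def bterm_dz_def[abs_def]
    using hol h' c by (intro continuous_intros bterm_continuous_on holomorphic_on_mult) auto
  have W2c: "continuous_on D2 W2" unfolding W2_def bterm_dzbar_def[abs_def]
    using hol h' c by (intro continuous_intros bterm_continuous_on holomorphic_on_mult) auto
  have F1c: "continuous_on D2 (F1 n)" for n unfolding F1_def[abs_def]
    using S0 by (intro continuous_intros W1c Wc Sc hc) auto
  have F2c: "continuous_on D2 (F2 n)" for n unfolding F2_def[abs_def]
    using S0 by (intro continuous_intros W2c Wc Sc hc) auto
  note ibp = integral_by_parts_test[OF phi open_ball d F1c F2c b]
  define f where "f z = norm (deriv h z / h z)" for z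
  have alg: "((d * r + u * w) * s - u * r * w) / s\<^sup>2 = d * (r / s) + u * (w * t / s\<^sup>2)"
    if "s \<noteq> 0" "s = r + t" for d r u w s t :: complex
  proof -
    have "(d * r + u * w) * s - u * r * w = d * r * s + u * w * t" unfolding that(2) by (simp add: algebra_simps)
    then show ?thesis using that(1) by (simp add: add_divide_distrib power2_eq_square)
  qed
  \<comment> \<open>The formal derivative of \<open>v\<close> times \<open>R / S n\<close>, which
    tends to \<open>1\<close> off the zeros, plus an error carrying the factor
    \<open>e n\<close>.\<close>
  have F1e: "F1 n z = bterm_dz A B c m h z * (R z / S n z) + v z * (deriv h z * cnj (h z) * of_real (e n) / (S n z)\<^sup>2)" for n z
    unfolding F1_def W1_def W_def bterm_dz_square bterm_square R_def[symmetric] v_def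
    by (rule alg[OF S0]) (simp add: S_def)
  have F2e: "F2 n z = bterm_dzbar A B c m h z * (R z / S n z) + v z * (h z * cnj (deriv h z) * of_real (e n) / (S n z)\<^sup>2)" for n z
    unfolding F2_def W2_def W_def bterm_dzbar_square bterm_square R_def[symmetric] v_def
    by (rule alg[OF S0]) (simp add: S_def)
  have vne: "vn n z = v z * (R z / S n z)" for n z
    unfolding vn_def W_def bterm_square v_def R_def by simp
  have RS: "norm (R z / S n z) \<le> 1" for n z
  proof -
    have "0 < (norm (h z))\<^sup>2 + e n" using e0[of n] by (simp add: add_nonneg_pos)
    then show ?thesis unfolding norm_divide nS Rr norm_of_real using e0[of n] by (simp add: divide_le_eq_1)
  qed
  have hz0: "v z = 0" "bterm_dz A B c m h z = 0" "bterm_dzbar A B c m h z = 0" if "h z = 0" for z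
    using that by (auto simp: v_def bterm_def bterm_dz_def bterm_dzbar_def)
  \<comment> \<open>The product \<open>|h|\<^sup>2 * e n\<close> occurs in the expansion of the
    squared denominator, so the error factor is at most \<open>|h' / h|\<close>, uniformly in
    \<open>n\<close>.\<close>
  have kb: "norm (h z) * norm (deriv h z) * e n / (norm (S n z))\<^sup>2 \<le> f z" for n z
  proof (cases "h z = 0")
    case False
    have "(norm (h z))\<^sup>2 * e n \<le> (norm (S n z))\<^sup>2"
    proof -
      have "(norm (S n z))\<^sup>2 = (norm (h z))\<^sup>2 * e n + ((norm (h z))\<^sup>2 * (norm (h z))\<^sup>2 + (norm (h z))\<^sup>2 * e n + e n * e n)"
        unfolding nS by (simp add: power2_sum) (simp add: power2_eq_square algebra_simps)
      moreover have "0 \<le> (norm (h z))\<^sup>2 * (norm (h z))\<^sup>2 + (norm (h z))\<^sup>2 * e n + e n * e n"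
        using e0[of n] by (intro add_nonneg_nonneg mult_nonneg_nonneg) auto
      ultimately show ?thesis by linarith
    qed
    then have "((norm (h z))\<^sup>2 * e n) * f z / (norm (S n z))\<^sup>2 \<le> (norm (S n z))\<^sup>2 * f z / (norm (S n z))\<^sup>2"
      by (intro divide_right_mono mult_right_mono) (auto simp: f_def)
    moreover have "(norm (h z))\<^sup>2 * e n * f z = norm (h z) * norm (deriv h z) * e n"
      using False by (simp add: f_def norm_divide power2_eq_square)
    ultimately show ?thesis using S0 by simp
  qed (simp add: f_def)
  have klim: "(\<lambda>n. of_real (e n) / (S n z)\<^sup>2) \<longlonglongrightarrow> 0" "(\<lambda>n. R z / S n z) \<longlonglongrightarrow> 1" if "h z \<noteq> 0" for z
  proof -
    have R0: "R z \<noteq> 0" using that by (simp add: R_def)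
    have "(\<lambda>n. of_real (e n) :: complex) \<longlonglongrightarrow> of_real 0" using elim by (rule tendsto_of_real)
    then have el: "(\<lambda>n. of_real (e n) :: complex) \<longlonglongrightarrow> 0" by simp
    have Sl: "(\<lambda>n. S n z) \<longlonglongrightarrow> R z" unfolding S_def using tendsto_add[OF tendsto_const el, of "R z"] by simp
    show "(\<lambda>n. of_real (e n) / (S n z)\<^sup>2) \<longlonglongrightarrow> 0"
      using tendsto_divide[OF el tendsto_power[OF Sl, of 2]] R0 by simp
    show "(\<lambda>n. R z / S n z) \<longlonglongrightarrow> 1"
      using tendsto_divide[OF tendsto_const Sl R0, of "R z"] R0 by simp
  qed
  obtain C where C: "C \<ge> 0" "\<And>z. z \<in> D2 \<Longrightarrow> norm (bterm_dz A B c m h z) \<le> C * (1 + f z)"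
    "\<And>z. z \<in> D2 \<Longrightarrow> norm (bterm_dzbar A B c m h z) \<le> C * (1 + f z)"
    using bterm_wirtinger_bound[OF A B h c] unfolding f_def by metis
  obtain Cv where Cv: "Cv \<ge> 0" "\<And>z. z \<in> D2 \<Longrightarrow> norm (v z) \<le> Cv"
    using bterm_bounded[OF A B h c] unfolding v_def by metis
  obtain M where M: "M \<ge> 0" "\<And>z. \<bar>\<phi> z\<bar> \<le> M" "\<And>z. \<bar>partial 1 \<phi> z\<bar> \<le> M" "\<And>z. \<bar>partial \<i> \<phi> z\<bar> \<le> M"
    using test_function_bounds[OF phi] by metis
  have Mb: "\<bar>partial b \<phi> z\<bar> \<le> M" for z using M b by (auto simp: Basis_complex_def)
  have nb: "norm b = 1" using b by simp
  have f0: "f z \<ge> 0" for z by (simp add: f_def)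
  have F1b: "norm (F1 n z) \<le> C * (1 + f z) + Cv * f z" if z: "z \<in> D2" for n z
  proof -
    have "norm (v z * (deriv h z * cnj (h z) * of_real (e n) / (S n z)\<^sup>2)) \<le> Cv * f z"
      unfolding norm_mult[of "v z"] using Cv z kb[of z n] e0[of n] f0[of z]
      by (intro mult_mono) (auto simp: norm_mult norm_divide norm_power mult_ac)
    moreover have "norm (bterm_dz A B c m h z * (R z / S n z)) \<le> C * (1 + f z) * 1"
      unfolding norm_mult[of "bterm_dz A B c m h z"] using C z RS f0[of z] by (intro mult_mono) auto
    ultimately show ?thesis unfolding F1e by (intro order_trans[OF norm_triangle_ineq]) simp
  qed
  have F2b: "norm (F2 n z) \<le> C * (1 + f z) + Cv * f z" if z: "z \<in> D2" for n z
  proof -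
    have "norm (v z * (h z * cnj (deriv h z) * of_real (e n) / (S n z)\<^sup>2)) \<le> Cv * f z"
      unfolding norm_mult[of "v z"] using Cv z kb[of z n] e0[of n] f0[of z]
      by (intro mult_mono) (auto simp: norm_mult norm_divide norm_power mult_ac)
    moreover have "norm (bterm_dzbar A B c m h z * (R z / S n z)) \<le> C * (1 + f z) * 1"
      unfolding norm_mult[of "bterm_dzbar A B c m h z"] using C z RS f0[of z] by (intro mult_mono) auto
    ultimately show ?thesis unfolding F2e by (intro order_trans[OF norm_triangle_ineq]) simp
  qed
  define s where "s n z = indicator D2 z *\<^sub>R (\<phi> z *\<^sub>R (F1 n z * b + F2 n z * cnj b))" for n z
  define t where "t n z = indicator D2 z *\<^sub>R (partial b \<phi> z *\<^sub>R vn n z)" for n z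
  have si: "integrable lborel (s n)" "integrable lborel (t n)" for n
    using ibp(2,3)[of n] unfolding s_def[abs_def] t_def[abs_def] set_integrable_def by auto
  have slim: "(\<lambda>n. s n z) \<longlonglongrightarrow> indicator D2 z *\<^sub>R (\<phi> z *\<^sub>R V z)" for z
  proof (cases "h z = 0")
    case True
    then show ?thesis using hz0[OF True] by (simp add: s_def V_def F1e F2e)
  next
    case False
    have 1: "(\<lambda>n. F1 n z) \<longlonglongrightarrow> bterm_dz A B c m h z * 1 + v z * (deriv h z * cnj (h z) * 0)"
      unfolding F1e times_divide_eq_right[symmetric, of "deriv h z * cnj (h z)"]
      by (intro tendsto_intros klim False)
    have 2: "(\<lambda>n. F2 n z) \<longlonglongrightarrow> bterm_dzbar A B c m h z * 1 + v z * (h z * cnj (deriv h z) * 0)"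
      unfolding F2e times_divide_eq_right[symmetric, of "h z * cnj (deriv h z)"]
      by (intro tendsto_intros klim False)
    show ?thesis unfolding s_def V_def using 1 2 by (intro tendsto_intros) simp_all
  qed
  have tlim: "(\<lambda>n. t n z) \<longlonglongrightarrow> indicator D2 z *\<^sub>R (partial b \<phi> z *\<^sub>R v z)" for z
  proof (cases "h z = 0")
    case True
    then show ?thesis using hz0[OF True] by (simp add: t_def vne)
  next
    case False
    have "(\<lambda>n. vn n z) \<longlonglongrightarrow> v z * 1"
      unfolding vne by (intro tendsto_intros klim False)
    then show ?thesis unfolding t_def by (intro tendsto_intros) simp_all
  qed
  define ws where "ws z = M * (2 * (C * indicator D2 z + (C + Cv) * (indicator D2 z *\<^sub>R f z)))" for z
  have i1: "integrable lborel (\<lambda>z. indicator D2 z :: real)"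
    by (rule integrable_real_indicator) (use emeasure_ball_complex[of 1 0] in auto)
  have fi: "integrable lborel (\<lambda>z. indicator D2 z *\<^sub>R f z)"
    using L1 unfolding set_integrable_def f_def .
  have wsi: "integrable lborel ws"
    unfolding ws_def[abs_def] using i1 fi
    by (intro integrable_mult_right Bochner_Integration.integrable_add)
  have sb: "norm (s n z) \<le> ws z" for n z
  proof (cases "z \<in> D2")
    case True
    have "norm (F1 n z * b + F2 n z * cnj b) \<le> norm (F1 n z) + norm (F2 n z)"
      using norm_triangle_ineq[of "F1 n z * b" "F2 n z * cnj b"] nb by (simp add: norm_mult)
    also have "\<dots> \<le> 2 * (C + (C + Cv) * f z)"
      using F1b[OF True, of n] F2b[OF True, of n] by (simp add: algebra_simps)
    finally have "\<bar>\<phi> z\<bar> * norm (F1 n z * b + F2 n z * cnj b) \<le> M * (2 * (C + (C + Cv) * f z))"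
      using M by (intro mult_mono) auto
    then show ?thesis using True by (simp add: s_def ws_def)
  qed (simp add: s_def ws_def)
  define wt where "wt z = M * Cv * indicator D2 z" for z :: complex
  have wti: "integrable lborel wt" unfolding wt_def[abs_def] by (intro integrable_mult_right i1)
  have tb: "norm (t n z) \<le> wt z" for n z
  proof (cases "z \<in> D2")
    case True
    have "norm (vn n z) \<le> Cv * 1"
      unfolding vne norm_mult using Cv True RS by (intro mult_mono) auto
    then have "\<bar>partial b \<phi> z\<bar> * norm (vn n z) \<le> M * Cv" using Mb M by (intro mult_mono) auto
    then show ?thesis using True by (simp add: t_def wt_def)
  qed (simp add: t_def wt_def)
  have sm: "s n \<in> borel_measurable lborel" "t n \<in> borel_measurable lborel" for n using si by auto
  have lm: "(\<lambda>z. indicator D2 z *\<^sub>R (\<phi> z *\<^sub>R V z)) \<in> borel_measurable lborel"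
    by (rule borel_measurable_LIMSEQ_metric[OF sm(1) slim])
  have lt: "(\<lambda>z. indicator D2 z *\<^sub>R (partial b \<phi> z *\<^sub>R v z)) \<in> borel_measurable lborel"
    by (rule borel_measurable_LIMSEQ_metric[OF sm(2) tlim])
  show "set_integrable lborel D2 (\<lambda>z. \<phi> z *\<^sub>R V z)" unfolding set_integrable_def
    by (rule integrable_dominated_convergence[OF lm sm(1) wsi AE_I2[OF slim] AE_I2[OF sb]])
  show "set_integrable lborel D2 (\<lambda>z. partial b \<phi> z *\<^sub>R v z)" unfolding set_integrable_def
    by (rule integrable_dominated_convergence[OF lt sm(2) wti AE_I2[OF tlim] AE_I2[OF tb]])
  have l1: "(\<lambda>n. integral\<^sup>L lborel (s n)) \<longlonglongrightarrow> (LINT z:D2|lborel. \<phi> z *\<^sub>R V z)"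
    unfolding set_lebesgue_integral_def
    by (rule integral_dominated_convergence[OF lm sm(1) wsi AE_I2[OF slim] AE_I2[OF sb]])
  have l2: "(\<lambda>n. integral\<^sup>L lborel (t n)) \<longlonglongrightarrow> (LINT z:D2|lborel. partial b \<phi> z *\<^sub>R v z)"
    unfolding set_lebesgue_integral_def
    by (rule integral_dominated_convergence[OF lt sm(2) wti AE_I2[OF tlim] AE_I2[OF tb]])
  have "integral\<^sup>L lborel (s n) = - integral\<^sup>L lborel (t n)" for n
    using ibp(1)[of n] unfolding s_def[abs_def] t_def[abs_def] set_lebesgue_integral_def .
  then have "(\<lambda>n. integral\<^sup>L lborel (s n)) \<longlonglongrightarrow> - (LINT z:D2|lborel. partial b \<phi> z *\<^sub>R v z)"
    using tendsto_minus[OF l2] by simp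
  then show "(LINT z:D2|lborel. \<phi> z *\<^sub>R V z) = - (LINT z:D2|lborel. partial b \<phi> z *\<^sub>R v z)"
    using LIMSEQ_unique[OF l1] by blast
qed

section \<open>The vortices\<close>

lemma vortex_hol: "vortex holomorphic_on D2"
  by (rule bounded_derivs_holomorphic[OF bounded_derivs_vortex])

lemma vortex_zero_iff: "z \<in> D2 \<Longrightarrow> vortex z = 0 \<longleftrightarrow> z \<in> range vortex_pt"
  using vortex_eq_0_iff[of z] by (cases "z = 1") auto

lemma vortex_DERIV: "z \<in> D2 \<Longrightarrow> (vortex has_field_derivative deriv vortex z) (at z)"
  using holomorphic_derivI[OF vortex_hol open_ball] by simp

text \<open>By the identity theorem, zeros accumulating inside the disc would force \<open>H\<close>
  to vanish identically, against its nonzero derivative at \<open>w\<close>.\<close>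

lemma isolated_zeros_D2:
  assumes H: "H holomorphic_on D2" and w: "w \<in> D2" "deriv H w \<noteq> 0" and Z: "Z \<subseteq> {z \<in> D2. H z = 0}"
  shows "isolated_points_in D2 Z"
  unfolding isolated_points_in_def
proof (intro conjI ballI notI)
  show "Z \<subseteq> D2" using Z by auto
  fix z assume z: "z \<in> D2" "z islimpt Z"
  have H0: "H x = 0" if "x \<in> D2" for x
    by (rule analytic_continuation[OF H open_ball _ \<open>Z \<subseteq> D2\<close> z(1) z(2) _ that]) (use Z in auto)
  have "eventually (\<lambda>x. H x = 0) (nhds w)"
    by (rule eventually_mono[OF eventually_nhds_in_open[OF open_ball w(1)]]) (rule H0)
  then have "deriv H w = deriv (\<lambda>_. 0) w" by (rule deriv_cong_ev) simp
  then show False using w by simp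
qed

lemma vortex_pt_isolated: "isolated_points_in D2 (range vortex_pt)"
  by (rule isolated_zeros_D2[OF vortex_hol vortex_pt_in_D2 deriv_vortex_pt])
    (use vortex_pt_in_D2 vortex_zero_iff in auto)

text \<open>Zeros are divided out one at a time as removable singularities. The logarithmic
  derivative splits into \<open>n\<close> simple poles and that of the cofactor, which reduces
  questions on compact subsets to finitely many poles.\<close>

lemma vortex_factorization:
  "\<exists>k. k holomorphic_on D2 \<and> (\<forall>z\<in>D2. vortex z = (\<Prod>i<n. z - vortex_pt i) * k z \<and>
     (vortex z \<noteq> 0 \<longrightarrow> vortex_logd z = (\<Sum>i<n. inverse (z - vortex_pt i)) + deriv k z / k z))"
proof (induction n)
  case 0
  show ?case by (intro exI[of _ vortex]) (auto simp: vortex_hol vortex_logd_def)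
next
  case (Suc n)
  then obtain k where k: "k holomorphic_on D2" "\<And>z. z \<in> D2 \<Longrightarrow> vortex z = (\<Prod>i<n. z - vortex_pt i) * k z"
    "\<And>z. z \<in> D2 \<Longrightarrow> vortex z \<noteq> 0 \<Longrightarrow> vortex_logd z = (\<Sum>i<n. inverse (z - vortex_pt i)) + deriv k z / k z" by blast
  define q where "q = vortex_pt n"
  have q: "q \<in> D2" using vortex_pt_in_D2 by (simp add: q_def)
  have "(\<Prod>i<n. q - vortex_pt i) \<noteq> 0"
    using inj_vortex_pt by (auto simp: q_def inj_def)
  moreover have "vortex q = 0" using vortex_zero_iff[OF q] by (simp add: q_def)
  ultimately have kq: "k q = 0" using k(2)[OF q] by simp
  define l where "l z = (if z = q then deriv k q else (k z - k q) / (z - q))" for z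
  have l: "l holomorphic_on D2" unfolding l_def[abs_def] by (rule pole_lemma_open[OF k(1)]) simp
  have kl: "k z = (z - q) * l z" for z using kq by (simp add: l_def)
  have 1: "vortex z = (\<Prod>i<Suc n. z - vortex_pt i) * l z" if "z \<in> D2" for z
    using k(2)[OF that] kl[of z] by (simp add: q_def)
  have 2: "vortex_logd z = (\<Sum>i<Suc n. inverse (z - vortex_pt i)) + deriv l z / l z"
    if z: "z \<in> D2" "vortex z \<noteq> 0" for z
  proof -
    have nz: "z - q \<noteq> 0" "l z \<noteq> 0" using z 1[OF z(1)] by (auto simp: q_def)
    have "((\<lambda>z. (z - q) * l z) has_field_derivative l z + (z - q) * deriv l z) (at z)"
      using holomorphic_derivI[OF l open_ball z(1), of UNIV] by (auto intro!: derivative_eq_intros)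
    moreover have "k = (\<lambda>z. (z - q) * l z)" using kl by auto
    ultimately have "deriv k z = l z + (z - q) * deriv l z" using DERIV_imp_deriv by blast
    then have "deriv k z / k z = inverse (z - q) + deriv l z / l z"
      using nz by (simp add: kl field_simps)
    then show ?thesis using k(3)[OF z] by (simp add: q_def)
  qed
  show ?case using l 1 2 by blast
qed

text \<open>A zero of the cofactor is a zero of \<open>vortex\<close>, so outside the tail it is one
  of the divided points; there it would make \<open>vortex\<close> vanish to second order, contrary
  to simplicity.\<close>

lemma vortex_cofactor_nz:
  assumes k: "k holomorphic_on D2" "\<And>z. z \<in> D2 \<Longrightarrow> vortex z = (\<Prod>i<n. z - vortex_pt i) * k z"
    and z: "z \<in> D2" "z \<notin> vortex_pt ` {n..}"
  shows "k z \<noteq> 0"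
proof
  assume kz: "k z = 0"
  then have "vortex z = 0" using k(2)[OF z(1)] by simp
  then obtain i where i: "z = vortex_pt i" using vortex_zero_iff[OF z(1)] by auto
  then have "i < n" using z(2) by (metis atLeast_iff imageI not_le)
  define P where "P w = (\<Prod>i<n. w - vortex_pt i)" for w
  have Pz: "P z = 0" using \<open>i < n\<close> i by (auto simp: P_def)
  have Pd: "P field_differentiable at z" unfolding P_def[abs_def]
    by (rule holomorphic_on_imp_differentiable_at[of _ UNIV]) (auto intro!: holomorphic_intros)
  have "((\<lambda>w. P w * k w) has_field_derivative P z * deriv k z + deriv P z * k z) (at z)"
    using DERIV_mult[OF field_differentiable_derivI[OF Pd] holomorphic_derivI[OF k(1) open_ball z(1), of UNIV]]
    by (simp add: add.commute mult.commute)
  then have "((\<lambda>w. P w * k w) has_field_derivative 0) (at z)" by (simp add: Pz kz)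
  then have "(vortex has_field_derivative 0) (at z)"
    by (rule has_field_derivative_transform_within_open[OF _ open_ball z(1)]) (use k(2) in \<open>simp add: P_def\<close>)
  then have "deriv vortex z = 0" by (rule DERIV_imp_deriv)
  then show False using deriv_vortex_pt i by simp
qed

lemma compact_avoids_vortex_tail:
  assumes "compact K" "K \<subseteq> D2"
  obtains n where "K \<inter> vortex_pt ` {n..} = {}"
proof -
  have "1 \<in> - K" using assms by auto
  moreover have "open (- K)" using assms by (simp add: compact_imp_closed open_Compl)
  ultimately have "eventually (\<lambda>i. vortex_pt i \<in> - K) sequentially"
    by (intro topological_tendstoD[OF vortex_pt_tendsto])
  then obtain n where "\<And>i. i \<ge> n \<Longrightarrow> vortex_pt i \<in> - K" unfolding eventually_sequentially by blast
  with that show ?thesis by force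
qed

lemma AE_not_vortex_pt: "AE z in lborel. z \<notin> range vortex_pt"
  by (rule AE_not_in[OF countable_imp_null_set_lborel]) simp

lemma vortex_logd_integrable_L1: "set_integrable lborel D2 (\<lambda>z. norm (deriv vortex z / vortex z))"
proof -
  have "set_integrable lborel D2 (\<lambda>z. norm (vortex_logd z) powr 1)" by (rule vortex_logd_Lp) auto
  then show ?thesis by (simp add: vortex_logd_def)
qed

text \<open>The support of a test function meets finitely many vortices. Each simple pole yields a
  Dirac mass through the Cauchy kernel; the logarithmic derivative of the cofactor is holomorphic
  near the support and contributes nothing.\<close>

lemma
  assumes phi: "\<phi> \<in> test_functions D2"
  shows integrable_dbar_logd: "set_integrable lborel D2 (\<lambda>z. dbar \<phi> z * vortex_logd z)"
    and integral_dbar_logd: "\<exists>n. (\<forall>i\<ge>n. \<phi> (vortex_pt i) = 0) \<and>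
      (LINT z:D2|lborel. dbar \<phi> z * vortex_logd z) = - (2 * pi * (\<Sum>i<n. \<phi> (vortex_pt i)))"
proof -
  obtain K where K: "compact K" "K \<subseteq> D2" "\<And>z. z \<notin> K \<Longrightarrow> \<phi> z = 0" "\<And>b z. z \<notin> K \<Longrightarrow> partial b \<phi> z = 0"
    using test_functionE[OF phi] by metis
  obtain n where n: "K \<inter> vortex_pt ` {n..} = {}" using compact_avoids_vortex_tail[OF K(1,2)] by blast
  obtain k where k: "k holomorphic_on D2" "\<And>z. z \<in> D2 \<Longrightarrow> vortex z = (\<Prod>i<n. z - vortex_pt i) * k z"
    "\<And>z. z \<in> D2 \<Longrightarrow> vortex z \<noteq> 0 \<Longrightarrow> vortex_logd z = (\<Sum>i<n. inverse (z - vortex_pt i)) + deriv k z / k z"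
    using vortex_factorization by metis
  \<comment> \<open>The support lies in this smaller open set, so \<open>\<phi>\<close> is a test
    function on it, and the remaining term is holomorphic there.\<close>
  define \<Omega> where "\<Omega> = {z \<in> D2. k z \<noteq> 0}"
  have O: "open \<Omega>"
  proof -
    have "open (D2 \<inter> k -` (- {0}))"
      by (rule continuous_open_preimage[OF holomorphic_on_imp_continuous_on[OF k(1)]]) auto
    moreover have "\<Omega> = D2 \<inter> k -` (- {0})" by (auto simp: \<Omega>_def)
    ultimately show ?thesis by simp
  qed
  have "k z \<noteq> 0" if "z \<in> K" for z
    using vortex_cofactor_nz[OF k(1,2), of z] that K(2) n by blast
  then have KO: "K \<subseteq> \<Omega>" using K(2) by (auto simp: \<Omega>_def)
  have phiO: "\<phi> \<in> test_functions \<Omega>"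
    using phi K(1,3) KO unfolding test_functions_def by blast
  define F where "F z = deriv k z / k z" for z
  have F: "F holomorphic_on \<Omega>" unfolding F_def[abs_def] \<Omega>_def
    by (intro holomorphic_on_divide holomorphic_on_subset[OF k(1)] holomorphic_on_subset[OF holomorphic_deriv[OF k(1)]]) auto
  define J where "J z = (\<Sum>i<n. dbar \<phi> z * inverse (z - vortex_pt i)) + indicator \<Omega> z *\<^sub>R (dbar \<phi> z * F z)" for z
  have i1: "integrable lborel (\<lambda>z. \<Sum>i<n. dbar \<phi> z * inverse (z - vortex_pt i))"
    by (intro Bochner_Integration.integrable_sum integrable_dbar_cauchy[OF phi])
  have i2: "integrable lborel (\<lambda>z. indicator \<Omega> z *\<^sub>R (dbar \<phi> z * F z))"
    using set_integrable_dbar_holomorphic[OF phiO O F] unfolding set_integrable_def .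
  have Ji: "integrable lborel J" unfolding J_def[abs_def] using i1 i2 by (rule Bochner_Integration.integrable_add)
  have AE: "AE z in lborel. indicator D2 z *\<^sub>R (dbar \<phi> z * vortex_logd z) = J z"
    using AE_not_vortex_pt
  proof eventually_elim
    case (elim z)
    show ?case
    proof (cases "z \<in> K")
      case True
      then have "z \<in> D2" "z \<in> \<Omega>" using K(2) KO by auto
      moreover from this have "vortex z \<noteq> 0" using elim vortex_zero_iff by blast
      ultimately show ?thesis using k(3)[of z] by (simp add: J_def F_def sum_distrib_left distrib_left)
    next
      case False
      then have "dbar \<phi> z = 0" using K(4) by (simp add: dbar_def)
      then show ?thesis by (simp add: J_def)
    qed
  qed
  have m: "(\<lambda>z. indicator D2 z *\<^sub>R (dbar \<phi> z * vortex_logd z)) \<in> borel_measurable lborel"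
  proof -
    have "dbar \<phi> \<in> borel_measurable borel" by (rule borel_measurable_continuous_onI[OF test_dbar_continuous[OF phi]])
    then have "(\<lambda>z. dbar \<phi> z * (indicator D2 z *\<^sub>R vortex_logd z)) \<in> borel_measurable borel"
      using borel_measurable_vortex_logd by (rule borel_measurable_times)
    then show ?thesis by simp
  qed
  show "set_integrable lborel D2 (\<lambda>z. dbar \<phi> z * vortex_logd z)"
    unfolding set_integrable_def using integrable_cong_AE[OF m borel_measurable_integrable[OF Ji] AE] Ji by blast
  have "(LINT z:D2|lborel. dbar \<phi> z * vortex_logd z) = integral\<^sup>L lborel J"
    unfolding set_lebesgue_integral_def by (rule integral_cong_AE[OF m borel_measurable_integrable[OF Ji] AE])
  also have "\<dots> = (LINT z|lborel. (\<Sum>i<n. dbar \<phi> z * inverse (z - vortex_pt i))) + (LINT z:\<Omega>|lborel. dbar \<phi> z * F z)"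
    unfolding J_def[abs_def] set_lebesgue_integral_def by (rule Bochner_Integration.integral_add[OF i1 i2])
  also have "(LINT z|lborel. (\<Sum>i<n. dbar \<phi> z * inverse (z - vortex_pt i))) = (\<Sum>i<n. LINT z|lborel. dbar \<phi> z * inverse (z - vortex_pt i))"
    by (intro Bochner_Integration.integral_sum integrable_dbar_cauchy[OF phi])
  also have "\<dots> = (\<Sum>i<n. of_real (- (2 * pi * \<phi> (vortex_pt i))))"
    by (intro sum.cong refl) (use integral_dbar_cauchy[OF phi] in simp)
  also have "(LINT z:\<Omega>|lborel. dbar \<phi> z * F z) = 0" by (rule integral_dbar_holomorphic[OF phiO O F])
  finally have "(LINT z:D2|lborel. dbar \<phi> z * vortex_logd z) = - (2 * pi * (\<Sum>i<n. \<phi> (vortex_pt i)))"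
    by (simp add: sum_negf sum_distrib_left)
  moreover have "\<phi> (vortex_pt i) = 0" if "i \<ge> n" for i using n that by (intro K(3)) auto
  ultimately show "\<exists>n. (\<forall>i\<ge>n. \<phi> (vortex_pt i) = 0) \<and>
      (LINT z:D2|lborel. dbar \<phi> z * vortex_logd z) = - (2 * pi * (\<Sum>i<n. \<phi> (vortex_pt i)))" by blast
qed

text \<open>If a sum of \<open>n + 1\<close> terms exceeds \<open>t\<close> in modulus, some term
  exceeds \<open>t / (n + 1)\<close>. For a simple pole this places \<open>z\<close> in a disc of
  radius of order \<open>1 / t\<close>, hence of area of order \<open>1 / t\<^sup>2\<close>. The
  bounded remainder can be that large only for small \<open>t\<close>, when a disc around the origin
  covers everything.\<close>

lemma vortex_logd_weak_L2:
  assumes K: "compact K" "K \<subseteq> D2"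
  obtains C where "\<And>t. t > 0 \<Longrightarrow> emeasure lborel {z \<in> K. t < norm (vortex_logd z)} \<le> ennreal (C / t\<^sup>2)"
proof -
  obtain n where n: "K \<inter> vortex_pt ` {n..} = {}" using compact_avoids_vortex_tail[OF K] by blast
  obtain k where k: "k holomorphic_on D2" "\<And>z. z \<in> D2 \<Longrightarrow> vortex z = (\<Prod>i<n. z - vortex_pt i) * k z"
    "\<And>z. z \<in> D2 \<Longrightarrow> vortex z \<noteq> 0 \<Longrightarrow> vortex_logd z = (\<Sum>i<n. inverse (z - vortex_pt i)) + deriv k z / k z"
    using vortex_factorization by metis
  have knz: "k z \<noteq> 0" if "z \<in> K" for z
    using vortex_cofactor_nz[OF k(1,2), of z] that K(2) n by blast
  have "continuous_on K (\<lambda>z. deriv k z / k z)"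
    using knz K(2)
    by (intro continuous_on_divide continuous_on_subset[OF holomorphic_on_imp_continuous_on[OF k(1)]]
        continuous_on_subset[OF holomorphic_on_imp_continuous_on[OF holomorphic_deriv[OF k(1)]]]) auto
  then have "bounded ((\<lambda>z. deriv k z / k z) ` K)"
    using K(1) by (simp add: compact_continuous_image compact_imp_bounded)
  then obtain B where B: "\<And>z. z \<in> K \<Longrightarrow> norm (deriv k z / k z) \<le> B" unfolding bounded_iff by blast
  define N where "N = real n + 1"
  define R where "R = N * max B 1"
  \<comment> \<open>The index \<open>n\<close> receives the centre \<open>0\<close>; its disc
    accounts for the bounded remainder.\<close>
  define c where "c i = (if i < n then vortex_pt i else 0)" for i
  have N: "N \<ge> 1" and R: "R \<ge> N" "R \<ge> N * B" "R > 0"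
    by (auto simp: N_def R_def mult_left_mono intro!: mult_pos_pos)
  have sub: "{z \<in> K. t < norm (vortex_logd z)} \<subseteq> (\<Union>i\<le>n. ball (c i) (R / t))" if t: "t > 0" for t
  proof
    fix z assume z: "z \<in> {z \<in> K. t < norm (vortex_logd z)}"
    then have zK: "z \<in> K" "z \<in> D2" "t < norm (vortex_logd z)" using K(2) by auto
    then have "vortex z \<noteq> 0" using t by (auto simp: vortex_logd_def)
    then have f: "vortex_logd z = (\<Sum>i<n. inverse (z - vortex_pt i)) + deriv k z / k z"
      using k(3) zK by blast
    show "z \<in> (\<Union>i\<le>n. ball (c i) (R / t))"
    proof (rule ccontr)
      assume "z \<notin> (\<Union>i\<le>n. ball (c i) (R / t))"
      then have nb: "R / t \<le> norm (z - c i)" if "i \<le> n" for i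
        using that by (auto simp: dist_norm norm_minus_commute not_less)
      have Rt: "R / t > 0" using R t by simp
      have "norm (inverse (z - vortex_pt i)) \<le> t / N" if "i < n" for i
      proof -
        have "R / t \<le> norm (z - vortex_pt i)" using nb[of i] that by (simp add: c_def)
        then have "inverse (norm (z - vortex_pt i)) \<le> inverse (R / t)" using Rt by (rule le_imp_inverse_le)
        also have "\<dots> = t / R" by simp
        also have "\<dots> \<le> t / N" using R N t by (intro divide_left_mono) auto
        finally show ?thesis by (simp add: norm_inverse)
      qed
      then have "norm (\<Sum>i<n. inverse (z - vortex_pt i)) \<le> (\<Sum>i<n. t / N)" by (intro sum_norm_le) auto
      then have 1: "norm (\<Sum>i<n. inverse (z - vortex_pt i)) \<le> real n * (t / N)" by simp
      \<comment> \<open>A point outside the disc around the origin forces \<open>R \<le> t\<close>,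
        and for such \<open>t\<close> the remainder is at most \<open>t / N\<close>.\<close>
      have "R / t \<le> norm z" using nb[of n] by (simp add: c_def)
      then have "R / t \<le> 1" using zK(2) by simp
      then have "R \<le> t" using t by (simp add: field_simps)
      then have "N * B \<le> t" using R by linarith
      then have "B \<le> t / N" using N by (simp add: field_simps)
      then have 2: "norm (deriv k z / k z) \<le> t / N" using B[OF zK(1)] by linarith
      have "norm (vortex_logd z) \<le> real n * (t / N) + t / N"
        unfolding f using 1 2 by (intro order_trans[OF norm_triangle_ineq] add_mono)
      also have "\<dots> = N * (t / N)" unfolding N_def distrib_right by simp
      also have "\<dots> = t" using N by simp
      finally show False using zK(3) by simp
    qed
  qed
  have "emeasure lborel {z \<in> K. t < norm (vortex_logd z)} \<le> ennreal ((real (Suc n) * (pi * R\<^sup>2)) / t\<^sup>2)" if t: "t > 0" for t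
  proof -
    have "emeasure lborel {z \<in> K. t < norm (vortex_logd z)} \<le> emeasure lborel (\<Union>i\<le>n. ball (c i) (R / t))"
      by (rule emeasure_mono[OF sub[OF t]]) auto
    also have "\<dots> \<le> (\<Sum>i\<le>n. emeasure lborel (ball (c i) (R / t)))"
      by (rule emeasure_subadditive_finite) auto
    also have "\<dots> = (\<Sum>i\<le>n. ennreal (pi * (R / t)\<^sup>2))"
      using R t by (intro sum.cong refl emeasure_ball_complex) auto
    also have "\<dots> = ennreal (\<Sum>i\<le>n. pi * (R / t)\<^sup>2)" by (rule sum_ennreal) auto
    also have "(\<Sum>i\<le>n. pi * (R / t)\<^sup>2) = (real (Suc n) * (pi * R\<^sup>2)) / t\<^sup>2" by (simp add: power_divide)
    finally show ?thesis .
  qed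
  with that show ?thesis by blast
qed

text \<open>The value \<open>1\<close> at the zeros, where no phase exists, keeps the map in the
  unit circle everywhere; integrals do not see this countable set.\<close>

definition vortex_phase :: "complex \<Rightarrow> complex" where
  "vortex_phase z = (if vortex z = 0 then 1 else sgn (vortex z))"

text \<open>If \<open>\<Phi>\<close> is a local phase of \<open>vortex\<close>, then \<open>\<nabla>\<Phi> = (Im f, Re f)\<close> for the logarithmic derivative
  \<open>f\<close>, and the gradient of the phase factor \<open>g\<close> is \<open>\<i> g \<nabla>\<Phi>\<close>.\<close>

definition vortex_grad :: "complex \<Rightarrow> complex \<times> complex" where
  "vortex_grad z = (\<i> * vortex_phase z * of_real (Im (vortex_logd z)), \<i> * vortex_phase z * of_real (Re (vortex_logd z)))"

lemma norm_vortex_phase: "norm (vortex_phase z) = 1"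
  by (simp add: vortex_phase_def norm_sgn)

lemma vortex_phase_cnj: "cnj (vortex_phase z) * vortex_phase z = 1"
  using complex_norm_square[of "vortex_phase z"] by (simp add: norm_vortex_phase mult.commute)

lemma norm_vortex_grad: "norm (vortex_grad z) = norm (vortex_logd z)"
  unfolding vortex_grad_def norm_Pair norm_mult norm_vortex_phase norm_ii norm_of_real
  by (simp add: cmod_def[of "vortex_logd z"] add.commute)

lemma vortex_phase_homog: "vortex z \<noteq> 0 \<Longrightarrow> vortex_phase z = homog 0 1 (vortex z)"
  by (simp add: vortex_phase_def homog_def)

lemma borel_measurable_vortex_phase: "(\<lambda>z. indicator D2 z *\<^sub>R vortex_phase z) \<in> borel_measurable borel"
proof -
  have 1: "(\<lambda>z. indicator D2 z *\<^sub>R vortex z) \<in> borel_measurable borel"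
    by (rule borel_measurable_continuous_on_indicator) (use vortex_hol in \<open>auto intro: holomorphic_on_imp_continuous_on\<close>)
  define w where "w z = indicator D2 z *\<^sub>R vortex z" for z
  have w: "w \<in> borel_measurable borel" using 1 by (simp add: w_def[abs_def])
  \<comment> \<open>At a vortex the quotient is \<open>0\<close> by division by zero, and the
    indicator supplies the value \<open>1\<close>.\<close>
  have "(\<lambda>z. w z / of_real (norm (w z)) + indicator (range vortex_pt) z) \<in> borel_measurable borel"
    by (intro borel_measurable_add borel_measurable_divide w borel_measurable_indicator measurable_compose[OF measurable_compose[OF w borel_measurable_norm] borel_measurable_of_real])
      (simp add: countable_imp_null_set_lborel[THEN null_setsD2, simplified])
  moreover have "indicator D2 z *\<^sub>R vortex_phase z = w z / of_real (norm (w z)) + indicator (range vortex_pt) z" for z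
  proof (cases "z \<in> D2")
    case True
    then show ?thesis using vortex_zero_iff[OF True]
      by (auto simp: w_def vortex_phase_def sgn_div_norm scaleR_conv_of_real divide_inverse indicator_def mult.commute)
  next
    case False
    then have "z \<notin> range vortex_pt" using vortex_pt_in_D2 by blast
    then show ?thesis using False by (simp add: w_def)
  qed
  ultimately show ?thesis by simp
qed

lemma borel_measurable_vortex_grad: "(\<lambda>z. indicator D2 z *\<^sub>R vortex_grad z) \<in> borel_measurable borel"
proof -
  note g = borel_measurable_vortex_phase
  note f = borel_measurable_vortex_logd
  have 1: "(\<lambda>z. (\<i> * (indicator D2 z *\<^sub>R vortex_phase z) * of_real (Im (indicator D2 z *\<^sub>R vortex_logd z)),
      \<i> * (indicator D2 z *\<^sub>R vortex_phase z) * of_real (Re (indicator D2 z *\<^sub>R vortex_logd z)))) \<in> borel_measurable borel"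
    by (intro borel_measurable_Pair borel_measurable_times borel_measurable_const g
        measurable_compose[OF measurable_compose[OF f borel_measurable_Im] borel_measurable_of_real]
        measurable_compose[OF measurable_compose[OF f borel_measurable_Re] borel_measurable_of_real])
  have 2: "indicator D2 z *\<^sub>R vortex_grad z = (\<i> * (indicator D2 z *\<^sub>R vortex_phase z) * of_real (Im (indicator D2 z *\<^sub>R vortex_logd z)),
      \<i> * (indicator D2 z *\<^sub>R vortex_phase z) * of_real (Re (indicator D2 z *\<^sub>R vortex_logd z)))" for z
    by (cases "z \<in> D2") (auto simp: vortex_grad_def zero_prod_def)
  show ?thesis unfolding 2 by (rule 1)
qed

section \<open>The solution\<close>

lemma indicator_D2_integrable: "integrable lborel (\<lambda>z::complex. indicator D2 z :: real)"
  by (rule integrable_real_indicator) (use emeasure_ball_complex[of 1 0] in auto)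

lemma vortex_phase_integrable: "set_integrable lborel D2 vortex_phase"
  unfolding set_integrable_def
  by (rule Bochner_Integration.integrable_bound[OF indicator_D2_integrable])
    (use borel_measurable_vortex_phase in \<open>auto simp: norm_vortex_phase indicator_def\<close>)

lemma vortex_grad_integrable: "set_integrable lborel D2 vortex_grad"
proof -
  have i: "integrable lborel (\<lambda>z. indicator D2 z *\<^sub>R norm (deriv vortex z / vortex z))"
    using vortex_logd_integrable_L1 unfolding set_integrable_def .
  show ?thesis unfolding set_integrable_def
    by (rule Bochner_Integration.integrable_bound[OF i])
      (use borel_measurable_vortex_grad in \<open>auto simp: norm_vortex_grad vortex_logd_def indicator_def\<close>)
qed

text \<open>The phase is formally \<open>h\<close> to the power \<open>1/2\<close> times
  \<open>cnj h\<close> to the power \<open>- 1/2\<close>; this is the origin of the halves and of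
  the sign. At a zero all terms are \<open>0\<close> by convention.\<close>

lemma vortex_phase_wirtinger:
  "bterm_dz (\<lambda>_. 1) (\<lambda>_. 1) 0 1 vortex z = vortex_phase z * vortex_logd z / 2"
  "bterm_dzbar (\<lambda>_. 1) (\<lambda>_. 1) 0 1 vortex z = - (vortex_phase z * cnj (vortex_logd z) / 2)"
proof -
  have "bterm_dz (\<lambda>_. 1) (\<lambda>_. 1) 0 1 vortex z = vortex_phase z * vortex_logd z / 2 \<and>
    bterm_dzbar (\<lambda>_. 1) (\<lambda>_. 1) 0 1 vortex z = - (vortex_phase z * cnj (vortex_logd z) / 2)"
  proof (cases "vortex z = 0")
    case True
    then show ?thesis by (simp add: bterm_dz_def bterm_dzbar_def bterm_def vortex_logd_def)
  next
    case False
    have 1: "homog (0 - 1) (1 - 1) (vortex z) = vortex_phase z * inverse (vortex z)"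
      using homog_mult[of 0 1 "vortex z" "-1" "-1"] by (simp add: vortex_phase_homog[OF False] homog_m1_m1)
    have 2: "homog (0 - 1) (1 + 1) (vortex z) = vortex_phase z * cnj (inverse (vortex z))"
      using homog_mult[of 0 1 "vortex z" "-1" 1] cnj_homog[of "-1" "-1" "vortex z"]
      by (simp add: vortex_phase_homog[OF False] homog_m1_m1)
    show ?thesis
      unfolding bterm_dz_def bterm_dzbar_def bterm_def vortex_logd_def 1 2
      using False by (simp add: field_simps)
  qed
  then show "bterm_dz (\<lambda>_. 1) (\<lambda>_. 1) 0 1 vortex z = vortex_phase z * vortex_logd z / 2"
    "bterm_dzbar (\<lambda>_. 1) (\<lambda>_. 1) 0 1 vortex z = - (vortex_phase z * cnj (vortex_logd z) / 2)" by auto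
qed

lemma vortex_weak_gradient: "has_weak_gradient D2 vortex_phase vortex_grad"
  unfolding has_weak_gradient_def
proof (intro conjI ballI)
  show "locally_integrable_on D2 vortex_phase"
    unfolding locally_integrable_on_def
    using set_integrable_subset[OF vortex_phase_integrable] by (auto simp: compact_imp_closed)
  show "locally_integrable_on D2 vortex_grad"
    unfolding locally_integrable_on_def
    using set_integrable_subset[OF vortex_grad_integrable] by (auto simp: compact_imp_closed)
  fix \<phi> assume phi: "\<phi> \<in> test_functions D2"
  have oc: "1 \<in> (Basis::complex set)" "\<i> \<in> (Basis::complex set)" by (auto simp: Basis_complex_def)
  define V where "V b z = bterm_dz (\<lambda>_. 1) (\<lambda>_. 1) 0 1 vortex z * b + bterm_dzbar (\<lambda>_. 1) (\<lambda>_. 1) 0 1 vortex z * cnj b" for b z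
  note W = weak_gradient_bterm[OF bounded_derivs_const[of 1] bounded_derivs_const[of 1] bounded_derivs_vortex order.refl
      vortex_logd_integrable_L1 phi, of _ 1, folded V_def]
  have V1: "V 1 z = fst (vortex_grad z)" for z
  proof -
    have "f / 2 - cnj f / 2 = \<i> * of_real (Im f)" for f by (simp add: complex_eq_iff)
    then have "g * (f / 2 - cnj f / 2) = g * (\<i> * of_real (Im f))" for f g by metis
    then show ?thesis by (simp add: V_def vortex_phase_wirtinger vortex_grad_def right_diff_distrib mult.left_commute)
  qed
  have V2: "V \<i> z = snd (vortex_grad z)" for z
  proof -
    have "g * f / 2 * \<i> + - (g * cnj f / 2) * cnj \<i> = \<i> * g * of_real (Re f)" for f g
      by (simp add: complex_eq_iff field_simps)
    then show ?thesis unfolding V_def vortex_phase_wirtinger vortex_grad_def snd_conv .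
  qed
  \<comment> \<open>At the vortices the term of degree \<open>0\<close> is \<open>0\<close> while
    \<open>vortex_phase\<close> is \<open>1\<close>; the two functions agree off this null
    set.\<close>
  have AE: "(LINT z:D2|lborel. partial b \<phi> z *\<^sub>R bterm (\<lambda>_. 1) (\<lambda>_. 1) 0 1 vortex z)
      = (LINT z:D2|lborel. partial b \<phi> z *\<^sub>R vortex_phase z)" if b: "b \<in> Basis" for b
    unfolding set_lebesgue_integral_def
  proof (rule integral_cong_AE)
    show "(\<lambda>z. indicator D2 z *\<^sub>R (partial b \<phi> z *\<^sub>R bterm (\<lambda>_. 1) (\<lambda>_. 1) 0 1 vortex z)) \<in> borel_measurable lborel"
      using W(3)[OF b] unfolding set_integrable_def by (rule borel_measurable_integrable)
    have "partial b \<phi> \<in> borel_measurable borel"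
      by (rule borel_measurable_continuous_onI[OF test_function_partial_continuous[OF phi b]])
    then have "(\<lambda>z. partial b \<phi> z *\<^sub>R (indicator D2 z *\<^sub>R vortex_phase z)) \<in> borel_measurable borel"
      by (rule borel_measurable_scaleR[OF _ borel_measurable_vortex_phase])
    then show "(\<lambda>z. indicator D2 z *\<^sub>R (partial b \<phi> z *\<^sub>R vortex_phase z)) \<in> borel_measurable lborel"
      by (simp add: scaleR_left_commute mult.commute)
    show "AE z in lborel. indicator D2 z *\<^sub>R (partial b \<phi> z *\<^sub>R bterm (\<lambda>_. 1) (\<lambda>_. 1) 0 1 vortex z)
        = indicator D2 z *\<^sub>R (partial b \<phi> z *\<^sub>R vortex_phase z)"
      using AE_not_vortex_pt
    proof eventually_elim
      case (elim z)
      show ?case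
      proof (cases "z \<in> D2")
        case True
        then have "vortex z \<noteq> 0" using elim vortex_zero_iff by blast
        then show ?thesis by (simp add: bterm_def vortex_phase_homog)
      qed simp
    qed
  qed
  show "(LINT z:D2|lborel. \<phi> z *\<^sub>R fst (vortex_grad z)) = - (LINT z:D2|lborel. partial 1 \<phi> z *\<^sub>R vortex_phase z)"
    using W(1)[OF oc(1)] unfolding AE[OF oc(1)] V1 .
  show "(LINT z:D2|lborel. \<phi> z *\<^sub>R snd (vortex_grad z)) = - (LINT z:D2|lborel. partial \<i> \<phi> z *\<^sub>R vortex_phase z)"
    using W(1)[OF oc(2)] unfolding AE[OF oc(2)] V2 .
qed

lemma vortex_phase_Lp: "Lp_on p D2 vortex_phase"
  unfolding Lp_on_def set_borel_measurable_def set_integrable_def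
  using borel_measurable_vortex_phase indicator_D2_integrable by (simp add: norm_vortex_phase)

lemma vortex_grad_Lp:
  assumes "1 \<le> p" "p < 2"
  shows "Lp_on p D2 vortex_grad"
  unfolding Lp_on_def set_borel_measurable_def norm_vortex_grad
  using borel_measurable_vortex_grad vortex_logd_Lp[OF assms] by simp

lemma vortex_grad_weak_L2_loc: "weak_L2_loc D2 vortex_grad"
  unfolding weak_L2_loc_def weak_L2_on_def
proof (intro allI impI conjI)
  fix K assume K: "compact K \<and> K \<subseteq> D2"
  have "(\<lambda>z. indicator K z *\<^sub>R (indicator D2 z *\<^sub>R vortex_grad z)) \<in> borel_measurable borel"
    using K by (intro borel_measurable_scaleR borel_measurable_vortex_grad borel_measurable_indicator) (simp add: compact_imp_closed)
  also have "(\<lambda>z. indicator K z *\<^sub>R (indicator D2 z *\<^sub>R vortex_grad z)) = (\<lambda>z. indicator K z *\<^sub>R vortex_grad z)"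
    using K by (auto simp: indicator_def fun_eq_iff)
  finally show "set_borel_measurable lborel K vortex_grad"
    unfolding set_borel_measurable_def by simp
  obtain C where "\<And>t. t > 0 \<Longrightarrow> emeasure lborel {z \<in> K. t < norm (vortex_logd z)} \<le> ennreal (C / t\<^sup>2)"
    using vortex_logd_weak_L2 K by metis
  then show "\<exists>C. \<forall>t>0. emeasure lborel {z \<in> K. t < norm (vortex_grad z)} \<le> ennreal (C / t\<^sup>2)"
    unfolding norm_vortex_grad by blast
qed

text \<open>The accumulation point \<open>1\<close> belongs to the closure of the vortices and is
  removed with them; at the remaining points of the closed disc \<open>vortex\<close> is continuous
  and nonzero.\<close>

lemma vortex_phase_continuous: "continuous_up_to_boundary_off (range vortex_pt) vortex_phase"
proof -
  have 1: "1 \<in> closure (range vortex_pt)"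
    unfolding closure_sequential using vortex_pt_tendsto by blast
  define S where "S = closure D2 - closure (range vortex_pt)"
  have S: "z \<in> cball 0 1" "z \<noteq> 1" "z \<notin> range vortex_pt" if "z \<in> S" for z
    using that 1 closure_subset[of "range vortex_pt"] by (auto simp: S_def closure_ball)
  have nz: "vortex z \<noteq> 0" if "z \<in> S" for z using vortex_eq_0_iff[OF S(1,2)[OF that]] S(3)[OF that] by blast
  have "continuous_on S vortex" by (rule continuous_on_subset[OF continuous_on_vortex]) (use S(1) in blast)
  then have "continuous_on S (\<lambda>z. vortex z /\<^sub>R norm (vortex z))" using nz by (intro continuous_intros) auto
  then have "continuous_on S vortex_phase"
    by (rule continuous_on_eq) (use nz in \<open>simp add: vortex_phase_def sgn_div_norm\<close>)
  then show ?thesis by (simp add: continuous_up_to_boundary_off_def S_def)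
qed

lemma dbar_mult: "dbar \<phi> z * w = of_real (partial 1 \<phi> z * Re w - partial \<i> \<phi> z * Im w)
    + \<i> * of_real (partial 1 \<phi> z * Im w + partial \<i> \<phi> z * Re w)"
  by (simp add: dbar_def complex_eq_iff)

text \<open>With \<open>f\<close> the logarithmic derivative,
  \<open>\<i> * cnj g * \<nabla>g\<close> is \<open>- (Im f, Re f)\<close>. Its divergence tested
  with \<open>\<phi>\<close> is the imaginary part of the integral of
  \<open>dbar \<phi> * f\<close>, and the rotated field gives minus the real part. That integral is
  real and equals \<open>- 2 * pi\<close> times the sum of the values of \<open>\<phi>\<close> at
  the vortices.\<close>

lemma vortex_phase_div:
  assumes "\<phi> \<in> test_functions D2"
  shows "distr_div D2 (field_mult (\<lambda>z. \<i> * cnj (vortex_phase z)) vortex_grad) \<phi> = 0" (is ?A)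
    and "(\<lambda>k. 2 * pi * dirac (vortex_pt k) \<phi>) sums
           distr_div D2 (field_mult (\<lambda>z. \<i> * cnj (vortex_phase z)) (perp vortex_grad)) \<phi>" (is ?B)
proof -
  define I where "I = (LINT z:D2|lborel. dbar \<phi> z * vortex_logd z)"
  obtain n where n: "\<And>i. i \<ge> n \<Longrightarrow> \<phi> (vortex_pt i) = 0" "I = - (2 * pi * (\<Sum>i<n. \<phi> (vortex_pt i)))"
    using integral_dbar_logd[OF assms] unfolding I_def by blast
  have i: "integrable lborel (\<lambda>z. indicator D2 z *\<^sub>R (dbar \<phi> z * vortex_logd z))"
    using integrable_dbar_logd[OF assms] unfolding set_integrable_def .
  have c: "\<i> * cnj (vortex_phase z) * (\<i> * vortex_phase z * w) = - w" for z w
  proof -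
    have "\<i> * cnj (vortex_phase z) * (\<i> * vortex_phase z * w) = (\<i> * \<i>) * (cnj (vortex_phase z) * vortex_phase z) * w"
      by (simp only: mult_ac)
    then show ?thesis by (simp add: vortex_phase_cnj)
  qed
  have "distr_div D2 (field_mult (\<lambda>z. \<i> * cnj (vortex_phase z)) vortex_grad) \<phi>
     = - (LINT z:D2|lborel. of_real (- Im (dbar \<phi> z * vortex_logd z)))"
    unfolding distr_div_def field_mult_def vortex_grad_def fst_conv snd_conv c dbar_mult
    by (simp add: scaleR_conv_of_real)
  also have "\<dots> = of_real (Im I)"
  proof -
    have "(LINT z:D2|lborel. - Im (dbar \<phi> z * vortex_logd z)) = - (LINT z:D2|lborel. Im (dbar \<phi> z * vortex_logd z))"
      unfolding set_lebesgue_integral_def by (simp only: scaleR_minus_right Bochner_Integration.integral_minus)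
    also have "(LINT z:D2|lborel. Im (dbar \<phi> z * vortex_logd z)) = Im I"
      unfolding I_def set_lebesgue_integral_def integral_Im[OF i, symmetric] by simp
    finally show ?thesis unfolding set_integral_complex_of_real by simp
  qed
  also have "Im I = 0" unfolding n(2) by simp
  finally show ?A by simp
  have "distr_div D2 (field_mult (\<lambda>z. \<i> * cnj (vortex_phase z)) (perp vortex_grad)) \<phi>
     = - (LINT z:D2|lborel. of_real (Re (dbar \<phi> z * vortex_logd z)))"
    unfolding distr_div_def field_mult_def vortex_grad_def perp_def fst_conv snd_conv mult_minus_right c dbar_mult
    by (simp add: scaleR_conv_of_real)
  also have "\<dots> = - of_real (Re I)"
    unfolding set_integral_complex_of_real I_def set_lebesgue_integral_def integral_Re[OF i, symmetric]
    by simp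
  also have "\<dots> = (\<Sum>i<n. 2 * pi * dirac (vortex_pt i) \<phi>)" unfolding n(2) by (simp add: dirac_def sum_distrib_left)
  finally have e: "distr_div D2 (field_mult (\<lambda>z. \<i> * cnj (vortex_phase z)) (perp vortex_grad)) \<phi>
     = (\<Sum>i<n. 2 * pi * dirac (vortex_pt i) \<phi>)" .
  show ?B unfolding e by (rule sums_finite) (use n(1) in \<open>auto simp: dirac_def not_less\<close>)
qed

text \<open>The identities in the directions \<open>1\<close> and \<open>\<i>\<close> are combined
  with weights \<open>1\<close> and \<open>\<i>\<close>, or \<open>1\<close> and
  \<open>- \<i>\<close>; the factor \<open>2\<close> arises because \<open>dbar\<close> is twice a
  Wirtinger derivative.\<close>

lemma weak_wirtinger_bterm:
  fixes m :: int
  assumes A: "bounded_derivs A" and B: "bounded_derivs B" and h: "bounded_derivs h" and c: "c \<ge> 0"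
    and L1: "set_integrable lborel D2 (\<lambda>z. norm (deriv h z / h z))"
    and phi: "\<phi> \<in> test_functions D2"
  shows "(LINT z:D2|lborel. dbar \<phi> z * bterm A B c m h z) = - 2 * (LINT z:D2|lborel. \<phi> z *\<^sub>R bterm_dzbar A B c m h z)"
    and "(LINT z:D2|lborel. cnj (dbar \<phi> z) * bterm A B c m h z) = - 2 * (LINT z:D2|lborel. \<phi> z *\<^sub>R bterm_dz A B c m h z)"
    and "set_integrable lborel D2 (\<lambda>z. dbar \<phi> z * bterm A B c m h z)"
    and "set_integrable lborel D2 (\<lambda>z. cnj (dbar \<phi> z) * bterm A B c m h z)"
    and "set_integrable lborel D2 (\<lambda>z. \<phi> z *\<^sub>R bterm_dz A B c m h z)"
    and "set_integrable lborel D2 (\<lambda>z. \<phi> z *\<^sub>R bterm_dzbar A B c m h z)"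
proof -
  have oc: "1 \<in> (Basis::complex set)" "\<i> \<in> (Basis::complex set)" by (auto simp: Basis_complex_def)
  note W = weak_gradient_bterm[OF A B h c L1 phi, of _ m]
  let ?v = "bterm A B c m h" let ?d = "bterm_dz A B c m h" let ?e = "bterm_dzbar A B c m h"
  let ?V = "\<lambda>b z. \<phi> z *\<^sub>R (?d z * b + ?e z * cnj b)"
  note Wi = W(2)[OF oc(1)] W(2)[OF oc(2)] W(3)[OF oc(1)] W(3)[OF oc(2)]
  have Vi: "set_integrable lborel D2 (\<lambda>z. k * ?V \<i> z)" "set_integrable lborel D2 (\<lambda>z. k * (partial \<i> \<phi> z *\<^sub>R ?v z))" for k
    by (intro set_integrable_mult_right Wi)+
  have e1: "?V 1 z + \<i> * ?V \<i> z = 2 * (\<phi> z *\<^sub>R ?e z)" for z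
  proof -
    have "p * (d * 1 + e * cnj 1) + \<i> * (p * (d * \<i> + e * cnj \<i>)) = 2 * (p * e)" for p d e :: complex
      by (simp add: complex_eq_iff algebra_simps)
    then show ?thesis unfolding scaleR_conv_of_real .
  qed
  have e2: "?V 1 z + (- \<i>) * ?V \<i> z = 2 * (\<phi> z *\<^sub>R ?d z)" for z
  proof -
    have "p * (d * 1 + e * cnj 1) + (- \<i>) * (p * (d * \<i> + e * cnj \<i>)) = 2 * (p * d)" for p d e :: complex
      by (simp add: complex_eq_iff algebra_simps)
    then show ?thesis unfolding scaleR_conv_of_real .
  qed
  have e3: "dbar \<phi> z * ?v z = partial 1 \<phi> z *\<^sub>R ?v z + \<i> * (partial \<i> \<phi> z *\<^sub>R ?v z)" for z
    by (simp add: dbar_def scaleR_conv_of_real algebra_simps)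
  have e4: "cnj (dbar \<phi> z) * ?v z = partial 1 \<phi> z *\<^sub>R ?v z + (- \<i>) * (partial \<i> \<phi> z *\<^sub>R ?v z)" for z
    by (simp add: dbar_def scaleR_conv_of_real algebra_simps)
  have two: "(2 :: complex) \<noteq> 0" by simp
  note s1 = set_integral_add[OF Wi(1) Vi(1)[of "\<i>"], unfolded e1 set_integral_mult_right]
  note s2 = set_integral_add[OF Wi(1) Vi(1)[of "- \<i>"], unfolded e2 set_integral_mult_right]
  note s3 = set_integral_add[OF Wi(3) Vi(2)[of "\<i>"], folded e3, unfolded set_integral_mult_right]
  note s4 = set_integral_add[OF Wi(3) Vi(2)[of "- \<i>"], folded e4, unfolded set_integral_mult_right]
  show "set_integrable lborel D2 (\<lambda>z. dbar \<phi> z * ?v z)" by (rule s3(1))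
  show "set_integrable lborel D2 (\<lambda>z. cnj (dbar \<phi> z) * ?v z)" by (rule s4(1))
  show "set_integrable lborel D2 (\<lambda>z. \<phi> z *\<^sub>R ?d z)"
    using s2(1) by (simp only: set_integrable_mult_right_iff[OF two])
  show "set_integrable lborel D2 (\<lambda>z. \<phi> z *\<^sub>R ?e z)"
    using s1(1) by (simp only: set_integrable_mult_right_iff[OF two])
  have p1: "(LINT z:D2|lborel. partial 1 \<phi> z *\<^sub>R ?v z) = - (LINT z:D2|lborel. ?V 1 z)"
    using W(1)[OF oc(1)] by (metis add.inverse_inverse)
  have p2: "(LINT z:D2|lborel. partial \<i> \<phi> z *\<^sub>R ?v z) = - (LINT z:D2|lborel. ?V \<i> z)"
    using W(1)[OF oc(2)] by (metis add.inverse_inverse)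
  show "(LINT z:D2|lborel. dbar \<phi> z * ?v z) = - 2 * (LINT z:D2|lborel. \<phi> z *\<^sub>R ?e z)"
    using s3(2) s1(2) unfolding p1 p2 by simp
  show "(LINT z:D2|lborel. cnj (dbar \<phi> z) * ?v z) = - 2 * (LINT z:D2|lborel. \<phi> z *\<^sub>R ?d z)"
    using s4(2) s2(2) unfolding p1 p2 by simp
qed

section \<open>The equation for \<open>u\<close>, its critical points and its trace\<close>

definition vortex_sol :: "real \<Rightarrow> int \<Rightarrow> complex \<Rightarrow> complex" where
  "vortex_sol a m z = homog a m (vortex z)"

lemma vortex_sol_bterm: "vortex_sol a m = bterm (\<lambda>_. 1) (\<lambda>_. 1) a m vortex"
  by (simp add: vortex_sol_def bterm_def fun_eq_iff)

lemma vortex_sol_partial: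
  assumes "z \<in> D2" "vortex z \<noteq> 0 \<or> a > 1"
  shows "partial b (vortex_sol a m) z
    = of_real ((a + m) / 2) * bterm (deriv vortex) (\<lambda>_. 1) (a - 1) (m - 1) vortex z * b
    + of_real ((a - m) / 2) * bterm (\<lambda>_. 1) (deriv vortex) (a - 1) (m + 1) vortex z * cnj b"
proof -
  have "(vortex_sol a m has_derivative (\<lambda>v. bterm_dz (\<lambda>_. 1) (\<lambda>_. 1) a m vortex z * v
      + bterm_dzbar (\<lambda>_. 1) (\<lambda>_. 1) a m vortex z * cnj v)) (at z)"
    unfolding vortex_sol_bterm using assms vortex_hol by (intro bterm_has_derivative[of _ D2]) auto
  from partial_eq[OF this, of b] show ?thesis
    by (simp add: bterm_dz_def bterm_dzbar_def bterm_def)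
qed

text \<open>The phase raises the frequency by one. At a zero both sides vanish because
  \<open>homog\<close> does, whatever value the phase has there.\<close>

lemma vortex_phase_mult_bterm:
  "vortex_phase z * bterm A B c m vortex z = bterm A B c (m + 1) vortex z"
proof (cases "vortex z = 0")
  case False
  have "homog c (m + 1) (vortex z) = vortex_phase z * homog c m (vortex z)"
    using homog_mult[of 0 1 "vortex z" c m] by (simp add: vortex_phase_homog[OF False] add.commute)
  then show ?thesis by (simp add: bterm_def mult_ac)
qed (simp add: bterm_def)

text \<open>Multiplied by the phase, the two Wirtinger parts of the gradient become \<open>P\<close>
  and \<open>R\<close> of degree \<open>a - 1\<close>. Integration by parts calls for the
  \<open>dzbar\<close> part of \<open>P\<close>, whose amplitude is holomorphic, and the
  \<open>dz\<close> part of \<open>R\<close>, whose amplitude is antiholomorphic; so both are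
  multiples of one term of degree \<open>a - 2\<close>. For \<open>a < 2\<close> that term is
  unbounded at the vortices, hence the weak formulation.\<close>

lemma vortex_sol_div:
  assumes a: "a > 1" "a\<^sup>2 = (of_int m)\<^sup>2 + of_int m" and phi: "\<phi> \<in> test_functions D2"
  shows "distr_div D2 (field_mult vortex_phase (grad (vortex_sol a m))) \<phi> = 0"
proof -
  define k l where "k = (of_real ((a + m) / 2) :: complex)" and "l = (of_real ((a - m) / 2) :: complex)"
  define P where "P = bterm (deriv vortex) (\<lambda>_. 1) (a - 1) m vortex"
  define R where "R = bterm (\<lambda>_. 1) (deriv vortex) (a - 1) (m + 2) vortex"
  define P' where "P' = bterm_dzbar (deriv vortex) (\<lambda>_. 1) (a - 1) m vortex"
  define R' where "R' = bterm_dz (\<lambda>_. 1) (deriv vortex) (a - 1) (m + 2) vortex"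
  note bd = bounded_derivs_deriv[OF bounded_derivs_vortex] bounded_derivs_const[of 1] bounded_derivs_vortex
  have a0: "a - 1 \<ge> 0" using a by simp
  note WP = weak_wirtinger_bterm[OF bd(1,2,3) a0 vortex_logd_integrable_L1 phi, of m, folded P_def P'_def]
  note WR = weak_wirtinger_bterm[OF bd(2,1,3) a0 vortex_logd_integrable_L1 phi, of "m + 2", folded R_def R'_def]
  have X: "partial 1 \<phi> z *\<^sub>R fst (field_mult vortex_phase (grad (vortex_sol a m)) z)
      + partial \<i> \<phi> z *\<^sub>R snd (field_mult vortex_phase (grad (vortex_sol a m)) z)
    = k * (dbar \<phi> z * P z) + l * (cnj (dbar \<phi> z) * R z)" if z: "z \<in> D2" for z
  proof -
    have g: "vortex_phase z * partial b (vortex_sol a m) z = k * P z * b + l * R z * cnj b" for b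
    proof -
      have "vortex_phase z * partial b (vortex_sol a m) z
        = k * (vortex_phase z * bterm (deriv vortex) (\<lambda>_. 1) (a - 1) (m - 1) vortex z) * b
        + l * (vortex_phase z * bterm (\<lambda>_. 1) (deriv vortex) (a - 1) (m + 1) vortex z) * cnj b"
        using a z by (subst vortex_sol_partial) (simp_all add: k_def l_def algebra_simps)
      moreover have "m - 1 + 1 = m" "m + 1 + 1 = m + 2" by simp_all
      ultimately show ?thesis unfolding vortex_phase_mult_bterm P_def R_def by (simp only:)
    qed
    show ?thesis unfolding field_mult_def grad_def fst_conv snd_conv g
      by (simp add: dbar_def scaleR_conv_of_real algebra_simps)
  qed
  have cancel: "k * P' z + l * R' z = 0" for z
  proof -
    have hP: "P' z = of_real ((a - 1 - m) / 2) * bterm (deriv vortex) (deriv vortex) (a - 2) (m + 1) vortex z"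
      by (simp add: P'_def bterm_dzbar_def bterm_def)
    have hR: "R' z = of_real ((a - 1 + (m + 2)) / 2) * bterm (deriv vortex) (deriv vortex) (a - 2) (m + 1) vortex z"
      by (simp add: R'_def bterm_dz_def bterm_def add.commute)
    \<comment> \<open>The combined coefficient of the common term; here the relation between
      \<open>a\<close> and \<open>m\<close> enters.\<close>
    have "(a + m) / 2 * ((a - 1 - m) / 2) + (a - m) / 2 * ((a - 1 + (m + 2)) / 2) = (2 * (a\<^sup>2 - ((of_int m)\<^sup>2 + of_int m))) / 4"
      by (simp add: power2_eq_square field_simps)
    also have "\<dots> = 0" using a by simp
    finally have "k * of_real ((a - 1 - m) / 2) + l * of_real ((a - 1 + (m + 2)) / 2) = 0"
      unfolding k_def l_def of_real_mult[symmetric] of_real_add[symmetric] by (simp only: of_real_0)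
    then show ?thesis unfolding hP hR by (simp only: mult.assoc[symmetric] distrib_right[symmetric] mult_zero_left)
  qed
  have "(LINT z:D2|lborel. partial 1 \<phi> z *\<^sub>R fst (field_mult vortex_phase (grad (vortex_sol a m)) z)
      + partial \<i> \<phi> z *\<^sub>R snd (field_mult vortex_phase (grad (vortex_sol a m)) z))
    = (LINT z:D2|lborel. k * (dbar \<phi> z * P z) + l * (cnj (dbar \<phi> z) * R z))"
    by (rule set_lebesgue_integral_cong) (use X in auto)
  also have "\<dots> = k * (LINT z:D2|lborel. dbar \<phi> z * P z) + l * (LINT z:D2|lborel. cnj (dbar \<phi> z) * R z)"
    using set_integral_add(2)[OF set_integrable_mult_right[OF WP(3)] set_integrable_mult_right[OF WR(4)]]
    by (simp only: set_integral_mult_right)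
  also have "\<dots> = - 2 * (k * (LINT z:D2|lborel. \<phi> z *\<^sub>R P' z) + l * (LINT z:D2|lborel. \<phi> z *\<^sub>R R' z))"
    unfolding WP(1) WR(2) by (simp add: algebra_simps)
  also have "k * (LINT z:D2|lborel. \<phi> z *\<^sub>R P' z) + l * (LINT z:D2|lborel. \<phi> z *\<^sub>R R' z)
     = (LINT z:D2|lborel. k * (\<phi> z *\<^sub>R P' z) + l * (\<phi> z *\<^sub>R R' z))"
    using set_integral_add(2)[OF set_integrable_mult_right[OF WP(6)] set_integrable_mult_right[OF WR(5)]]
    by (simp only: set_integral_mult_right)
  also have "(\<lambda>z. k * (\<phi> z *\<^sub>R P' z) + l * (\<phi> z *\<^sub>R R' z)) = (\<lambda>z. \<phi> z *\<^sub>R (k * P' z + l * R' z))"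
    by (simp add: scaleR_right_distrib)
  also have "(LINT z:D2|lborel. \<phi> z *\<^sub>R (k * P' z + l * R' z)) = 0" unfolding cancel by (simp add: set_lebesgue_integral_def)
  finally show ?thesis unfolding distr_div_def by simp
qed

text \<open>Off the zeros of \<open>vortex\<close> and of its derivative, the complex linear part of
  the derivative is nonzero because \<open>(a + m) / 2\<close> is. All critical points are therefore
  zeros of the holomorphic function \<open>vortex * deriv vortex\<close>.\<close>

lemma vortex_sol_critical_points:
  assumes "a > 1" "a + m > 0"
  shows "isolated_points_in D2 {z \<in> D2. grad (vortex_sol a m) z = 0}"
proof (rule isolated_zeros_D2)
  have d: "deriv vortex holomorphic_on D2" using vortex_hol by (rule holomorphic_deriv) simp
  show "(\<lambda>z. vortex z * deriv vortex z) holomorphic_on D2" by (intro holomorphic_on_mult vortex_hol d)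
  define q where "q = vortex_pt 0"
  show q: "q \<in> D2" unfolding q_def by (rule vortex_pt_in_D2)
  \<comment> \<open>At the simple zero \<open>q\<close> the derivative of the product reduces to the
    square of \<open>deriv vortex q\<close>, so the product is not identically zero.\<close>
  have "((\<lambda>z. vortex z * deriv vortex z) has_field_derivative vortex q * deriv (deriv vortex) q + deriv vortex q * deriv vortex q) (at q)"
    using DERIV_mult'[OF vortex_DERIV[OF q] holomorphic_derivI[OF d open_ball q, of UNIV]] by simp
  then have "deriv (\<lambda>z. vortex z * deriv vortex z) q = vortex q * deriv (deriv vortex) q + deriv vortex q * deriv vortex q"
    by (rule DERIV_imp_deriv)
  moreover have "vortex q = 0" using vortex_zero_iff[OF q] by (simp add: q_def)
  ultimately show "deriv (\<lambda>z. vortex z * deriv vortex z) q \<noteq> 0" using deriv_vortex_pt[of 0] by (simp add: q_def)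
  show "{z \<in> D2. grad (vortex_sol a m) z = 0} \<subseteq> {z \<in> D2. vortex z * deriv vortex z = 0}"
  proof
    fix z assume zz: "z \<in> {z \<in> D2. grad (vortex_sol a m) z = 0}"
    have "vortex z = 0" if d0: "deriv vortex z \<noteq> 0"
    proof (rule ccontr)
      have z: "z \<in> D2" "grad (vortex_sol a m) z = 0" "deriv vortex z \<noteq> 0" using zz d0 by auto
      assume nz: "vortex z \<noteq> 0"
      define x where "x = of_real ((a + m) / 2) * bterm (deriv vortex) (\<lambda>_. 1) (a - 1) (m - 1) vortex z"
      define y where "y = of_real ((a - m) / 2) * bterm (\<lambda>_. 1) (deriv vortex) (a - 1) (m + 1) vortex z"
      have p: "partial b (vortex_sol a m) z = x * b + y * cnj b" for b
        using vortex_sol_partial[of z a b m] z(1) nz by (simp add: x_def y_def)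
      have e: "x * 1 + y * cnj 1 = 0" "x * \<i> + y * cnj \<i> = 0"
        using z(2) unfolding grad_def p zero_prod_def by (simp_all only: prod.inject)
      \<comment> \<open>The combination of the two partial derivatives in which the conjugate linear
        part drops out.\<close>
      have "2 * x = (x * 1 + y * cnj 1) - \<i> * (x * \<i> + y * cnj \<i>)" by (simp add: algebra_simps)
      then have "x = 0" unfolding e by simp
      moreover have "homog (a - 1) (m - 1) (vortex z) \<noteq> 0"
        using norm_homog[OF nz, of "a - 1" "m - 1"] nz by auto
      moreover have "(a + m) / 2 \<noteq> 0" using assms(2) by simp
      ultimately show False using z(3) unfolding x_def bterm_def by (simp only: mult_eq_0_iff of_real_eq_0_iff complex_cnj_one one_neq_zero simp_thms)
    qed
    then show "z \<in> {z \<in> D2. vortex z * deriv vortex z = 0}" using zz by auto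
  qed
qed

lemma vortex_sol_smooth: "smooth_on (D2 - range vortex_pt) (vortex_sol a m)"
proof -
  have "open (D2 \<inter> vortex -` (- {0}))"
    by (rule continuous_open_preimage[OF holomorphic_on_imp_continuous_on[OF vortex_hol]]) auto
  moreover have "D2 - range vortex_pt = D2 \<inter> vortex -` (- {0})" using vortex_zero_iff by auto
  ultimately have o: "open (D2 - range vortex_pt)" by simp
  have "hclass vortex a (vortex_sol a m)" unfolding vortex_sol_bterm
    by (intro hclass_term bounded_derivs_const) simp
  then show ?thesis unfolding smooth_on_def
    using hclass_Ck_on[OF _ bounded_derivs_vortex o] vortex_zero_iff by (metis DiffD1 DiffD2 Diff_subset)
qed

text \<open>The formula for the solution is continuous on the closed disc, so it is its own trace;
  smoothness at the angle zero rests on the flatness of \<open>vortex\<close>.\<close>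

lemma vortex_sol_trace:
  assumes "a > 0"
  shows "has_boundary_trace (vortex_sol a m) (vortex_sol a m) \<and> smooth_on_circle (vortex_sol a m)"
proof
  have "continuous_on (cball 0 1) (vortex_sol a m)" unfolding vortex_sol_def[abs_def]
    by (rule continuous_on_compose2[OF continuous_on_homog[OF assms, of UNIV] continuous_on_vortex]) simp
  then show "has_boundary_trace (vortex_sol a m) (vortex_sol a m)"
    unfolding has_boundary_trace_def continuous_on_def
    by (metis ball_subset_cball sphere_cball subsetD tendsto_within_subset)
  show "smooth_on_circle (vortex_sol a m)"
    unfolding vortex_sol_def[abs_def] by (rule smooth_on_circle_vortex[OF assms])
qed

text \<open>For a given test function only finitely many Dirac terms are nonzero, so
  \<open>sums\<close> expresses the infinite sum of distributions. The classical gradient may stand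
  in the equation for \<open>u\<close> because the Hoelder exponent exceeds
  \<open>1\<close>.\<close>

theorem theorem1p2:
  fixes p :: real and j :: nat
  assumes "1 \<le> p" and "p < 2" and "j \<noteq> 0"
  shows "\<exists>(g :: complex \<Rightarrow> complex) (G :: complex \<Rightarrow> complex \<times> complex)
           (q :: nat \<Rightarrow> complex) (u :: complex \<Rightarrow> complex).
      g ` D2 \<subseteq> sphere 0 1 \<and>
      has_weak_gradient D2 g G \<and>
      Lp_on p D2 g \<and> Lp_on p D2 G \<and>
      weak_L2_loc D2 G \<and>
      continuous_up_to_boundary_off (range q) g \<and>
      inj q \<and> isolated_points_in D2 (range q) \<and>
      (\<forall>\<phi>\<in>test_functions D2. distr_div D2 (field_mult (\<lambda>z. \<i> * cnj (g z)) G) \<phi> = 0) \<and>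
      (\<forall>\<phi>\<in>test_functions D2.
         (\<lambda>k. 2 * pi * dirac (q k) \<phi>) sums
           distr_div D2 (field_mult (\<lambda>z. \<i> * cnj (g z)) (perp G)) \<phi>) \<and>
      u \<in> holder_space (sqrt (real j ^ 2 + real j)) D2 \<and>
      (\<forall>\<phi>\<in>test_functions D2. distr_div D2 (field_mult g (grad u)) \<phi> = 0) \<and>
      smooth_on (D2 - range q) u \<and>
      isolated_points_in D2 {z \<in> D2. grad u z = 0} \<and>
      (\<exists>\<tau>. has_boundary_trace u \<tau> \<and> smooth_on_circle \<tau>)"
proof -
  define a where "a = sqrt (real j ^ 2 + real j)"
  have a2: "a\<^sup>2 = (real j)\<^sup>2 + real j" by (simp add: a_def)
  have a0: "a \<ge> 0" by (simp add: a_def)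
  have j: "real j \<ge> 1" using assms(3) by simp
  \<comment> \<open>The inequalities \<open>j\<^sup>2 < j\<^sup>2 + j < (j + 1)\<^sup>2\<close> put
    \<open>a\<close> strictly between consecutive integers, as the Hoelder space requires.\<close>
  have lo: "real j < a" by (rule power2_less_imp_less) (use a2 a0 j in auto)
  have hi: "a < real j + 1" by (rule power2_less_imp_less) (use a2 j in \<open>auto simp: power2_sum\<close>)
  have a1: "a > 1" using lo j by linarith
  have aZ: "a \<notin> \<int>"
  proof
    assume "a \<in> \<int>"
    then obtain n :: int where "a = of_int n" by (auto elim: Ints_cases)
    then have "int j < n" "n < int j + 1" using lo hi by linarith+
    then show False by simp
  qed
  have ai: "a\<^sup>2 = (real_of_int (int j))\<^sup>2 + real_of_int (int j)" using a2 by simp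
  define u where "u = vortex_sol a (int j)"
  have h: "u \<in> holder_space a D2" unfolding u_def vortex_sol_bterm
    by (rule hclass_holder_space[OF hclass_term bounded_derivs_vortex])
      (use bounded_derivs_const a1 aZ in auto)
  have "vortex_phase ` D2 \<subseteq> sphere 0 1" using norm_vortex_phase by auto
  moreover note vortex_weak_gradient vortex_phase_Lp[of p] vortex_grad_Lp[OF assms(1,2)] vortex_grad_weak_L2_loc
    vortex_phase_continuous inj_vortex_pt vortex_pt_isolated
  moreover have "\<forall>\<phi>\<in>test_functions D2. distr_div D2 (field_mult (\<lambda>z. \<i> * cnj (vortex_phase z)) vortex_grad) \<phi> = 0"
    using vortex_phase_div(1) by blast
  moreover have "\<forall>\<phi>\<in>test_functions D2. (\<lambda>k. 2 * pi * dirac (vortex_pt k) \<phi>) sums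
           distr_div D2 (field_mult (\<lambda>z. \<i> * cnj (vortex_phase z)) (perp vortex_grad)) \<phi>"
    using vortex_phase_div(2) by blast
  moreover note h[unfolded a_def]
  moreover have "\<forall>\<phi>\<in>test_functions D2. distr_div D2 (field_mult vortex_phase (grad u)) \<phi> = 0"
    unfolding u_def using vortex_sol_div[OF a1 ai] by blast
  moreover have "smooth_on (D2 - range vortex_pt) u" unfolding u_def by (rule vortex_sol_smooth)
  moreover have "isolated_points_in D2 {z \<in> D2. grad u z = 0}"
    unfolding u_def by (rule vortex_sol_critical_points) (use a1 in auto)
  moreover have "\<exists>\<tau>. has_boundary_trace u \<tau> \<and> smooth_on_circle \<tau>"
    unfolding u_def using vortex_sol_trace[of a "int j"] a1 by (intro exI[of _ "vortex_sol a (int j)"]) simp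
  ultimately show ?thesis
    by (intro exI[of _ vortex_phase] exI[of _ vortex_grad] exI[of _ vortex_pt] exI[of _ u]) (intro conjI)
qed

end
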